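(* Assume that conditions (1)-(11) listed in the context are satisfied, and that the semivariogram $F_\lambda$ is four times differentiable in a neighborhood of zero. Then $\overline{\varphi_1}(h_1)$ is an asymptotically unbiased estimator of the stochastic constraint $\phi_1(a_1)$. More specifically, the following holds: $$\mathbb{E}\left[\overline{\varphi_1}(h_1)-\phi_1(a_1)\right]=d\,\tau_4\,h_1^4\left(B_4-B_2^2\right)+O(h_1^2\,p_n)+o(h_1^4),\qquad \tau_4=\frac{F_\lambda^{(4)}(0)}{4!}.$$
   Context: **Field and data.** $X_\lambda$ is a real-valued, zero-mean, weakly stationary, isotropic random field on $\mathbb{R}^d$ (not necessarily Gaussian) with semivariogram $F_\lambda(r)=\frac12\mathbb{E}[(X_\lambda(\mathbf{s})-X_\lambda(\mathbf{s}'))^2]$ for $\|\mathbf{s}-\mathbf{s}'\|=r$. The data $X^*_i=X^*(\mathbf{s}_i)$, $i=1,\dots,n$, are observed at random sampling points $\mathbf{s}_1,\dots,\mathbf{s}_n$ in a domain $\Omega_n\subset\mathbb{R}^d$ and are modeled as a sample of $X_\lambda$. $|\Omega_n|$ is the area (volume) enclosed by the convex hull of $\Omega_n$. Put $X^*_{i,j}=X^*_i-X^*_j$ and $s_{i,j}=\|\mathbf{s}_i-\mathbf{s}_j\|$. Write $\mathbf{s}_i=L_n\mathbf{U}_i$, with $L_n\propto|\Omega_n|^{1/d}$ and $\mathbf{U}_i$ a random vector in $[0,1]^d$; $\mathbf{U}_{i,j}=\mathbf{U}_i-\mathbf{U}_j$. The asymptotic limit is $n\to\infty$ with $1/|\Omega_n|\to0$.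 **Kernel.** $K$ is an isotropic, bounded, positive kernel, a function of distance with compact support $[0,R]$. Put $m_{K,j}=\int_0^R s^{j-1}K(s)\,ds$ and $B_p=m_{K,d+p}/m_{K,d}$. For a bandwidth $h>0$ and a pair function $A_{i,j}$, $$\langle A_{i,j}\rangle_h=\frac{\sum_{i\ne j}K(s_{i,j}/h)A_{i,j}}{\sum_{i\ne j}K(s_{i,j}/h)}.$$ **Gradient constraints.** $\overline{\varphi_1}(h_1)=d\,\langle (X^*_{i,j})^2\rangle_{h_1}$ and $\phi_1(a)=2d\,F_\lambda(a)$. The step $a_1$ and the bandwidth $h_1$ are linked by the consistency principle $a_1^2=\langle s_{i,j}^2\rangle_{h_1}$; powers of $h_1$ and $a_1$ are not distinguished from their stochastic moments. Put $p_n=h_1/L_n$. Expectations are over both the field values and the sampling positions. "Asymptotically unbiased" means that the bias tends to $0$ faster than each of the two compared quantities. **Conditions.** (1) $\mathbf{U}_1,\dots,\mathbf{U}_n$ are independent and identically distributed. (2) The pdf $f_1$ of $\mathbf{U}_{i,j}$ is continuously differentiable in a neighborhood of zero. (3) The joint pdfs $f_2$ of $(\mathbf{U}_{i,j},\mathbf{U}_{i,k})$ and $f_3$ of $(\mathbf{U}_{i,j},\mathbf{U}_{i,k},\mathbf{U}_{i,l})$ are continuously differentiable in a neighborhood of zero. (4) The conditional pdf of $\mathbf{U}_{i,j}$ given $\mathbf{U}_j=\mathbf{u}$ is uniformly bounded in $\mathbf{u}$. (5) The joint moments of $X^*$ are identical to those of $X_\lambda$; for example, the semivariogram of $X^*$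 is $F_\lambda$. (6) $F_\lambda$ is continuous in a neighborhood of zero. (7) There is a continuous bounded function $\psi_\lambda$ such that $\mathrm{Cov}[(X^*_{i,j})^2,(X^*_{p,q})^2]=\psi_\lambda(s_{i,p},s_{j,q},s_{i,q},s_{j,p})$. (8) For $\epsilon\ll1$ there exist $c_1\ge1$ and continuous functions $g_1,g_2,g_3$ such that, with $\xi>0$ the characteristic length: $\psi_\lambda(0,0,\epsilon s,\epsilon s)=g_1(s)(\epsilon/\xi)^{2c_1}+o((\epsilon/\xi)^{2c_1})$; $\psi_\lambda(\epsilon s_1,\epsilon s_2,0,\epsilon s_3)=g_2(s_1,s_2,s_3)(\epsilon/\xi)^{2c_1}+o((\epsilon/\xi)^{2c_1})$; and $\psi_\lambda(u_3,\|\epsilon\boldsymbol\omega_2+u_3\hat{\boldsymbol\omega}_3-\epsilon\boldsymbol\omega_1\|,\|u_3\hat{\boldsymbol\omega}_3+\epsilon\boldsymbol\omega_2\|,\|u_3\hat{\boldsymbol\omega}_3-\epsilon\boldsymbol\omega_1\|)=g_3(u_3,\omega_1,\omega_2,\boldsymbol\theta_1,\boldsymbol\theta_2,\boldsymbol\theta_3)(\epsilon/\xi)^{2c_1}+o((\epsilon/\xi)^{2c_1})$, where $\boldsymbol\omega_i=\omega_i\hat{\boldsymbol\omega}_i$ in spherical polar coordinates, $\omega_i=\|\boldsymbol\omega_i\|$, and $\boldsymbol\theta_i$ are the angles of the unit vector $\hat{\boldsymbol\omega}_i$. (9) The integral $\int du_3\,u_3^{d-1}g_3(u_3,\omega_1,\omega_2,\boldsymbol\theta_1,\boldsymbol\theta_2,\boldsymbol\theta_3)$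 over $u_3\ge 0$ is bounded. (10) The bandwidths tend to $0$ as $n\to\infty$. (11) $|\Omega_n|/n\to0$ as $n\to\infty$.
   Formalization: The leading term is proved as 2d τ_4 h_1^4 (B_4 − B_2^2) instead of the printed d τ_4 h_1^4 (B_4 − B_2^2); with F_λ half the mean squared increment, the printed constant is too small by a factor of 2. *)

theory Defs
  imports "HOL-Probability.Probability" "HOL-Library.Landau_Symbols"
begin

section \<open>Random fields and their moments\<close>

definition covariance :: "'w measure \<Rightarrow> ('w \<Rightarrow> real) \<Rightarrow> ('w \<Rightarrow> real) \<Rightarrow> real" where
  "covariance M Y Z =
     (\<integral>\<omega>. (Y \<omega> - (\<integral>\<omega>'. Y \<omega>' \<partial>M)) * (Z \<omega> - (\<integral>\<omega>'. Z \<omega>' \<partial>M)) \<partial>M)"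

definition stationary_isotropic_field ::
    "'w measure \<Rightarrow> ('a::euclidean_space \<Rightarrow> 'w \<Rightarrow> real) \<Rightarrow> bool" where
  "stationary_isotropic_field P X \<longleftrightarrow>
     prob_space P \<and>
     (\<forall>x. X x \<in> borel_measurable P \<and> integrable P (\<lambda>\<omega>. (X x \<omega>)\<^sup>2)) \<and>
     (\<forall>x. (\<integral>\<omega>. X x \<omega> \<partial>P) = 0) \<and>
     (\<exists>C :: real \<Rightarrow> real. \<forall>x y. (\<integral>\<omega>. X x \<omega> * X y \<omega> \<partial>P) = C (norm (x - y)))"

text \<open>The semivariogram is regarded as an even function on the whole real line, so that
  differentiability ``in a neighborhood of zero'' is two-sided.  With one-sided derivatives at zero
  odd powers such as the linear term of the exponential model would be admitted.\<close>

definition is_semivariogram ::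
    "'w measure \<Rightarrow> ('a::euclidean_space \<Rightarrow> 'w \<Rightarrow> real) \<Rightarrow> (real \<Rightarrow> real) \<Rightarrow> bool" where
  "is_semivariogram P X F \<longleftrightarrow>
     (\<forall>r x y. norm (x - y) = \<bar>r\<bar> \<longrightarrow> F r = (\<integral>\<omega>. (X x \<omega> - X y \<omega>)\<^sup>2 \<partial>P) / 2)"

text \<open>The equivalence of the two \<open>has_bochner_integral\<close> statements says that a joint
  moment exists for one field iff it exists for the other, and that the values then agree.\<close>

definition same_joint_moments ::
    "'v measure \<Rightarrow> ('a \<Rightarrow> 'v \<Rightarrow> real) \<Rightarrow> 'w measure \<Rightarrow> ('a \<Rightarrow> 'w \<Rightarrow> real) \<Rightarrow> bool" where
  "same_joint_moments P X Q Y \<longleftrightarrow>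
     (\<forall>xs v. has_bochner_integral P (\<lambda>\<omega>. \<Prod>x\<leftarrow>xs. X x \<omega>) v \<longleftrightarrow>
             has_bochner_integral Q (\<lambda>\<omega>. \<Prod>x\<leftarrow>xs. Y x \<omega>) v)"

definition squared_increment_covariance ::
    "'w measure \<Rightarrow> ('a::euclidean_space \<Rightarrow> 'w \<Rightarrow> real) \<Rightarrow>
     (real \<Rightarrow> real \<Rightarrow> real \<Rightarrow> real \<Rightarrow> real) \<Rightarrow> bool" where
  "squared_increment_covariance Q X \<psi> \<longleftrightarrow>
     (\<forall>x y. integrable Q (\<lambda>\<omega>. (X x \<omega> - X y \<omega>) ^ 4)) \<and>
     (\<forall>x\<^sub>i x\<^sub>j x\<^sub>p x\<^sub>q.
        covariance Q (\<lambda>\<omega>. (X x\<^sub>i \<omega> - X x\<^sub>j \<omega>)\<^sup>2) (\<lambda>\<omega>. (X x\<^sub>p \<omega> - X x\<^sub>q \<omega>)\<^sup>2) =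
        \<psi> (norm (x\<^sub>i - x\<^sub>p)) (norm (x\<^sub>j - x\<^sub>q)) (norm (x\<^sub>i - x\<^sub>q)) (norm (x\<^sub>j - x\<^sub>p)))"

section \<open>Densities and smoothness\<close>

definition C1_near_zero :: "('b::real_normed_vector \<Rightarrow> real) \<Rightarrow> bool" where
  "C1_near_zero f \<longleftrightarrow>
     (\<exists>S (f' :: 'b \<Rightarrow> 'b \<Rightarrow>\<^sub>L real). open S \<and> 0 \<in> S \<and>
        (\<forall>x\<in>S. (f has_derivative blinfun_apply (f' x)) (at x)) \<and> continuous_on S f')"

definition is_pdf :: "'w measure \<Rightarrow> ('w \<Rightarrow> 'b::euclidean_space) \<Rightarrow> ('b \<Rightarrow> real) \<Rightarrow> bool" where
  "is_pdf M Y f \<longleftrightarrow>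
     f \<in> borel_measurable borel \<and> (\<forall>y. 0 \<le> f y) \<and> distributed M lborel Y (\<lambda>y. ennreal (f y))"

text \<open>\<open>g z\<close> is a density of \<open>Y\<close> conditionally on \<open>Z = z\<close>.\<close>

definition is_conditional_pdf ::
    "'w measure \<Rightarrow> ('w \<Rightarrow> 'b::euclidean_space) \<Rightarrow> ('w \<Rightarrow> 'c::euclidean_space) \<Rightarrow>
     ('c \<Rightarrow> 'b \<Rightarrow> real) \<Rightarrow> bool" where
  "is_conditional_pdf M Y Z g \<longleftrightarrow>
     case_prod g \<in> borel_measurable (borel \<Otimes>\<^sub>M borel) \<and> (\<forall>z y. 0 \<le> g z y) \<and>
     (\<forall>A\<in>sets borel. \<forall>B\<in>sets borel.
        emeasure M {\<omega> \<in> space M. Y \<omega> \<in> A \<and> Z \<omega> \<in> B} =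
        (\<integral>\<^sup>+z\<in>B. (\<integral>\<^sup>+y\<in>A. ennreal (g z y) \<partial>lborel) \<partial>distr M borel Z))"

definition four_times_differentiable_near_zero :: "(real \<Rightarrow> real) \<Rightarrow> bool" where
  "four_times_differentiable_near_zero F \<longleftrightarrow>
     (\<exists>\<delta>>0. \<forall>x. \<bar>x\<bar> < \<delta> \<longrightarrow> (\<forall>k<4. (deriv ^^ k) F differentiable (at x)))"

section \<open>Kernel averages and gradient constraints\<close>

definition compact_kernel :: "(real \<Rightarrow> real) \<Rightarrow> real \<Rightarrow> bool" where
  "compact_kernel K R \<longleftrightarrow>
     0 < R \<and> K \<in> borel_measurable borel \<and> bounded (K ` {0..}) \<and>
     (\<forall>s. 0 \<le> s \<and> s < R \<longrightarrow> 0 < K s) \<and> 0 \<le> K R \<and> (\<forall>s>R. K s = 0)"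

definition kernel_moment :: "(real \<Rightarrow> real) \<Rightarrow> real \<Rightarrow> nat \<Rightarrow> real" where
  "kernel_moment K R j = (LINT s:{0..R}|lborel. s ^ (j - 1) * K s)"

definition moment_ratio :: "(real \<Rightarrow> real) \<Rightarrow> real \<Rightarrow> nat \<Rightarrow> nat \<Rightarrow> real" where
  "moment_ratio K R d p = kernel_moment K R (d + p) / kernel_moment K R d"

text \<open>If no pair of points is within range of the kernel, the quotient is \<open>0 / 0 = 0\<close>.\<close>

definition kernel_average ::
    "(real \<Rightarrow> real) \<Rightarrow> real \<Rightarrow> nat \<Rightarrow> (nat \<Rightarrow> 'a::euclidean_space) \<Rightarrow> (nat \<Rightarrow> nat \<Rightarrow> real) \<Rightarrow> real" where
  "kernel_average K h n s A =
     (\<Sum>(i, j) \<in> {(i, j). i \<in> {1..n} \<and> j \<in> {1..n} \<and> i \<noteq> j}. K (norm (s i - s j) / h) * A i j) /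
     (\<Sum>(i, j) \<in> {(i, j). i \<in> {1..n} \<and> j \<in> {1..n} \<and> i \<noteq> j}. K (norm (s i - s j) / h))"

definition sample_gradient_constraint ::
    "(real \<Rightarrow> real) \<Rightarrow> real \<Rightarrow> nat \<Rightarrow> (nat \<Rightarrow> 'a::euclidean_space) \<Rightarrow> (nat \<Rightarrow> real) \<Rightarrow> real" where
  "sample_gradient_constraint K h n s x =
     real DIM('a) * kernel_average K h n s (\<lambda>i j. (x i - x j)\<^sup>2)"

text \<open>The expectation of a squared increment at distance \<open>r\<close> is \<open>2 * F r\<close>.  Hence, with
  \<open>F r = \<tau>\<^sub>2 * r\<^sup>2 + \<tau>\<^sub>4 * r ^ 4 + o(r ^ 4)\<close> and \<open>a\<^sup>2 = \<langle>r\<^sup>2\<rangle>\<close>, the mean difference of the two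
  constraints is to leading order
  \<open>2 * d * (\<langle>F r\<rangle> - F a) = 2 * d * \<tau>\<^sub>4 * (\<langle>r ^ 4\<rangle> - \<langle>r\<^sup>2\<rangle>\<^sup>2)\<close>, that is
  \<open>2 * d * \<tau>\<^sub>4 * h ^ 4 * (B\<^sub>4 - B\<^sub>2\<^sup>2)\<close>.  So with \<open>F\<close> half the mean squared increment the
  coefficient is \<open>2 * d * \<tau>\<^sub>4\<close>; the value \<open>d * \<tau>\<^sub>4\<close> in the source is off by a factor of two.\<close>

definition gradient_constraint :: "nat \<Rightarrow> (real \<Rightarrow> real) \<Rightarrow> real \<Rightarrow> real" where
  "gradient_constraint d F a = 2 * real d * F a"

text \<open>\<open>M\<close> is to be the product of the probability space of the field values and that of the
  sampling positions, that is, the positions are independent of the field.\<close>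

definition asymptotically_unbiased ::
    "'w measure \<Rightarrow> (nat \<Rightarrow> 'w \<Rightarrow> real) \<Rightarrow> (nat \<Rightarrow> 'w \<Rightarrow> real) \<Rightarrow> bool" where
  "asymptotically_unbiased M est target \<longleftrightarrow>
     (\<lambda>n. \<integral>\<omega>. est n \<omega> - target n \<omega> \<partial>M) \<longlonglongrightarrow> 0 \<and>
     (\<lambda>n. \<integral>\<omega>. est n \<omega> - target n \<omega> \<partial>M) \<in> o(\<lambda>n. \<integral>\<omega>. est n \<omega> \<partial>M) \<and>
     (\<lambda>n. \<integral>\<omega>. est n \<omega> - target n \<omega> \<partial>M) \<in> o(\<lambda>n. \<integral>\<omega>. target n \<omega> \<partial>M)"

section \<open>Short-distance expansion of the covariance of squared increments\<close>

text \<open>Angles of unit vectors are represented by the unit vectors themselves.\<close>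

definition short_distance_expansion ::
    "(real \<Rightarrow> real \<Rightarrow> real \<Rightarrow> real \<Rightarrow> real) \<Rightarrow> real \<Rightarrow> real \<Rightarrow>
     (real \<Rightarrow> real) \<Rightarrow> (real \<Rightarrow> real \<Rightarrow> real \<Rightarrow> real) \<Rightarrow>
     (real \<Rightarrow> real \<Rightarrow> real \<Rightarrow> 'a::euclidean_space \<Rightarrow> 'a \<Rightarrow> 'a \<Rightarrow> real) \<Rightarrow> bool" where
  "short_distance_expansion \<psi> \<xi> c g\<^sub>1 g\<^sub>2 g\<^sub>3 \<longleftrightarrow>
     continuous_on {0..} g\<^sub>1 \<and>
     continuous_on ({0..} \<times> {0..} \<times> {0..}) (\<lambda>(s\<^sub>1, s\<^sub>2, s\<^sub>3). g\<^sub>2 s\<^sub>1 s\<^sub>2 s\<^sub>3) \<and>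
     continuous_on ({0..} \<times> {0..} \<times> {0..} \<times> sphere 0 1 \<times> sphere 0 1 \<times> sphere 0 1)
       (\<lambda>(u, \<omega>\<^sub>1, \<omega>\<^sub>2, e\<^sub>1, e\<^sub>2, e\<^sub>3). g\<^sub>3 u \<omega>\<^sub>1 \<omega>\<^sub>2 e\<^sub>1 e\<^sub>2 e\<^sub>3) \<and>
     (\<forall>s\<ge>0. (\<lambda>\<epsilon>. \<psi> 0 0 (\<epsilon> * s) (\<epsilon> * s) - g\<^sub>1 s * (\<epsilon> / \<xi>) powr (2 * c))
        \<in> o[at_right 0](\<lambda>\<epsilon>. (\<epsilon> / \<xi>) powr (2 * c))) \<and>
     (\<forall>s\<^sub>1\<ge>0. \<forall>s\<^sub>2\<ge>0. \<forall>s\<^sub>3\<ge>0.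
        (\<lambda>\<epsilon>. \<psi> (\<epsilon> * s\<^sub>1) (\<epsilon> * s\<^sub>2) 0 (\<epsilon> * s\<^sub>3) - g\<^sub>2 s\<^sub>1 s\<^sub>2 s\<^sub>3 * (\<epsilon> / \<xi>) powr (2 * c))
        \<in> o[at_right 0](\<lambda>\<epsilon>. (\<epsilon> / \<xi>) powr (2 * c))) \<and>
     (\<forall>u\<ge>0. \<forall>\<omega>\<^sub>1\<ge>0. \<forall>\<omega>\<^sub>2\<ge>0. \<forall>e\<^sub>1\<in>sphere 0 1. \<forall>e\<^sub>2\<in>sphere 0 1. \<forall>e\<^sub>3\<in>sphere 0 1.
        (\<lambda>\<epsilon>. \<psi> u (norm (\<epsilon> *\<^sub>R \<omega>\<^sub>2 *\<^sub>R e\<^sub>2 + u *\<^sub>R e\<^sub>3 - \<epsilon> *\<^sub>R \<omega>\<^sub>1 *\<^sub>R e\<^sub>1))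
                 (norm (u *\<^sub>R e\<^sub>3 + \<epsilon> *\<^sub>R \<omega>\<^sub>2 *\<^sub>R e\<^sub>2))
                 (norm (u *\<^sub>R e\<^sub>3 - \<epsilon> *\<^sub>R \<omega>\<^sub>1 *\<^sub>R e\<^sub>1))
               - g\<^sub>3 u \<omega>\<^sub>1 \<omega>\<^sub>2 e\<^sub>1 e\<^sub>2 e\<^sub>3 * (\<epsilon> / \<xi>) powr (2 * c))
        \<in> o[at_right 0](\<lambda>\<epsilon>. (\<epsilon> / \<xi>) powr (2 * c)))"

text \<open>The radii \<open>\<omega>\<^sub>1\<close>, \<open>\<omega>\<^sub>2\<close> are pair distances divided by the bandwidth, hence range over
  the support \<open>{0..R}\<close> of the kernel.  Since \<open>g\<^sub>3\<close> is homogeneous in \<open>(\<omega>\<^sub>1, \<omega>\<^sub>2)\<close>, a bound over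
  all radii could hold only if the integral vanished.\<close>

definition radial_integral_bounded ::
    "real \<Rightarrow> (real \<Rightarrow> real \<Rightarrow> real \<Rightarrow> 'a::euclidean_space \<Rightarrow> 'a \<Rightarrow> 'a \<Rightarrow> real) \<Rightarrow> bool" where
  "radial_integral_bounded R g\<^sub>3 \<longleftrightarrow>
     (\<exists>C. \<forall>\<omega>\<^sub>1\<in>{0..R}. \<forall>\<omega>\<^sub>2\<in>{0..R}. \<forall>e\<^sub>1\<in>sphere 0 1. \<forall>e\<^sub>2\<in>sphere 0 1. \<forall>e\<^sub>3\<in>sphere 0 1.
        set_integrable lborel {0..} (\<lambda>u. u ^ (DIM('a) - 1) * g\<^sub>3 u \<omega>\<^sub>1 \<omega>\<^sub>2 e\<^sub>1 e\<^sub>2 e\<^sub>3) \<and>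
        \<bar>LINT u:{0..}|lborel. u ^ (DIM('a) - 1) * g\<^sub>3 u \<omega>\<^sub>1 \<omega>\<^sub>2 e\<^sub>1 e\<^sub>2 e\<^sub>3\<bar> \<le> C)"

end

theory Submission
  imports Defs
begin

text \<open>Given the positions, the field average of the estimator is \<open>2 * d\<close> times the kernel average
  \<open>\<langle>F r\<rangle>\<close>.  Insert \<open>F r = \<tau>\<^sub>2 * r\<^sup>2 + \<tau>\<^sub>4 * r ^ 4 + o(r ^ 4)\<close>: the quadratic terms of \<open>\<langle>F r\<rangle> - F a\<close>
  cancel by the consistency principle, which leaves \<open>\<tau>\<^sub>4 * (\<langle>r ^ 4\<rangle> - \<langle>r\<^sup>2\<rangle>\<^sup>2)\<close>.

  The scale \<open>h * L = 1\<close> separates two regimes.  If \<open>h * L < 1\<close>, then \<open>h ^ 4 \<le> h\<^sup>2 * (h / L)\<close>, so the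
  crude bound \<open>O(h ^ 4)\<close> on all terms suffices; here it may happen that no pair is within range.
  If \<open>h * L \<ge> 1\<close>, then \<open>n\<^sup>2 * (h / L) ^ d \<ge> (n / L ^ d)\<^sup>2\<close>, so the expected number of pairs within
  range tends to infinity.  Then the sums of \<open>K(r / h) * (r / h) ^ q\<close> over pairs concentrate in
  mean square around multiples of \<open>f\<^sub>1 0\<close> times the kernel moments, with \<open>f\<^sub>1 0 > 0\<close> by a pigeonhole
  argument, and the quotients, being bounded, converge in mean to the moment ratios.

  For unbiasedness, either \<open>\<tau>\<^sub>2 > 0\<close>, and the bias is small compared with \<open>\<tau>\<^sub>2\<close> times the mean of
  \<open>\<langle>r\<^sup>2\<rangle>\<close>, or \<open>F\<close> vanishes identically.\<close>

section \<open>Radial integrals\<close>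

text \<open>The estimator is a quotient of two random sums, and nothing in the conditions keeps its
  denominator away from zero: \<open>h\<close> may shrink so fast that typically no pair is in
  range. Two features of the proof come from this. The step \<open>a\<close> is tied to the same
  random positions, so the quadratic terms are cancelled for each fixed configuration, before any
  expectation is taken. What remains contains the square of a random quotient, whose limit requires
  convergence in mean of the quotient and not merely of its expectation. Moreover, when pairs in
  range are rare, the mean of \<open>a\<^sup>2\<close> can be far below \<open>h\<^sup>2\<close>, so
  comparing the bias with the constraints by powers of \<open>h\<close> would fail. For unbiasedness
  both constraints are therefore compared with \<open>\<tau>2 * a\<^sup>2\<close> up to a small
  multiple of \<open>a\<^sup>2\<close>, an estimate that survives the default
  \<open>0 / 0 = 0\<close>. The alternative for \<open>\<tau>2\<close> rests on
  \<open>F (n * r) \<le> n\<^sup>2 * F r\<close>, which comes from telescoping the field along a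
  line.\<close>

lemma distr_norm_lborel:
  "distr lborel borel (norm :: 'a::euclidean_space \<Rightarrow> real) =
     density lborel (\<lambda>r. ennreal (real DIM('a) * unit_ball_vol (real DIM('a)) *
       (r ^ (DIM('a) - 1) * indicator {0..} r)))"
    (is "?N = ?D")
proof (rule measure_eqI_generator_eq)
  let ?V = "real DIM('a) * unit_ball_vol (real DIM('a))"
  have V: "?V > 0" by simp
  \<comment> \<open>Half-lines form an intersection-stable generator of the Borel sets, so it
    suffices to compare the masses of \<open>{..a}\<close>. Both are the volume of the ball of
    radius \<open>a\<close>, and zero for negative \<open>a\<close>, whence
    \<open>max 0 a\<close>.\<close>
  have N: "emeasure ?N {..a} = ennreal (unit_ball_vol DIM('a) * (max 0 a) ^ DIM('a))" for a
  proof (cases "a \<ge> 0")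
    case True
    have "norm -` {..a} = cball (0::'a) a" by auto
    then show ?thesis using True by (simp add: emeasure_distr emeasure_cball)
  next
    case False
    then have "norm -` {..a} = ({} :: 'a set)"
      by (auto intro: order.trans[OF norm_ge_zero])
    then show ?thesis using False by (simp add: emeasure_distr)
  qed
  have D: "emeasure ?D {..a} = ennreal (unit_ball_vol DIM('a) * (max 0 a) ^ DIM('a))" for a
  proof (cases "a \<ge> 0")
    case True
    have "emeasure ?D {..a} =
        (\<integral>\<^sup>+r. ennreal (?V * (r ^ (DIM('a) - 1) * indicator {0..} r)) * indicator {..a} r \<partial>lborel)"
      by (subst emeasure_density) auto
    also have "\<dots> = (\<integral>\<^sup>+r. ennreal (?V * r ^ (DIM('a) - 1)) * indicator {0..a} r \<partial>lborel)"
      by (intro nn_integral_cong) (auto split: split_indicator)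
    also have "\<dots> = ennreal (unit_ball_vol DIM('a) * a ^ DIM('a) - unit_ball_vol DIM('a) * 0 ^ DIM('a))"
      using True V by (intro nn_integral_FTC_Icc) (auto intro!: derivative_eq_intros mult_nonneg_nonneg)
    finally show ?thesis using True by simp
  next
    case False
    have "emeasure ?D {..a} =
        (\<integral>\<^sup>+r. ennreal (?V * (r ^ (DIM('a) - 1) * indicator {0..} r)) * indicator {..a} r \<partial>lborel)"
      by (subst emeasure_density) auto
    also have "\<dots> = (\<integral>\<^sup>+r. 0 \<partial>(lborel::real measure))"
      using False by (intro nn_integral_cong) (auto split: split_indicator)
    finally show ?thesis using False by simp
  qed
  show "Int_stable (range (atMost :: real \<Rightarrow> _))"
    by (auto simp: Int_stable_def)
  show "emeasure ?N X = emeasure ?D X" if "X \<in> range atMost" for X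
    using that N D by auto
  show "sets ?N = sigma_sets UNIV (range atMost)" "sets ?D = sigma_sets UNIV (range atMost)"
    by (simp_all add: borel_eq_atMost)
  show "range (\<lambda>i::nat. {..real i}) \<subseteq> range atMost" by auto
  show "(\<Union>i::nat. {..real i}) = UNIV"
    by (auto intro: real_arch_simple)
  show "emeasure ?N {..real i} \<noteq> \<infinity>" for i unfolding N by simp
qed auto

text \<open>Polar coordinates: the norm pushes Lebesgue measure forward to a density proportional to
  \<open>r ^ (d - 1)\<close>, and rescaling \<open>r\<close> by \<open>p\<close> extracts the factor
  \<open>p ^ d\<close>. Cutting off at \<open>R\<close> gives the integral the shape of
  \<open>kernel_moment\<close>.\<close>

lemma integral_norm_scaled:
  fixes g :: "real \<Rightarrow> real"
  assumes [measurable]: "g \<in> borel_measurable borel" and g: "\<And>t. t > R \<Longrightarrow> g t = 0"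
    and p: "p > 0"
  shows "(\<integral>x. g (norm (x::'a::euclidean_space) / p) \<partial>lborel) =
    p ^ DIM('a) * (real DIM('a) * unit_ball_vol (real DIM('a)) *
      (LINT r:{0..R}|lborel. r ^ (DIM('a) - 1) * g r))"
proof -
  let ?V = "real DIM('a) * unit_ball_vol (real DIM('a))"
  have V: "?V > 0" by simp
  have nn: "0 \<le> ?V * (r ^ (DIM('a) - 1) * indicator {0..} r)" for r :: real
    by (cases "r \<ge> 0") (auto intro!: mult_nonneg_nonneg)
  have "(\<integral>x. g (norm (x::'a) / p) \<partial>lborel) = (\<integral>r. g (r / p) \<partial>distr lborel borel (norm :: 'a \<Rightarrow> real))"
    by (subst integral_distr) auto
  also have "\<dots> = (\<integral>r. ?V * (r ^ (DIM('a) - 1) * indicator {0..} r) * g (r / p) \<partial>lborel)"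
    unfolding distr_norm_lborel using nn by (subst integral_density) auto
  also have "\<dots> = p * (\<integral>r. ?V * ((p * r) ^ (DIM('a) - 1) * indicator {0..} (p * r)) * g r \<partial>lborel)"
    using p by (subst lborel_integral_real_affine[of p _ 0]) auto
  also have "(\<lambda>r. ?V * ((p * r) ^ (DIM('a) - 1) * indicator {0..} (p * r)) * g r) =
      (\<lambda>r. (?V * p ^ (DIM('a) - 1)) * (indicator {0..R} r * (r ^ (DIM('a) - 1) * g r)))"
    using p g by (auto simp: fun_eq_iff power_mult_distrib zero_le_mult_iff split: split_indicator)
  also have "p * (\<integral>r. \<dots> r \<partial>lborel) =
      p * (?V * p ^ (DIM('a) - 1)) * (LINT r:{0..R}|lborel. r ^ (DIM('a) - 1) * g r)"
    unfolding set_lebesgue_integral_def by simp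
  also have "\<dots> = (p * p ^ (DIM('a) - 1)) * (?V * (LINT r:{0..R}|lborel. r ^ (DIM('a) - 1) * g r))"
    by simp
  also have "p * p ^ (DIM('a) - 1) = p ^ DIM('a)"
    by (simp add: power_eq_if)
  finally show ?thesis .
qed

section \<open>Semivariograms near the origin\<close>

text \<open>Evenness removes the odd derivatives at zero. The fourth derivative exists but may be
  discontinuous, so Taylor's formula with Lagrange remainder is used only up to order three; the
  last order comes from differentiability of the third derivative at zero, that is, from the limit
  of \<open>D 3 r / r\<close>.\<close>

lemma even_quartic_expansion:
  assumes smooth: "four_times_differentiable_near_zero F"
    and even: "\<And>r. F (- r) = F r" and zero: "F 0 = 0" and \<epsilon>: "\<epsilon> > 0"
  shows "\<exists>\<delta>>0. \<forall>r. 0 \<le> r \<and> r < \<delta> \<longrightarrow>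
    \<bar>F r - (deriv ^^ 2) F 0 / 2 * r\<^sup>2 - (deriv ^^ 4) F 0 / fact 4 * r ^ 4\<bar> \<le> \<epsilon> * r ^ 4"
proof -
  define D where "D k = (deriv ^^ k) F" for k
  obtain \<delta> where \<delta>: "\<delta> > 0" and diff: "\<And>x k. \<bar>x\<bar> < \<delta> \<Longrightarrow> k < 4 \<Longrightarrow> D k differentiable (at x)"
    using smooth unfolding four_times_differentiable_near_zero_def D_def by blast
  have der: "(D k has_field_derivative D (Suc k) x) (at x)" if "\<bar>x\<bar> < \<delta>" "k < 4" for x k
    using diff[OF that] by (simp add: D_def DERIV_deriv_iff_real_differentiable)
  \<comment> \<open>Differentiation alternates the parity. The induction stays inside the interval
    of radius \<open>\<delta>\<close>, the only place where the derivatives are known to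
    exist.\<close>
  have refl: "D k (- x) = (- 1) ^ k * D k x" if "\<bar>x\<bar> < \<delta>" "k < 4" for x k
    using that
  proof (induction k arbitrary: x)
    case 0
    then show ?case by (simp add: D_def even)
  next
    case (Suc k)
    have "((\<lambda>y. (- 1) ^ k * D k (- y)) has_field_derivative (- 1) ^ k * (D (Suc k) (- x) * - 1)) (at x)"
      using Suc.prems
      by (intro DERIV_cmult DERIV_chain'[where g = "D k" and f = uminus] der derivative_eq_intros) auto
    moreover have "\<forall>\<^sub>F y in nhds x. y \<in> {-\<delta><..<\<delta>}"
      using Suc.prems by (intro eventually_nhds_in_open) auto
    then have "\<forall>\<^sub>F y in nhds x. (- 1) ^ k * D k (- y) = D k y"
    proof eventually_elim
      case (elim y)
      then have "D k (- y) = (- 1) ^ k * D k y" using Suc by (intro Suc.IH) auto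
      then show ?case by (simp flip: power_mult_distrib mult.assoc)
    qed
    ultimately have "(D k has_field_derivative (- 1) ^ k * (D (Suc k) (- x) * - 1)) (at x)"
      by (subst DERIV_cong_ev[OF refl _ refl, symmetric]) auto
    from DERIV_unique[OF this der[of x k]] Suc.prems
    have "(- 1) ^ k * D (Suc k) (- x) = - D (Suc k) x" by simp
    then have "(- 1) ^ k * ((- 1) ^ k * D (Suc k) (- x)) = (- 1) ^ k * (- D (Suc k) x)" by simp
    then show ?case by (simp flip: power_mult_distrib mult.assoc)
  qed
  have D0: "D 0 0 = 0" "D 1 0 = 0" "D 3 0 = 0"
    using refl[of 0 1] refl[of 0 3] \<delta> zero by (simp_all add: D_def)
  have "(\<lambda>r. (D 3 r - D 3 0) / (r - 0)) \<midarrow>0\<rightarrow> D 4 0"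
    using der[of 0 3] \<delta> by (simp add: has_field_derivative_iff)
  then have "\<forall>\<^sub>F r in at 0. dist ((D 3 r - D 3 0) / (r - 0)) (D 4 0) < \<epsilon>"
    using \<epsilon> by (rule tendstoD)
  then obtain \<delta>' where \<delta>': "\<delta>' > 0"
    and D3: "\<And>r. r \<noteq> 0 \<Longrightarrow> \<bar>r\<bar> < \<delta>' \<Longrightarrow> \<bar>D 3 r / r - D 4 0\<bar> < \<epsilon>"
    by (auto simp: eventually_at dist_real_def D0)
  \<comment> \<open>\<open>G m\<close> is the \<open>m\<close>-th derivative of \<open>F\<close>
    minus its quartic Taylor polynomial. Its values at zero vanish for \<open>m < 3\<close>, so in
    the Maclaurin formula only the remainder with \<open>G 3 t = D 3 t - D 4 0 * t\<close>
    survives.\<close>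
  define G :: "nat \<Rightarrow> real \<Rightarrow> real" where
    "G m r = (if m = 0 then D 0 r - D 2 0 / 2 * r\<^sup>2 - D 4 0 / 24 * r ^ 4
      else if m = 1 then D 1 r - D 2 0 * r - D 4 0 / 6 * r ^ 3
      else if m = 2 then D 2 r - D 2 0 - D 4 0 / 2 * r\<^sup>2
      else D 3 r - D 4 0 * r)" for m r
  show ?thesis
  proof (intro exI[of _ "min \<delta> \<delta>'"] conjI allI impI)
    fix r assume r: "0 \<le> r \<and> r < min \<delta> \<delta>'"
    show "\<bar>F r - (deriv ^^ 2) F 0 / 2 * r\<^sup>2 - (deriv ^^ 4) F 0 / fact 4 * r ^ 4\<bar> \<le> \<epsilon> * r ^ 4"
    proof (cases "r = 0")
      case True
      then show ?thesis by (simp add: zero)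
    next
      case False
      have G: "DERIV (G m) t :> G (Suc m) t" if "m < 3" "0 \<le> t" "t \<le> r" for m t
      proof -
        have t: "\<bar>t\<bar> < \<delta>" using that r by auto
        have "m = 0 \<or> m = 1 \<or> m = 2" using that(1) by arith
        then consider "m = 0" | "m = 1" | "m = 2" by blast
        then show ?thesis
          using der[OF t, of m] unfolding G_def
          by cases (auto intro!: derivative_eq_intros simp: numeral_3_eq_3 numeral_2_eq_2)
      qed
      obtain t where t: "0 < t" "t < r"
        and eq: "G 0 r = (\<Sum>m<3. (G m 0 / fact m) * r ^ m) + (G 3 t / fact 3) * r ^ 3"
        using Maclaurin[of r 3 G "G 0"] G r False by auto
      have "\<bar>G 3 t\<bar> = \<bar>D 3 t / t - D 4 0\<bar> * t"
        using t by (simp add: G_def abs_mult_pos field_simps)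
      also have "\<dots> \<le> \<epsilon> * r"
        using D3[of t] t r \<epsilon> by (intro mult_mono) auto
      finally have "\<bar>G 3 t\<bar> \<le> \<epsilon> * r" .
      moreover have "G 0 r = G 3 t / 6 * r ^ 3"
        using eq D0 by (simp add: G_def lessThan_nat_numeral lessThan_Suc fact_numeral)
      then have "G 0 r = G 3 t * (r ^ 3 / 6)" by simp
      then have "\<bar>G 0 r\<bar> = \<bar>G 3 t\<bar> * (r ^ 3 / 6)"
        using r by (simp only: abs_mult) simp
      ultimately have "\<bar>G 0 r\<bar> \<le> \<epsilon> * r * (r ^ 3 / 6)"
        using r by (simp only:) (intro mult_right_mono, auto)
      also have "\<dots> \<le> \<epsilon> * r ^ 4"
        using \<epsilon> r by (simp add: power_eq_if mult_ac)
      finally show ?thesis by (simp add: G_def D_def fact_numeral)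
    qed
  qed (use \<delta> \<delta>' in auto)
qed

lemma semivariogram_eq:
  "is_semivariogram P X F \<Longrightarrow> norm (x - y) = \<bar>r\<bar> \<Longrightarrow> F r = (\<integral>\<omega>. (X x \<omega> - X y \<omega>)\<^sup>2 \<partial>P) / 2"
  unfolding is_semivariogram_def by blast

lemma
  fixes X :: "'a::euclidean_space \<Rightarrow> 'v \<Rightarrow> real"
  assumes F: "is_semivariogram P X F"
  shows semivariogram_nonneg: "0 \<le> F r"
    and semivariogram_even: "F (- r) = F r"
    and semivariogram_0: "F 0 = 0"
proof -
  obtain e :: 'a where e: "norm e = 1" using nonempty_Basis norm_Basis by blast
  have *: "F r = (\<integral>\<omega>. (X (r *\<^sub>R e) \<omega> - X 0 \<omega>)\<^sup>2 \<partial>P) / 2"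
    "F (- r) = (\<integral>\<omega>. (X (r *\<^sub>R e) \<omega> - X 0 \<omega>)\<^sup>2 \<partial>P) / 2"
    by (rule semivariogram_eq[OF F], simp add: e)+
  show "F (- r) = F r" unfolding * ..
  show "0 \<le> F r" unfolding * by simp
  show "F 0 = 0" by (subst semivariogram_eq[OF F, of 0 0]) simp_all
qed

lemma stationary_isotropic_field_integrable_mult:
  assumes "stationary_isotropic_field P X"
  shows "integrable P (\<lambda>\<omega>. X x \<omega> * X y \<omega>)"
proof -
  have [measurable]: "X x \<in> borel_measurable P"
    and sq: "integrable P (\<lambda>\<omega>. (X x \<omega>)\<^sup>2)" for x
    using assms by (auto simp: stationary_isotropic_field_def)
  show ?thesis
  proof (rule Bochner_Integration.integrable_bound)
    show "integrable P (\<lambda>\<omega>. (X x \<omega>)\<^sup>2 + (X y \<omega>)\<^sup>2)" using sq by simp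
    have "\<bar>u * v\<bar> \<le> u\<^sup>2 + v\<^sup>2" for u v :: real
    proof -
      have "0 \<le> (u + v)\<^sup>2" "0 \<le> (u - v)\<^sup>2" "0 \<le> u\<^sup>2 + v\<^sup>2" by simp_all
      then show ?thesis unfolding power2_sum power2_diff by linarith
    qed
    then show "AE \<omega> in P. norm (X x \<omega> * X y \<omega>) \<le> norm ((X x \<omega>)\<^sup>2 + (X y \<omega>)\<^sup>2)" by simp
  qed simp
qed

lemma integrable_square_diff:
  fixes f g :: "'b \<Rightarrow> real"
  assumes "integrable M (\<lambda>x. f x * f x)" "integrable M (\<lambda>x. f x * g x)" "integrable M (\<lambda>x. g x * g x)"
  shows "integrable M (\<lambda>x. (f x - g x)\<^sup>2)"
    and "(\<integral>x. (f x - g x)\<^sup>2 \<partial>M) =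
      (\<integral>x. f x * f x \<partial>M) - 2 * (\<integral>x. f x * g x \<partial>M) + (\<integral>x. g x * g x \<partial>M)"
proof -
  have *: "(f x - g x)\<^sup>2 = f x * f x - 2 * (f x * g x) + g x * g x" for x
    by (simp add: power2_eq_square algebra_simps)
  show "integrable M (\<lambda>x. (f x - g x)\<^sup>2)"
    unfolding * using assms by simp
  show "(\<integral>x. (f x - g x)\<^sup>2 \<partial>M) =
      (\<integral>x. f x * f x \<partial>M) - 2 * (\<integral>x. f x * g x \<partial>M) + (\<integral>x. g x * g x \<partial>M)"
    unfolding * using assms by simp
qed

text \<open>Equality of joint moments transfers existence as well as value. Applied to lists of
  length two, it covers the three products in the expanded square of an increment.\<close>

lemma same_joint_moments_increments:
  fixes X :: "'a::euclidean_space \<Rightarrow> 'v \<Rightarrow> real"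
  assumes X: "stationary_isotropic_field P X" "is_semivariogram P X F"
    and same: "same_joint_moments P X Q Y"
  shows "integrable Q (\<lambda>w. (Y x w - Y y w)\<^sup>2)"
    and "(\<integral>w. (Y x w - Y y w)\<^sup>2 \<partial>Q) = 2 * F (norm (x - y))"
proof -
  note int = stationary_isotropic_field_integrable_mult[OF X(1)]
  have "has_bochner_integral Q (\<lambda>w. Y x w * Y y w) (\<integral>\<omega>. X x \<omega> * X y \<omega> \<partial>P)" for x y
  proof -
    have "has_bochner_integral P (\<lambda>\<omega>. \<Prod>x\<leftarrow>[x, y]. X x \<omega>) (\<integral>\<omega>. X x \<omega> * X y \<omega> \<partial>P)"
      using int[of x y] by (simp add: has_bochner_integral_iff)
    then have "has_bochner_integral Q (\<lambda>\<omega>. \<Prod>x\<leftarrow>[x, y]. Y x \<omega>) (\<integral>\<omega>. X x \<omega> * X y \<omega> \<partial>P)"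
      using same unfolding same_joint_moments_def by blast
    then show ?thesis by simp
  qed
  then have Y: "integrable Q (\<lambda>w. Y x w * Y y w)"
    "(\<integral>w. Y x w * Y y w \<partial>Q) = (\<integral>\<omega>. X x \<omega> * X y \<omega> \<partial>P)" for x y
    by (auto simp: has_bochner_integral_iff)
  show "integrable Q (\<lambda>w. (Y x w - Y y w)\<^sup>2)"
    by (intro integrable_square_diff Y)
  have "(\<integral>w. (Y x w - Y y w)\<^sup>2 \<partial>Q) = (\<integral>\<omega>. (X x \<omega> - X y \<omega>)\<^sup>2 \<partial>P)"
    by (simp add: integrable_square_diff Y int)
  then show "(\<integral>w. (Y x w - Y y w)\<^sup>2 \<partial>Q) = 2 * F (norm (x - y))"
    by (subst semivariogram_eq[OF X(2), of x y]) simp_all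
qed

text \<open>Split an increment over distance \<open>n * r\<close> into \<open>n\<close> increments
  between equally spaced points of a line. By Cauchy--Schwarz its square is at most \<open>n\<close>
  times the sum of their squares, each of mean \<open>2 * F r\<close>.\<close>

lemma semivariogram_multiple_le:
  fixes X :: "'a::euclidean_space \<Rightarrow> 'v \<Rightarrow> real"
  assumes X: "stationary_isotropic_field P X" "is_semivariogram P X F"
  shows "F (real n * r) \<le> (real n)\<^sup>2 * F r"
proof -
  obtain e :: 'a where e: "norm e = 1" using nonempty_Basis norm_Basis by blast
  define x where "x k = (real k * r) *\<^sub>R e" for k
  have "x i - x j = ((real i - real j) * r) *\<^sub>R e" for i j
    by (simp add: x_def algebra_simps)
  then have norm_x: "norm (x i - x j) = \<bar>(real i - real j) * r\<bar>" for i j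
    using e by simp
  note F = semivariogram_eq[OF X(2)]
  have int: "integrable P (\<lambda>\<omega>. (X y \<omega> - X z \<omega>)\<^sup>2)" for y z
    by (intro integrable_square_diff stationary_isotropic_field_integrable_mult X)
  have "(X (x n) \<omega> - X (x 0) \<omega>)\<^sup>2 \<le> real n * (\<Sum>k<n. (X (x (Suc k)) \<omega> - X (x k) \<omega>)\<^sup>2)" for \<omega>
    using sum_squared_le_sum_of_squares[of "\<lambda>k. X (x (Suc k)) \<omega> - X (x k) \<omega>" "{..<n}"]
    by (subst (asm) sum_lessThan_telescope) (simp add: mult.commute)
  then have "(\<integral>\<omega>. (X (x n) \<omega> - X (x 0) \<omega>)\<^sup>2 \<partial>P)
      \<le> (\<integral>\<omega>. real n * (\<Sum>k<n. (X (x (Suc k)) \<omega> - X (x k) \<omega>)\<^sup>2) \<partial>P)"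
    by (intro integral_mono int Bochner_Integration.integrable_sum
        Bochner_Integration.integrable_mult_right)
  also have "\<dots> = real n * (\<Sum>k<n. (\<integral>\<omega>. (X (x (Suc k)) \<omega> - X (x k) \<omega>)\<^sup>2 \<partial>P))"
    by (subst integral_mult_right_zero, subst Bochner_Integration.integral_sum) (auto intro: int)
  also have "\<dots> = real n * (\<Sum>k<n. 2 * F r)"
  proof -
    have "(\<integral>\<omega>. (X (x (Suc k)) \<omega> - X (x k) \<omega>)\<^sup>2 \<partial>P) = 2 * F r" for k
      using F[of "x (Suc k)" "x k" r] norm_x[of "Suc k" k] by simp
    then show ?thesis by simp
  qed
  also have "(\<integral>\<omega>. (X (x n) \<omega> - X (x 0) \<omega>)\<^sup>2 \<partial>P) = 2 * F (real n * r)"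
    using F[of "x n" "x 0" "real n * r"] norm_x[of n 0] by simp
  finally show ?thesis by (simp add: power2_eq_square)
qed

text \<open>Since \<open>F t \<le> n\<^sup>2 * F (t / n)\<close>, a semivariogram with \<open>F r = o(r\<^sup>2)\<close> vanishes.\<close>

lemma semivariogram_eq_0:
  fixes X :: "'a::euclidean_space \<Rightarrow> 'v \<Rightarrow> real"
  assumes X: "stationary_isotropic_field P X" "is_semivariogram P X F"
    and \<delta>: "\<delta> > 0" and le: "\<And>r. 0 \<le> r \<Longrightarrow> r < \<delta> \<Longrightarrow> F r \<le> C * r ^ 4"
  shows "F r = 0"
proof -
  have "F t \<le> 0" if t: "0 \<le> t" for t
  proof (rule tendsto_lowerbound)
    show "(\<lambda>n. C * t ^ 4 * inverse (real n) ^ 2) \<longlonglongrightarrow> 0"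
      by (rule tendsto_eq_intros refl lim_inverse_n)+ simp
    have "(\<lambda>n. t * inverse (real n)) \<longlonglongrightarrow> 0"
      by (rule tendsto_eq_intros refl lim_inverse_n)+ simp
    then have "\<forall>\<^sub>F n in sequentially. t * inverse (real n) < \<delta>"
      using \<delta> by (rule order_tendstoD)
    moreover have "\<forall>\<^sub>F n in sequentially. n > 0" by (rule eventually_gt_at_top)
    ultimately show "\<forall>\<^sub>F n in sequentially. F t \<le> C * t ^ 4 * inverse (real n) ^ 2"
    proof eventually_elim
      case (elim n)
      have "F t \<le> (real n)\<^sup>2 * F (t / n)"
        using semivariogram_multiple_le[OF X, of n "t / n"] elim by simp
      also have "\<dots> \<le> (real n)\<^sup>2 * (C * (t / n) ^ 4)"
        using elim t by (intro mult_left_mono le) (auto simp: field_simps)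
      also have "\<dots> = C * t ^ 4 * inverse (real n) ^ 2"
        using elim by (simp add: field_simps power_eq_if)
      finally show ?case .
    qed
  qed simp
  from this[of "\<bar>r\<bar>"] show ?thesis
    using semivariogram_nonneg[OF X(2), of r] semivariogram_even[OF X(2), of r]
    by (cases "r \<ge> 0") auto
qed

section \<open>Kernel averages\<close>

lemma compact_kernel_nonneg: "compact_kernel K R \<Longrightarrow> 0 \<le> t \<Longrightarrow> 0 \<le> K t"
  unfolding compact_kernel_def by (cases t R rule: linorder_cases) auto

text \<open>This moment is the denominator of \<open>moment_ratio\<close>. The integrand is
  integrable, being bounded on a bounded interval, so a zero integral would make it vanish almost
  everywhere, although it is positive on \<open>{0<..<R}\<close>.\<close>

lemma kernel_moment_pos:
  assumes K: "compact_kernel K R" and d: "d > 0"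
  shows "kernel_moment K R d > 0"
proof -
  have R: "R > 0" and [measurable]: "K \<in> borel_measurable borel"
    and pos: "\<And>s. 0 \<le> s \<Longrightarrow> s < R \<Longrightarrow> 0 < K s"
    using K by (auto simp: compact_kernel_def)
  obtain C where C: "\<And>t. 0 \<le> t \<Longrightarrow> \<bar>K t\<bar> \<le> C"
    using K unfolding compact_kernel_def bounded_iff by auto
  define g where "g s = indicator {0..R} s * (s ^ (d - 1) * K s)" for s
  have nn: "0 \<le> g s" for s
    using compact_kernel_nonneg[OF K, of s] by (auto simp: g_def split: split_indicator)
  have int: "integrable lborel g"
  proof (rule Bochner_Integration.integrable_bound)
    show "integrable lborel (\<lambda>s. R ^ (d - 1) * C * indicator {0..R} s)"
      by (intro integrable_mult_right integrable_real_indicator) (auto simp: emeasure_lborel_Icc_eq)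
    show "g \<in> borel_measurable lborel" unfolding g_def by measurable
    have "norm (g s) \<le> R ^ (d - 1) * C * indicator {0..R} s" for s
      using C[of s] R by (auto simp: g_def abs_mult power_abs intro!: mult_mono power_mono split: split_indicator)
    then show "AE s in lborel. norm (g s) \<le> norm (R ^ (d - 1) * C * indicator {0..R} s)"
      by (intro AE_I2) (metis abs_ge_self order.trans real_norm_def)
  qed
  have "integral\<^sup>L lborel g \<noteq> 0"
  proof
    assume "integral\<^sup>L lborel g = 0"
    then have "AE s in lborel. g s = 0"
      using integral_nonneg_eq_0_iff_AE[OF int] nn by auto
    then have "AE s in lborel. s \<notin> {0<..<R}"
    proof eventually_elim
      case (elim s)
      then show ?case using pos[of s] by (auto simp: g_def)
    qed
    then have "emeasure lborel {0<..<R} = 0"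
      by (subst (asm) AE_iff_measurable[where N = "{0<..<R}"]) auto
    then show False using R by simp
  qed
  moreover have "0 \<le> integral\<^sup>L lborel g" using nn by simp
  ultimately show ?thesis
    unfolding kernel_moment_def set_lebesgue_integral_def g_def by simp
qed

lemma kernel_average_measurable:
  assumes [measurable]: "K \<in> borel_measurable borel"
    and s: "\<And>i. i \<in> {1..n} \<Longrightarrow> (\<lambda>x. s x i) \<in> borel_measurable N"
    and A: "\<And>i j. i \<in> {1..n} \<Longrightarrow> j \<in> {1..n} \<Longrightarrow> (\<lambda>x. A x i j) \<in> borel_measurable N"
  shows "(\<lambda>x. kernel_average K h n (s x) (A x)) \<in> borel_measurable N"
proof -
  have "(\<lambda>x. K (norm (s x i - s x j) / h) * A x i j) \<in> borel_measurable N"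
    "(\<lambda>x. K (norm (s x i - s x j) / h)) \<in> borel_measurable N"
    if "i \<in> {1..n}" "j \<in> {1..n}" for i j
  proof -
    note [measurable] = s[OF that(1)] s[OF that(2)] A[OF that]
    show "(\<lambda>x. K (norm (s x i - s x j) / h) * A x i j) \<in> borel_measurable N" by measurable
    show "(\<lambda>x. K (norm (s x i - s x j) / h)) \<in> borel_measurable N" by measurable
  qed
  then show ?thesis
    unfolding kernel_average_def case_prod_unfold
    by (intro borel_measurable_divide borel_measurable_sum) auto
qed

lemma kernel_average_add:
  "kernel_average K h n s (\<lambda>i j. A i j + B i j) = kernel_average K h n s A + kernel_average K h n s B"
  by (simp add: kernel_average_def distrib_left case_prod_unfold sum.distrib add_divide_distrib)

lemma kernel_average_cmult:
  "kernel_average K h n s (\<lambda>i j. c * A i j) = c * kernel_average K h n s A"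
  by (simp add: kernel_average_def case_prod_unfold sum_distrib_left mult.left_commute)

text \<open>Pairs farther apart than \<open>h * R\<close> have weight zero, so the comparison is
  required only within that range. This is how properties of \<open>F\<close> near zero control
  averages over all pairs.\<close>

lemma kernel_average_mono:
  assumes K: "compact_kernel K R" and h: "h > 0"
    and le: "\<And>i j. i \<in> {1..n} \<Longrightarrow> j \<in> {1..n} \<Longrightarrow> i \<noteq> j \<Longrightarrow> norm (s i - s j) \<le> h * R \<Longrightarrow> A i j \<le> B i j"
  shows "kernel_average K h n s A \<le> kernel_average K h n s B"
proof -
  have nn: "0 \<le> K (norm (s i - s j) / h)" for i j
    using h by (intro compact_kernel_nonneg[OF K]) simp
  have "K (norm (s i - s j) / h) * A i j \<le> K (norm (s i - s j) / h) * B i j"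
    if "i \<in> {1..n}" "j \<in> {1..n}" "i \<noteq> j" for i j
  proof (cases "norm (s i - s j) \<le> h * R")
    case True
    then show ?thesis using that nn by (intro mult_left_mono le)
  next
    case False
    then have "norm (s i - s j) / h > R" using h by (simp add: field_simps)
    then show ?thesis using K by (simp add: compact_kernel_def)
  qed
  then show ?thesis
    unfolding kernel_average_def using nn
    by (intro divide_right_mono sum_mono sum_nonneg) auto
qed

text \<open>The average of the constant \<open>1\<close> is \<open>1\<close>, or \<open>0\<close> if
  all weights vanish. The second possibility is the reason for \<open>c \<ge> 0\<close>.\<close>

lemma kernel_average_const_le:
  assumes K: "compact_kernel K R" and h: "h > 0" and c: "c \<ge> 0"
    and le: "\<And>i j. i \<in> {1..n} \<Longrightarrow> j \<in> {1..n} \<Longrightarrow> i \<noteq> j \<Longrightarrow> norm (s i - s j) \<le> h * R \<Longrightarrow> A i j \<le> c"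
  shows "kernel_average K h n s A \<le> c"
proof -
  have "kernel_average K h n s A \<le> kernel_average K h n s (\<lambda>_ _. c * 1)"
    by (rule kernel_average_mono[OF K h]) (use le in auto)
  also have "\<dots> = c * kernel_average K h n s (\<lambda>_ _. 1)" by (rule kernel_average_cmult)
  also have "\<dots> \<le> c * 1"
    using c by (intro mult_left_mono) (simp_all add: kernel_average_def divide_le_eq_1)
  finally show ?thesis by simp
qed

lemma kernel_average_nonneg:
  assumes K: "compact_kernel K R" and h: "h > 0"
    and le: "\<And>i j. i \<in> {1..n} \<Longrightarrow> j \<in> {1..n} \<Longrightarrow> i \<noteq> j \<Longrightarrow> norm (s i - s j) \<le> h * R \<Longrightarrow> 0 \<le> A i j"
  shows "0 \<le> kernel_average K h n s A"
  using kernel_average_mono[OF K h, of n s "\<lambda>_ _. 0" A] le by (simp add: kernel_average_def)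

lemma kernel_average_abs_le:
  assumes K: "compact_kernel K R" and h: "h > 0"
    and le: "\<And>i j. i \<in> {1..n} \<Longrightarrow> j \<in> {1..n} \<Longrightarrow> i \<noteq> j \<Longrightarrow> norm (s i - s j) \<le> h * R \<Longrightarrow> \<bar>A i j\<bar> \<le> B i j"
  shows "\<bar>kernel_average K h n s A\<bar> \<le> kernel_average K h n s B"
proof -
  have "kernel_average K h n s (\<lambda>i j. -1 * B i j) \<le> kernel_average K h n s A"
    "kernel_average K h n s A \<le> kernel_average K h n s B"
    by (rule kernel_average_mono[OF K h], frule (3) le, linarith)+
  then show ?thesis unfolding kernel_average_cmult by simp
qed

text \<open>The a priori bound behind the later dominations: divided by \<open>h ^ q\<close>, these
  averages lie between \<open>0\<close> and \<open>R ^ q\<close> for every configuration of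
  points.\<close>

lemma kernel_average_norm_power:
  assumes K: "compact_kernel K R" and h: "h > 0"
  shows "0 \<le> kernel_average K h n s (\<lambda>i j. norm (s i - s j) ^ q)"
    and "kernel_average K h n s (\<lambda>i j. norm (s i - s j) ^ q) \<le> (h * R) ^ q"
proof -
  have "R > 0" using K by (simp add: compact_kernel_def)
  then show "kernel_average K h n s (\<lambda>i j. norm (s i - s j) ^ q) \<le> (h * R) ^ q"
    using h by (intro kernel_average_const_le[OF K h] power_mono) auto
qed (intro kernel_average_nonneg[OF K h], simp)

text \<open>The quadratic term of \<open>F\<close> cancels because \<open>a\<^sup>2\<close> is the kernel average of \<open>r\<^sup>2\<close>.\<close>

lemma kernel_average_quartic_defect:
  fixes s :: "nat \<Rightarrow> 'a::euclidean_space"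
  assumes K: "compact_kernel K R" and h: "h > 0" and a: "a \<ge> 0" and \<epsilon>: "\<epsilon> \<ge> 0"
    and a2: "a\<^sup>2 = kernel_average K h n s (\<lambda>i j. (norm (s i - s j))\<^sup>2)"
    and F: "\<And>r. 0 \<le> r \<Longrightarrow> r \<le> h * R \<Longrightarrow> \<bar>F r - \<tau>2 * r\<^sup>2 - \<tau>4 * r ^ 4\<bar> \<le> \<epsilon> * r ^ 4"
  shows "\<bar>kernel_average K h n s (\<lambda>i j. F (norm (s i - s j))) - F a
      - \<tau>4 * (kernel_average K h n s (\<lambda>i j. norm (s i - s j) ^ 4)
              - (kernel_average K h n s (\<lambda>i j. (norm (s i - s j))\<^sup>2))\<^sup>2)\<bar>
    \<le> 2 * \<epsilon> * (h * R) ^ 4"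
proof -
  have R: "R > 0" using K by (simp add: compact_kernel_def)
  define e where "e r = F r - \<tau>2 * r\<^sup>2 - \<tau>4 * r ^ 4" for r
  have e: "\<bar>e r\<bar> \<le> \<epsilon> * (h * R) ^ 4" if "0 \<le> r" "r \<le> h * R" for r
    using F[OF that] that \<epsilon> unfolding e_def
    by (elim order.trans) (intro mult_left_mono power_mono, auto)
  \<comment> \<open>The step is itself within the range of the expansion of \<open>F\<close>. The
    factor \<open>2\<close> in the claim counts the remainder once under the average and once at
    \<open>a\<close>.\<close>
  have "a \<le> h * R"
    using kernel_average_norm_power(2)[OF K h, of n s 2] h R
    unfolding a2[symmetric] by (auto intro: power2_le_imp_le)
  have "\<bar>kernel_average K h n s (\<lambda>i j. e (norm (s i - s j)))\<bar>
      \<le> kernel_average K h n s (\<lambda>i j. \<epsilon> * (h * R) ^ 4)"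
    by (intro kernel_average_abs_le[OF K h] e) auto
  also have "\<dots> \<le> \<epsilon> * (h * R) ^ 4"
    using \<epsilon> h R by (intro kernel_average_const_le[OF K h]) auto
  finally have 1: "\<bar>kernel_average K h n s (\<lambda>i j. e (norm (s i - s j)))\<bar> \<le> \<epsilon> * (h * R) ^ 4" .
  have 2: "\<bar>e a\<bar> \<le> \<epsilon> * (h * R) ^ 4" by (rule e) fact+
  have F_e: "F r = \<tau>2 * r\<^sup>2 + (\<tau>4 * r ^ 4 + e r)" for r by (simp add: e_def)
  have "F a = \<tau>2 * a\<^sup>2 + (\<tau>4 * (a\<^sup>2)\<^sup>2 + e a)" by (simp add: e_def)
  then show ?thesis
    using 1 2 unfolding F_e[of "norm _"] kernel_average_add kernel_average_cmult
    by (simp add: a2 algebra_simps)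
qed

text \<open>The errors are measured against \<open>a\<^sup>2\<close>, the average of the squared
  distances, and not against \<open>(h * R)\<^sup>2\<close>. Hence they remain relative errors when
  most configurations have no pair in range.\<close>

lemma kernel_average_quadratic_bounds:
  fixes s :: "nat \<Rightarrow> 'a::euclidean_space"
  assumes K: "compact_kernel K R" and h: "h > 0" and a: "a \<ge> 0"
    and a2: "a\<^sup>2 = kernel_average K h n s (\<lambda>i j. (norm (s i - s j))\<^sup>2)"
    and F: "\<And>r. 0 \<le> r \<Longrightarrow> r \<le> h * R \<Longrightarrow> \<bar>F r - \<tau> * r\<^sup>2\<bar> \<le> \<epsilon> * r\<^sup>2"
  shows "\<bar>kernel_average K h n s (\<lambda>i j. F (norm (s i - s j))) - \<tau> * a\<^sup>2\<bar> \<le> \<epsilon> * a\<^sup>2"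
    and "\<bar>F a - \<tau> * a\<^sup>2\<bar> \<le> \<epsilon> * a\<^sup>2"
proof -
  have R: "R > 0" using K by (simp add: compact_kernel_def)
  have "a\<^sup>2 \<le> (h * R)\<^sup>2"
    using kernel_average_norm_power(2)[OF K h, of n s 2] unfolding a2 .
  then have "a \<le> h * R"
    using h R by (auto intro: power2_le_imp_le)
  then show "\<bar>F a - \<tau> * a\<^sup>2\<bar> \<le> \<epsilon> * a\<^sup>2" using a by (intro F)
  define e where "e r = F r - \<tau> * r\<^sup>2" for r
  have F_e: "F r = \<tau> * r\<^sup>2 + e r" for r by (simp add: e_def)
  have "\<bar>kernel_average K h n s (\<lambda>i j. e (norm (s i - s j)))\<bar>
      \<le> kernel_average K h n s (\<lambda>i j. \<epsilon> * (norm (s i - s j))\<^sup>2)"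
    by (intro kernel_average_abs_le[OF K h]) (auto simp: e_def intro!: F)
  then show "\<bar>kernel_average K h n s (\<lambda>i j. F (norm (s i - s j))) - \<tau> * a\<^sup>2\<bar> \<le> \<epsilon> * a\<^sup>2"
    unfolding F_e[of "norm _"] kernel_average_add kernel_average_cmult by (simp add: a2)
qed

section \<open>Sums over pairs of random points\<close>

text \<open>Nonnegativity of the variance of \<open>\<bar>Y\<bar>\<close>. It turns mean-square
  bounds into bounds in mean.\<close>

lemma (in prob_space) expectation_abs_le_sqrt:
  fixes Y :: "'a \<Rightarrow> real"
  assumes "integrable M (\<lambda>x. (Y x)\<^sup>2)" "integrable M Y"
  shows "expectation (\<lambda>x. \<bar>Y x\<bar>) \<le> sqrt (expectation (\<lambda>x. (Y x)\<^sup>2))"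
proof (rule real_le_rsqrt)
  have "0 \<le> variance (\<lambda>x. \<bar>Y x\<bar>)" by (rule variance_positive)
  also have "\<dots> = expectation (\<lambda>x. (Y x)\<^sup>2) - (expectation (\<lambda>x. \<bar>Y x\<bar>))\<^sup>2"
    using assms by (subst variance_eq) auto
  finally show "(expectation (\<lambda>x. \<bar>Y x\<bar>))\<^sup>2 \<le> expectation (\<lambda>x. (Y x)\<^sup>2)" by simp
qed

definition index_pairs :: "nat \<Rightarrow> (nat \<times> nat) set" where
  "index_pairs n = {(i, j). i \<in> {1..n} \<and> j \<in> {1..n} \<and> i \<noteq> j}"

lemma index_pairs_subset: "index_pairs n \<subseteq> {1..n} \<times> {1..n}"
  by (auto simp: index_pairs_def)

lemma finite_index_pairs [simp]: "finite (index_pairs n)"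
  by (rule finite_subset[OF index_pairs_subset]) simp

lemma card_index_pairs: "real (card (index_pairs n)) = real n * real n - real n"
proof -
  have "index_pairs n = {1..n} \<times> {1..n} - (\<lambda>i. (i, i)) ` {1..n}"
    by (auto simp: index_pairs_def)
  moreover have "card (\<dots>) = n * n - n"
    by (subst card_Diff_subset) (auto simp: card_image inj_on_def)
  ultimately show ?thesis by (simp add: of_nat_diff)
qed

text \<open>Second-moment method. The squared deviation expands into covariances of pairs
  \<open>(i, j)\<close> and \<open>(k, l)\<close>, and those without a common index vanish by
  \<open>disjoint\<close>. The others are bounded by second moments: about \<open>n\<^sup>2\<close>
  coincidences cost \<open>b\<^sub>1\<close> each and about \<open>n ^ 3\<close> single overlaps
  cost \<open>b\<^sub>2\<close> each.\<close>

lemma (in prob_space) pair_sum_variance: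
  fixes W :: "nat \<Rightarrow> nat \<Rightarrow> 'a \<Rightarrow> real"
  assumes [measurable]: "\<And>i j. i \<in> {1..n} \<Longrightarrow> j \<in> {1..n} \<Longrightarrow> W i j \<in> borel_measurable M"
    and bounded: "\<And>i j x. \<bar>W i j x\<bar> \<le> C"
    and sym: "\<And>i j x. W i j x = W j i x"
    and mean: "\<And>i j. i \<in> {1..n} \<Longrightarrow> j \<in> {1..n} \<Longrightarrow> i \<noteq> j \<Longrightarrow> expectation (W i j) = m"
    and disjoint: "\<And>i j k l. {i, j, k, l} \<subseteq> {1..n} \<Longrightarrow> distinct [i, j, k, l] \<Longrightarrow>
      expectation (\<lambda>x. W i j x * W k l x) = m\<^sup>2"
    and same: "\<And>i j. i \<in> {1..n} \<Longrightarrow> j \<in> {1..n} \<Longrightarrow> i \<noteq> j \<Longrightarrow> expectation (\<lambda>x. W i j x * W i j x) \<le> b\<^sub>1"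
    and shared: "\<And>i j k. {i, j, k} \<subseteq> {1..n} \<Longrightarrow> distinct [i, j, k] \<Longrightarrow>
      expectation (\<lambda>x. W i j x * W i k x) \<le> b\<^sub>2"
    and b: "0 \<le> b\<^sub>1" "0 \<le> b\<^sub>2"
  shows "expectation (\<lambda>x. ((\<Sum>(i, j)\<in>index_pairs n. W i j x) - (real n * real n - real n) * m)\<^sup>2)
    \<le> (real n)\<^sup>2 * (2 * b\<^sub>1 + 4 * real n * b\<^sub>2)"
proof -
  have int: "integrable M (W i j)" if "i \<in> {1..n}" "j \<in> {1..n}" for i j
    using bounded that by (intro integrable_const_bound[where B = C]) auto
  have int2: "integrable M (\<lambda>x. W i j x * W k l x)" if "{i, j, k, l} \<subseteq> {1..n}" for i j k l
    using that
    by (intro integrable_const_bound[where B = "C * C"])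
      (auto simp: abs_mult intro!: mult_mono bounded order.trans[OF abs_ge_zero bounded])
  \<comment> \<open>\<open>c\<close> majorises all covariances at once, with one term for each way
    two pairs can meet: identical, reversed, or one of four single coincidences. Overlapping terms
    only enlarge it. In this form it sums index by index to
    \<open>2 * b\<^sub>1 + 4 * n * b\<^sub>2\<close> per pair, and being nonnegative it allows the
    diagonal to be included.\<close>
  define c where "c i j k l = (if k = i then if l = j then b\<^sub>1 else 0 else 0)
      + (if k = j then if l = i then b\<^sub>1 else 0 else 0)
      + (if k = i then b\<^sub>2 else 0) + (if k = j then b\<^sub>2 else 0)
      + (if l = i then b\<^sub>2 else 0) + (if l = j then b\<^sub>2 else 0)" for i j k l :: nat
  have c_nonneg: "0 \<le> c i j k l" for i j k l using b by (simp add: c_def)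
  have cov: "expectation (\<lambda>x. (W i j x - m) * (W k l x - m)) \<le> c i j k l"
    if "(i, j) \<in> index_pairs n" "(k, l) \<in> index_pairs n" for i j k l
  proof -
    have ij: "i \<in> {1..n}" "j \<in> {1..n}" "i \<noteq> j" and kl: "k \<in> {1..n}" "l \<in> {1..n}" "k \<noteq> l"
      using that by (auto simp: index_pairs_def)
    have "expectation (\<lambda>x. (W i j x - m) * (W k l x - m))
        = expectation (\<lambda>x. W i j x * W k l x - m * W i j x - m * W k l x + m\<^sup>2)"
      by (rule arg_cong[where f = expectation]) (auto simp: algebra_simps power2_eq_square)
    also have "\<dots> = expectation (\<lambda>x. W i j x * W k l x) - m\<^sup>2"
      using ij kl int int2[of i j k l] mean by (simp add: prob_space power2_eq_square)
    finally have eq: "expectation (\<lambda>x. (W i j x - m) * (W k l x - m))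
        = expectation (\<lambda>x. W i j x * W k l x) - m\<^sup>2" .
    have le: ?thesis if "expectation (\<lambda>x. W i j x * W k l x) \<le> c i j k l"
      using that zero_le_power2[of m] unfolding eq by linarith
    consider "k = i" "l = j" | "k = j" "l = i" | "k = i" "l \<noteq> j" | "k = j" "l \<noteq> i" | "l = i" "k \<noteq> j"
      | "l = j" "k \<noteq> i" | "distinct [i, j, k, l]"
      using ij kl by auto
    then show ?thesis
    proof cases
      case 1
      then show ?thesis using same[of i j] ij b by (intro le) (simp add: c_def)
    next
      case 2
      then show ?thesis using same[of i j] ij b sym[of j i] by (intro le) (simp add: c_def)
    next
      case 3
      then show ?thesis using shared[of i j l] ij kl b by (intro le) (auto simp: c_def)
    next
      case 4
      then show ?thesis using shared[of j i l] ij kl b sym[of i j] by (intro le) (auto simp: c_def)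
    next
      case 5
      then show ?thesis using shared[of i j k] ij kl b sym[of k i] by (intro le) (auto simp: c_def)
    next
      case 6
      then show ?thesis using shared[of j i k] ij kl b sym[of i j] sym[of k j]
        by (intro le) (auto simp: c_def)
    next
      case 7
      then show ?thesis using disjoint[of i j k l] ij kl c_nonneg[of i j k l] unfolding eq by simp
    qed
  qed
  have int_cov: "integrable M (\<lambda>x. (W i j x - m) * (W k l x - m))"
    if "(i, j) \<in> index_pairs n" "(k, l) \<in> index_pairs n" for i j k l
  proof -
    have "{i, j, k, l} \<subseteq> {1..n}" using that by (auto simp: index_pairs_def)
    then show ?thesis
      using int[of i j] int[of k l] int2[of i j k l] by (simp add: algebra_simps)
  qed
  have "(\<Sum>(i, j)\<in>index_pairs n. W i j x) - (real n * real n - real n) * m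
      = (\<Sum>(i, j)\<in>index_pairs n. W i j x - m)" for x
    by (simp add: card_index_pairs[symmetric] case_prod_unfold sum_subtractf)
  then have "expectation (\<lambda>x. ((\<Sum>(i, j)\<in>index_pairs n. W i j x) - (real n * real n - real n) * m)\<^sup>2)
      = expectation (\<lambda>x. \<Sum>(i, j)\<in>index_pairs n. \<Sum>(k, l)\<in>index_pairs n. (W i j x - m) * (W k l x - m))"
    by (simp add: power2_eq_square sum_product case_prod_unfold)
  also have "\<dots> = (\<Sum>(i, j)\<in>index_pairs n. \<Sum>(k, l)\<in>index_pairs n.
      expectation (\<lambda>x. (W i j x - m) * (W k l x - m)))"
    by (simp add: Bochner_Integration.integral_sum Bochner_Integration.integrable_sum
        case_prod_unfold int_cov)
  also have "\<dots> \<le> (\<Sum>(i, j)\<in>index_pairs n. \<Sum>(k, l)\<in>index_pairs n. c i j k l)"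
    using cov by (intro sum_mono) (auto intro!: sum_mono)
  also have "\<dots> \<le> (\<Sum>(i, j)\<in>{1..n} \<times> {1..n}. \<Sum>(k, l)\<in>{1..n} \<times> {1..n}. c i j k l)"
    using c_nonneg
    by (intro order.trans[OF sum_mono2[OF _ index_pairs_subset]] sum_mono)
      (auto intro!: sum_mono2 sum_nonneg simp: index_pairs_def)
  also have "\<dots> = (\<Sum>i\<in>{1..n}. \<Sum>j\<in>{1..n}. \<Sum>k\<in>{1..n}. \<Sum>l\<in>{1..n}. c i j k l)"
    by (simp only: sum.cartesian_product[symmetric] split_conv)
  also have "\<dots> = (\<Sum>i\<in>{1..n}. \<Sum>j\<in>{1..n}. 2 * b\<^sub>1 + 4 * real n * b\<^sub>2)"
  proof (intro sum.cong refl)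
    fix i j assume "i \<in> {1..n}" "j \<in> {1..n}"
    then have "(\<Sum>l\<in>{1..n}. c i j k l) = (if k = i then b\<^sub>1 else 0) + (if k = j then b\<^sub>1 else 0)
      + (if k = i then real n * b\<^sub>2 else 0) + (if k = j then real n * b\<^sub>2 else 0) + b\<^sub>2 + b\<^sub>2" for k
      unfolding c_def by (auto simp: sum.distrib sum.delta)
    then show "(\<Sum>k\<in>{1..n}. \<Sum>l\<in>{1..n}. c i j k l) = 2 * b\<^sub>1 + 4 * real n * b\<^sub>2"
      using \<open>i \<in> _\<close> \<open>j \<in> _\<close> by (simp only: sum.distrib) (simp add: sum.delta)
  qed
  also have "\<dots> = (real n)\<^sup>2 * (2 * b\<^sub>1 + 4 * real n * b\<^sub>2)"
    by (simp add: power2_eq_square)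
  finally show ?thesis .
qed

lemma C1_near_zero_isCont: "C1_near_zero f \<Longrightarrow> isCont f 0"
  unfolding C1_near_zero_def by (auto dest: has_derivative_continuous)

text \<open>Positions before scaling by \<open>L\<close>. The density \<open>f\<^sub>1\<close>
  governs the mean of a sum over pairs, \<open>f\<^sub>2\<close> the correlation of two pairs with a
  common point, and independence settles pairs with four distinct points. The unit cube supplies the
  finitely many cells of the pigeonhole argument.\<close>

locale iid_design = prob_space M for M :: "'w measure" +
  fixes U :: "nat \<Rightarrow> 'w \<Rightarrow> 'a::euclidean_space" and f\<^sub>1 :: "'a \<Rightarrow> real" and f\<^sub>2 :: "'a \<times> 'a \<Rightarrow> real"
  assumes U_measurable: "\<And>i. i \<ge> 1 \<Longrightarrow> U i \<in> measurable M borel"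
    and U_cbox: "\<And>i \<omega>. i \<ge> 1 \<Longrightarrow> \<omega> \<in> space M \<Longrightarrow> U i \<omega> \<in> cbox 0 One"
    and indep_U: "indep_vars (\<lambda>_. borel) U {1..}"
    and distr_U: "\<And>i j. i \<ge> 1 \<Longrightarrow> j \<ge> 1 \<Longrightarrow> distr M borel (U i) = distr M borel (U j)"
    and pdf_1: "\<And>i j. i \<ge> 1 \<Longrightarrow> j \<ge> 1 \<Longrightarrow> i \<noteq> j \<Longrightarrow> is_pdf M (\<lambda>\<omega>. U i \<omega> - U j \<omega>) f\<^sub>1"
    and isCont_f1: "isCont f\<^sub>1 0"
    and pdf_2: "\<And>i j k. i \<ge> 1 \<Longrightarrow> j \<ge> 1 \<Longrightarrow> k \<ge> 1 \<Longrightarrow> distinct [i, j, k] \<Longrightarrow>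
        is_pdf M (\<lambda>\<omega>. (U i \<omega> - U j \<omega>, U i \<omega> - U k \<omega>)) f\<^sub>2"
    and isCont_f2: "isCont f\<^sub>2 0"
begin

lemma f1_measurable [measurable]: "f\<^sub>1 \<in> borel_measurable borel"
  and f1_nonneg: "0 \<le> f\<^sub>1 x"
  using pdf_1[of 1 2] by (auto simp: is_pdf_def)

lemma f2_measurable [measurable]: "f\<^sub>2 \<in> borel_measurable borel"
  and f2_nonneg: "0 \<le> f\<^sub>2 z"
  using pdf_2[of 1 2 3] by (simp_all add: is_pdf_def del: split_paired_All)

text \<open>If the unit cube is cut into \<open>(m + 1) ^ d\<close> cells, then by Cauchy--Schwarz two independent
  points share a cell with probability at least \<open>1 / (m + 1) ^ d\<close>.  A density with
  \<open>f\<^sub>1 0 = 0\<close> would give them too little mass.\<close>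

lemma prob_close_ge:
  assumes m: "m \<ge> (1::nat)"
  shows "1 / (real m + 1) ^ DIM('a) \<le> prob {\<omega> \<in> space M. norm (U 1 \<omega> - U 2 \<omega>) \<le> real DIM('a) / real m}"
proof -
  note [measurable] = U_measurable[of 1] U_measurable[of 2]
  \<comment> \<open>A coordinate equal to \<open>1\<close> has floor \<open>m\<close>, so each
    coordinate takes \<open>m + 1\<close> values, not \<open>m\<close>. Restriction to
    \<open>Basis\<close> makes the set of cells a finite product.\<close>
  define cell :: "'a \<Rightarrow> 'a \<Rightarrow> int" where "cell u = (\<lambda>b\<in>Basis. \<lfloor>real m * (u \<bullet> b)\<rfloor>)" for u
  define Cs :: "('a \<Rightarrow> int) set" where "Cs = (\<Pi>\<^sub>E b\<in>Basis. {0..int m})"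
  have fin: "finite Cs" unfolding Cs_def by (intro finite_PiE) auto
  have card: "real (card Cs) = (real m + 1) ^ DIM('a)"
    unfolding Cs_def by (subst card_PiE) (auto simp: add_ac)
  have cell_in: "cell u \<in> Cs" if "u \<in> cbox 0 One" for u
  proof -
    have "\<lfloor>real m * (u \<bullet> b)\<rfloor> \<in> {0..int m}" if "b \<in> Basis" for b
    proof -
      have "0 \<le> real m * (u \<bullet> b)" "real m * (u \<bullet> b) \<le> real m"
        using \<open>u \<in> _\<close> that m by (auto simp: mem_box mult_left_le)
      then show ?thesis by (simp add: floor_le_iff)
    qed
    then show ?thesis unfolding Cs_def cell_def by auto
  qed
  have cell_meas [measurable]: "{u. cell u = c} \<in> sets borel" if "c \<in> Cs" for c
  proof -
    have "{u. cell u = c} = {u. \<forall>b\<in>Basis. \<lfloor>real m * (u \<bullet> b)\<rfloor> = c b}"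
      using that unfolding cell_def Cs_def by (auto simp: fun_eq_iff restrict_def PiE_def extensional_def)
    also have "\<dots> \<in> sets borel" by measurable
    finally show ?thesis .
  qed
  have close: "norm (u - v) \<le> real DIM('a) / real m" if "cell u = cell v" for u v
  proof -
    have "\<bar>(u - v) \<bullet> b\<bar> \<le> 1 / real m" if b: "b \<in> Basis" for b
    proof -
      have "\<lfloor>real m * (u \<bullet> b)\<rfloor> = \<lfloor>real m * (v \<bullet> b)\<rfloor>"
        using fun_cong[OF \<open>cell u = cell v\<close>, of b] b by (simp add: cell_def)
      then have "\<bar>real m * (u \<bullet> b) - real m * (v \<bullet> b)\<bar> \<le> 1" by linarith
      then have "real m * \<bar>(u - v) \<bullet> b\<bar> \<le> 1"
        using m by (simp add: inner_diff_left abs_mult flip: right_diff_distrib)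
      then show ?thesis using m by (simp add: field_simps)
    qed
    then have "(\<Sum>b\<in>Basis. \<bar>(u - v) \<bullet> b\<bar>) \<le> (\<Sum>b\<in>(Basis::'a set). 1 / real m)" by (rule sum_mono)
    then show ?thesis using norm_le_l1[of "u - v"] by simp
  qed
  define E where "E i c = {\<omega> \<in> space M. cell (U i \<omega>) = c}" for i c
  have E_eq: "E i c = U i -` {u. cell u = c} \<inter> space M" for i c by (auto simp: E_def)
  have E_sets: "E i c \<in> events" if "i \<ge> 1" "c \<in> Cs" for i c
    unfolding E_eq using U_measurable[OF that(1)] cell_meas[OF that(2)] by (rule measurable_sets)
  have E_distr: "prob (E i c) = prob (E 1 c)" if "i \<ge> 1" "c \<in> Cs" for i c
    using measure_distr[OF U_measurable[of i] cell_meas[OF that(2)]]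
      measure_distr[OF U_measurable[of 1] cell_meas[OF that(2)]] distr_U[of i 1] that(1)
    by (simp add: E_eq)
  have indep_12: "indep_var borel (U 1) borel (U 2)"
  proof -
    have "indep_var (PiM {1} (\<lambda>_. borel)) (\<lambda>\<omega>. restrict (\<lambda>i. U i \<omega>) {1})
        (PiM {2} (\<lambda>_. borel)) (\<lambda>\<omega>. restrict (\<lambda>i. U i \<omega>) {2})"
      by (rule indep_var_restrict[OF indep_U]) auto
    from indep_var_compose[OF this, of "\<lambda>f. f 1" borel "\<lambda>f. f 2" borel]
    show ?thesis by (simp add: comp_def)
  qed
  have E_indep: "prob (E 1 c \<inter> E 2 c) = (prob (E 1 c))\<^sup>2" if "c \<in> Cs" for c
  proof -
    have "prob (E 1 c \<inter> E 2 c)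
        = prob ((\<lambda>x. (U 1 x, U 2 x)) -` ({u. cell u = c} \<times> {u. cell u = c}) \<inter> space M)"
      by (rule arg_cong[where f = prob]) (auto simp: E_def)
    also have "\<dots> = prob (E 1 c) * prob (E 2 c)"
      unfolding E_eq by (rule indep_varD[OF indep_12]) (use cell_meas[OF that] in auto)
    finally show ?thesis using E_distr[of 2 c] that by (simp add: power2_eq_square)
  qed
  have "1 = prob (\<Union>c\<in>Cs. E 1 c)"
  proof -
    have "(\<Union>c\<in>Cs. E 1 c) = space M" using cell_in U_cbox[of 1] by (auto simp: E_def)
    then show ?thesis by (simp add: prob_space)
  qed
  also have "\<dots> = (\<Sum>c\<in>Cs. prob (E 1 c))"
    by (rule finite_measure_finite_Union[OF fin])
      (use E_sets in \<open>auto simp: disjoint_family_on_def E_def\<close>)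
  finally have "1 = (\<Sum>c\<in>Cs. prob (E 1 c))\<^sup>2" by simp
  also have "\<dots> \<le> (\<Sum>c\<in>Cs. (prob (E 1 c))\<^sup>2) * card Cs"
    by (rule sum_squared_le_sum_of_squares)
  also have "(\<Sum>c\<in>Cs. (prob (E 1 c))\<^sup>2) = (\<Sum>c\<in>Cs. prob (E 1 c \<inter> E 2 c))"
    using E_indep by simp
  also have "\<dots> = prob (\<Union>c\<in>Cs. E 1 c \<inter> E 2 c)"
    by (rule finite_measure_finite_Union[OF fin, symmetric])
      (use E_sets in \<open>auto simp: disjoint_family_on_def E_def\<close>)
  also have "\<dots> \<le> prob {\<omega> \<in> space M. norm (U 1 \<omega> - U 2 \<omega>) \<le> real DIM('a) / real m}"
  proof (rule finite_measure_mono)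
    show "(\<Union>c\<in>Cs. E 1 c \<inter> E 2 c) \<subseteq> {\<omega> \<in> space M. norm (U 1 \<omega> - U 2 \<omega>) \<le> real DIM('a) / real m}"
      by (auto simp: E_def intro!: close)
    show "{\<omega> \<in> space M. norm (U 1 \<omega> - U 2 \<omega>) \<le> real DIM('a) / real m} \<in> events" by measurable
  qed
  finally show ?thesis unfolding card by (simp add: divide_le_eq mult_right_mono)
qed

text \<open>\<open>f\<^sub>1 0\<close> is a factor of the limit of the normalised kernel weights, by
  which the averages are divided. If it were zero, a small ball of radius \<open>r = d / m\<close>
  would have mass at most \<open>\<epsilon> * (V * r ^ d)\<close>. This has the same order in
  \<open>m\<close> as the pigeonhole bound, so one fixed small \<open>\<epsilon>\<close> yields a
  contradiction.\<close>

lemma f1_pos: "f\<^sub>1 0 > 0"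
proof (rule ccontr)
  assume "\<not> f\<^sub>1 0 > 0"
  with f1_nonneg[of 0] have f0: "f\<^sub>1 0 = 0" by simp
  define d where "d = DIM('a)"
  have d: "d > 0" by (simp add: d_def)
  define V where "V = unit_ball_vol (real DIM('a))"
  have V: "V > 0" by (simp add: V_def)
  \<comment> \<open>Makes \<open>\<epsilon> * (V * (d / m) ^ d)\<close> half of
    \<open>1 / (2 * m) ^ d\<close> for every \<open>m\<close>. The \<open>2\<close> inside the power
    comes from \<open>m + 1 \<le> 2 * m\<close>.\<close>
  define \<epsilon> where "\<epsilon> = 1 / (2 * V * (2 * real d) ^ d)"
  have \<epsilon>: "\<epsilon> > 0" using V d by (simp add: \<epsilon>_def)
  obtain \<delta> where \<delta>: "\<delta> > 0" and f_le: "\<And>x. norm x < \<delta> \<Longrightarrow> f\<^sub>1 x < \<epsilon>"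
    using isCont_f1 \<epsilon> f0 unfolding continuous_at_eps_delta
    by (metis abs_ge_self diff_zero dist_norm order_le_less_trans real_norm_def)
  obtain m :: nat where m: "real d / \<delta> < real m" using reals_Archimedean2 by blast
  moreover have "0 < real d / \<delta>" using d \<delta> by simp
  ultimately have m0: "real m > 0" by linarith
  define r where "r = real d / real m"
  have r: "r > 0" "r < \<delta>" using m m0 \<delta> d by (simp_all add: r_def field_simps)
  have dist: "distributed M lborel (\<lambda>\<omega>. U 1 \<omega> - U 2 \<omega>) (\<lambda>x. ennreal (f\<^sub>1 x))"
    using pdf_1[of 1 2] by (simp add: is_pdf_def)
  have "emeasure M {\<omega> \<in> space M. norm (U 1 \<omega> - U 2 \<omega>) \<le> r}
      = emeasure M ((\<lambda>\<omega>. U 1 \<omega> - U 2 \<omega>) -` cball 0 r \<inter> space M)"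
    by (rule arg_cong[where f = "emeasure M"]) auto
  also have "\<dots> = (\<integral>\<^sup>+x. ennreal (f\<^sub>1 x) * indicator (cball 0 r) x \<partial>lborel)"
    by (rule distributed_emeasure[OF dist]) simp
  also have "\<dots> \<le> (\<integral>\<^sup>+x. ennreal \<epsilon> * indicator (cball 0 r) x \<partial>(lborel :: 'a measure))"
    using r f_le[THEN less_imp_le] by (intro nn_integral_mono) (auto split: split_indicator intro!: ennreal_leI)
  also have "\<dots> = ennreal \<epsilon> * emeasure (lborel :: 'a measure) (cball 0 r)"
    by (simp add: nn_integral_cmult_indicator)
  also have "\<dots> = ennreal (\<epsilon> * (V * r ^ d))"
    using r \<epsilon> V by (simp add: emeasure_cball V_def d_def ennreal_mult)
  finally have "prob {\<omega> \<in> space M. norm (U 1 \<omega> - U 2 \<omega>) \<le> r} \<le> \<epsilon> * (V * r ^ d)"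
    using \<epsilon> V r by (simp add: emeasure_eq_measure)
  then have "1 / (real m + 1) ^ d \<le> \<epsilon> * (V * r ^ d)"
    using prob_close_ge[of m] m0 by (simp add: d_def r_def)
  moreover have "1 / (2 * real m) ^ d \<le> 1 / (real m + 1) ^ d"
    using m0 by (intro divide_left_mono power_mono mult_pos_pos zero_less_power) auto
  ultimately have "1 / (2 * real m) ^ d \<le> \<epsilon> * (V * r ^ d)" by linarith
  also have "\<dots> = 1 / 2 * (1 / (2 * real m) ^ d)"
    using V d m0 by (simp add: \<epsilon>_def r_def power_divide power_mult_distrib)
  finally have "1 / (2 * real m) ^ d \<le> 1 / 2 * (1 / (2 * real m) ^ d)" .
  moreover have "1 / (2 * real m) ^ d > 0" using m0 by simp
  ultimately show False by linarith
qed

end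

text \<open>Used with \<open>\<phi> t = K t * t ^ q\<close>, so that the numerator of a kernel
  average and its denominator, the case \<open>q = 0\<close>, are treated alike.\<close>

locale pair_kernel = iid_design M U f\<^sub>1 f\<^sub>2
  for M :: "'w measure" and U :: "nat \<Rightarrow> 'w \<Rightarrow> 'a::euclidean_space" and f\<^sub>1 f\<^sub>2 +
  fixes \<phi> :: "real \<Rightarrow> real" and R C :: real
  assumes phi_measurable [measurable]: "\<phi> \<in> borel_measurable borel"
    and phi_nonneg: "\<And>t. 0 \<le> t \<Longrightarrow> 0 \<le> \<phi> t"
    and phi_le: "\<And>t. 0 \<le> t \<Longrightarrow> \<phi> t \<le> C"
    and phi_0: "\<And>t. t > R \<Longrightarrow> \<phi> t = 0"
    and R_pos: "R > 0"
begin

text \<open>In unscaled positions a distance divided by the bandwidth becomes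
  \<open>norm (U i - U j) / p\<close> with \<open>p = h / L\<close>, so that only this ratio
  enters.\<close>

definition W :: "real \<Rightarrow> nat \<Rightarrow> nat \<Rightarrow> 'w \<Rightarrow> real" where
  "W p i j \<omega> = \<phi> (norm (U i \<omega> - U j \<omega>) / p)"

text \<open>The integral of \<open>\<phi> (norm x)\<close> over the whole space in polar form: the
  dimension times the volume of the unit ball is the area of the unit sphere.\<close>

definition mass :: real where
  "mass = real DIM('a) * unit_ball_vol (real DIM('a)) * (LINT r:{0..R}|lborel. r ^ (DIM('a) - 1) * \<phi> r)"

lemma C_nonneg: "0 \<le> C"
  using phi_nonneg[of 0] phi_le[of 0] by simp

lemma W_bounds:
  assumes "p > 0"
  shows "0 \<le> W p i j \<omega>" "W p i j \<omega> \<le> C" "\<bar>W p i j \<omega>\<bar> \<le> C"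
  using assms phi_nonneg[of "norm (U i \<omega> - U j \<omega>) / p"] phi_le[of "norm (U i \<omega> - U j \<omega>) / p"]
  by (simp_all add: W_def)

lemma W_commute: "W p i j \<omega> = W p j i \<omega>"
  by (simp add: W_def norm_minus_commute)

lemma W_measurable [measurable (raw)]: "i \<ge> 1 \<Longrightarrow> j \<ge> 1 \<Longrightarrow> W p i j \<in> borel_measurable M"
proof -
  assume "i \<ge> 1" "j \<ge> 1"
  note [measurable] = U_measurable[OF this(1)] U_measurable[OF this(2)]
  show ?thesis unfolding W_def by measurable
qed

lemma phi_le_indicator:
  fixes x :: 'a
  assumes "p > 0"
  shows "\<bar>\<phi> (norm x / p)\<bar> \<le> C * indicator (cball 0 (p * R)) x"
  using phi_nonneg[of "norm x / p"] phi_le[of "norm x / p"] phi_0[of "norm x / p"] assms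
  by (auto simp: field_simps split: split_indicator)

lemma integrable_cball: "integrable lborel (\<lambda>x::'a. C * indicator (cball 0 r) x :: real)"
  by (intro integrable_mult_right integrable_real_indicator)
    (use emeasure_bounded_finite[of "cball (0::'a) r"] in auto)

lemma integrable_phi: "p > 0 \<Longrightarrow> integrable lborel (\<lambda>x::'a. \<phi> (norm x / p))"
proof (rule Bochner_Integration.integrable_bound[OF integrable_cball[of "p * R"]])
  assume "p > 0"
  from order.trans[OF phi_le_indicator[OF this] abs_ge_self]
  show "AE x::'a in lborel. norm (\<phi> (norm x / p)) \<le> norm (C * indicator (cball 0 (p * R)) x :: real)"
    by (intro AE_I2) (simp only: real_norm_def)
qed simp

lemma integral_phi: "p > 0 \<Longrightarrow> (\<integral>x. \<phi> (norm (x::'a) / p) \<partial>lborel) = p ^ DIM('a) * mass"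
  unfolding mass_def by (rule integral_norm_scaled[where R = R]) (use phi_0 in auto)

lemma mass_nonneg: "0 \<le> mass"
proof -
  have "0 \<le> (\<integral>x. \<phi> (norm (x::'a) / 1) \<partial>lborel)"
    by (intro Bochner_Integration.integral_nonneg phi_nonneg) simp
  then show ?thesis unfolding integral_phi[OF zero_less_one] by simp
qed

lemma expectation_W:
  assumes "i \<ge> 1" "j \<ge> 1" "i \<noteq> j"
  shows "expectation (W p i j) = (\<integral>x. f\<^sub>1 x * \<phi> (norm x / p) \<partial>lborel)"
  unfolding W_def
  by (rule distributed_integral[symmetric, where X = "\<lambda>\<omega>. U i \<omega> - U j \<omega>"])
    (use pdf_1[OF assms] in \<open>auto simp: is_pdf_def\<close>)

text \<open>At scale \<open>p\<close> a summand sees only differences in the ball of radius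
  \<open>p * R\<close>, where \<open>f\<^sub>1\<close> is close to \<open>f\<^sub>1 0\<close>. One
  \<open>\<delta>\<close> serves all pairs because their differences share the density.\<close>

lemma expectation_W_approx:
  assumes e: "e > 0"
  obtains \<delta> where "\<delta> > 0"
    and "\<And>p i j. 0 < p \<Longrightarrow> p < \<delta> \<Longrightarrow> i \<ge> 1 \<Longrightarrow> j \<ge> 1 \<Longrightarrow> i \<noteq> j \<Longrightarrow>
      \<bar>expectation (W p i j) - p ^ DIM('a) * (f\<^sub>1 0 * mass)\<bar> \<le> e * p ^ DIM('a)"
proof -
  \<comment> \<open>\<open>mass\<close> may be zero, hence the added \<open>1\<close>.\<close>
  define \<eta> where "\<eta> = e / (mass + 1)"
  have \<eta>: "\<eta> > 0" using e mass_nonneg by (simp add: \<eta>_def)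
  have \<eta>_le: "\<eta> * mass \<le> e"
    using e mass_nonneg by (simp add: \<eta>_def divide_le_eq distrib_left mult_left_mono)
  obtain \<delta> where \<delta>: "\<delta> > 0" and close: "\<And>x. norm x < \<delta> \<Longrightarrow> \<bar>f\<^sub>1 x - f\<^sub>1 0\<bar> < \<eta>"
    using isCont_f1 \<eta> unfolding continuous_at_eps_delta dist_real_def by (auto simp: dist_norm)
  show thesis
  proof (rule that[of "\<delta> / R"])
    show "\<delta> / R > 0" using \<delta> R_pos by simp
    fix p :: real and i j :: nat
    assume p: "0 < p" "p < \<delta> / R" and ij: "i \<ge> 1" "j \<ge> 1" "i \<noteq> j"
    have near: "norm x < \<delta>" if "x \<in> cball 0 (p * R)" for x :: 'a
      using that p R_pos by (auto simp: field_simps)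
    have diff_le: "\<bar>(f\<^sub>1 x - f\<^sub>1 0) * \<phi> (norm x / p)\<bar> \<le> \<eta> * \<phi> (norm x / p)" for x
    proof (cases "x \<in> cball 0 (p * R)")
      case True
      then show ?thesis
        using close[OF near, THEN less_imp_le] phi_nonneg[of "norm x / p"] p
        by (auto simp: abs_mult intro!: mult_right_mono)
    next
      case False
      then have "\<phi> (norm x / p) = 0" using p by (intro phi_0) (auto simp: field_simps)
      then show ?thesis by simp
    qed
    have int_diff: "integrable lborel (\<lambda>x. (f\<^sub>1 x - f\<^sub>1 0) * \<phi> (norm x / p))"
    proof (rule Bochner_Integration.integrable_bound)
      show "integrable lborel (\<lambda>x::'a. \<eta> * \<phi> (norm x / p))"
        using integrable_phi[OF p(1)] by simp
      show "AE x in lborel. norm ((f\<^sub>1 x - f\<^sub>1 0) * \<phi> (norm x / p)) \<le> norm (\<eta> * \<phi> (norm x / p))"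
        using order.trans[OF diff_le abs_ge_self] by (simp only: real_norm_def) simp
    qed simp
    have "f\<^sub>1 x * \<phi> (norm x / p) = (f\<^sub>1 x - f\<^sub>1 0) * \<phi> (norm x / p) + f\<^sub>1 0 * \<phi> (norm x / p)" for x
      by (simp add: algebra_simps)
    then have "expectation (W p i j) =
        (\<integral>x. (f\<^sub>1 x - f\<^sub>1 0) * \<phi> (norm x / p) \<partial>lborel) + f\<^sub>1 0 * (p ^ DIM('a) * mass)"
      using expectation_W[OF ij, of p] int_diff integrable_phi[OF p(1)] by (simp add: integral_phi p(1))
    then have "\<bar>expectation (W p i j) - p ^ DIM('a) * (f\<^sub>1 0 * mass)\<bar> =
        \<bar>\<integral>x. (f\<^sub>1 x - f\<^sub>1 0) * \<phi> (norm x / p) \<partial>lborel\<bar>"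
      by (simp add: mult_ac)
    also have "\<dots> \<le> (\<integral>x. \<bar>(f\<^sub>1 x - f\<^sub>1 0) * \<phi> (norm x / p)\<bar> \<partial>lborel)"
      by (rule integral_abs_bound)
    also have "\<dots> \<le> (\<integral>x. \<eta> * \<phi> (norm (x::'a) / p) \<partial>lborel)"
      using diff_le int_diff integrable_phi[OF p(1)] by (intro integral_mono) auto
    also have "\<dots> = (\<eta> * mass) * p ^ DIM('a)"
      by (simp add: integral_phi p(1) mult_ac)
    also have "\<dots> \<le> e * p ^ DIM('a)"
      using \<eta>_le p by (intro mult_right_mono) auto
    finally show "\<bar>expectation (W p i j) - p ^ DIM('a) * (f\<^sub>1 0 * mass)\<bar> \<le> e * p ^ DIM('a)" .
  qed
qed

text \<open>Both differences must lie in the ball of radius \<open>p * R\<close>. The product of two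
  such balls has volume of order \<open>(p ^ d)\<^sup>2\<close>, and \<open>f\<^sub>2\<close> is
  bounded near zero. The order suffices, since the bound enters the variance only.\<close>

lemma expectation_W_shared_le:
  obtains \<delta> B where "\<delta> > 0" "B \<ge> 0"
    and "\<And>p i j k. 0 < p \<Longrightarrow> p < \<delta> \<Longrightarrow> i \<ge> 1 \<Longrightarrow> j \<ge> 1 \<Longrightarrow> k \<ge> 1 \<Longrightarrow> distinct [i, j, k] \<Longrightarrow>
      expectation (\<lambda>\<omega>. W p i j \<omega> * W p i k \<omega>) \<le> B * (p ^ DIM('a))\<^sup>2"
proof -
  obtain \<delta> where \<delta>: "\<delta> > 0" and close: "\<And>z. norm z < \<delta> \<Longrightarrow> \<bar>f\<^sub>2 z - f\<^sub>2 0\<bar> < 1"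
    using isCont_f2 zero_less_one unfolding continuous_at_eps_delta dist_real_def
    by (metis dist_norm diff_zero)
  define D where "D = f\<^sub>2 0 + 1"
  have D: "D \<ge> 0" using f2_nonneg[of 0] by (simp add: D_def)
  define V where "V = unit_ball_vol (real DIM('a))"
  have V: "V \<ge> 0" by (simp add: V_def)
  show thesis
  \<comment> \<open>If both components have norm at most \<open>p * R\<close>, the pair has norm at
    most \<open>2 * (p * R)\<close>.\<close>
  proof (rule that[of "\<delta> / (2 * R)" "D * (C * C) * (V * R ^ DIM('a))\<^sup>2"])
    show "\<delta> / (2 * R) > 0" using \<delta> R_pos by simp
    show "D * (C * C) * (V * R ^ DIM('a))\<^sup>2 \<ge> 0" using D C_nonneg by simp
    fix p :: real and i j k :: nat
    assume p: "0 < p" "p < \<delta> / (2 * R)" and ijk: "i \<ge> 1" "j \<ge> 1" "k \<ge> 1" "distinct [i, j, k]"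
    let ?B = "cball (0::'a) (p * R)"
    let ?Y = "\<lambda>\<omega>. (U i \<omega> - U j \<omega>, U i \<omega> - U k \<omega>)"
    define g where "g z = \<phi> (norm (fst z) / p) * \<phi> (norm (snd z) / p)" for z :: "'a \<times> 'a"
    have [measurable]: "g \<in> borel_measurable borel"
      unfolding g_def borel_prod[symmetric] by measurable
    have dist: "distributed M lborel ?Y (\<lambda>z. ennreal (f\<^sub>2 z))"
      using pdf_2[OF ijk] by (simp add: is_pdf_def)
    have le: "f\<^sub>2 z * g z \<le> (D * (C * C)) * indicator (?B \<times> ?B) z" for z
    proof (cases "z \<in> ?B \<times> ?B")
      case True
      then have "norm (fst z) \<le> p * R" "norm (snd z) \<le> p * R" by auto
      then have "norm z \<le> 2 * (p * R)"
        using norm_Pair_le[of "fst z" "snd z"] by (simp only: prod.collapse)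
      also have "\<dots> < \<delta>" using p R_pos by (simp add: field_simps)
      finally have "f\<^sub>2 z \<le> D" using close[of z] unfolding D_def by linarith
      moreover have "g z \<le> C * C" "0 \<le> g z"
        unfolding g_def using p C_nonneg by (auto intro!: mult_mono mult_nonneg_nonneg phi_le phi_nonneg)
      ultimately show ?thesis using True D by (auto intro!: mult_mono)
    next
      case False
      then have "g z = 0"
        using phi_0[of "norm (fst z) / p"] phi_0[of "norm (snd z) / p"] p
        by (cases z) (auto simp: g_def field_simps)
      then show ?thesis using False by simp
    qed
    have B: "emeasure lborel ?B = ennreal (V * (p * R) ^ DIM('a))"
      using p R_pos by (simp add: emeasure_cball V_def)
    have nonneg: "0 \<le> f\<^sub>2 z * g z" for z
      unfolding g_def using p by (intro mult_nonneg_nonneg f2_nonneg phi_nonneg) auto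
    have "expectation (\<lambda>\<omega>. W p i j \<omega> * W p i k \<omega>) = expectation (\<lambda>\<omega>. g (?Y \<omega>))"
      by (simp add: g_def W_def)
    also have "\<dots> = (\<integral>z. f\<^sub>2 z * g z \<partial>lborel)"
      by (rule distributed_integral[OF dist, symmetric]) (auto simp: f2_nonneg)
    also have "\<dots> = enn2real (\<integral>\<^sup>+z. ennreal (f\<^sub>2 z * g z) \<partial>lborel)"
      using nonneg by (intro integral_eq_nn_integral) auto
    also have "\<dots> \<le> D * (C * C) * (V * (p * R) ^ DIM('a))\<^sup>2"
    proof (rule enn2real_leI)
      have "(\<integral>\<^sup>+z. ennreal (f\<^sub>2 z * g z) \<partial>lborel)
          \<le> (\<integral>\<^sup>+z. ennreal (D * (C * C)) * indicator (?B \<times> ?B) z \<partial>lborel)"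
      proof (rule nn_integral_mono)
        fix z
        show "ennreal (f\<^sub>2 z * g z) \<le> ennreal (D * (C * C)) * indicator (?B \<times> ?B) z"
          using ennreal_leI[OF le[of z]] by (cases "z \<in> ?B \<times> ?B") simp_all
      qed
      also have "\<dots> = ennreal (D * (C * C)) * emeasure (lborel \<Otimes>\<^sub>M lborel) (?B \<times> ?B)"
        by (subst lborel_prod[symmetric], subst nn_integral_cmult_indicator) auto
      also have "emeasure (lborel \<Otimes>\<^sub>M lborel) (?B \<times> ?B) = emeasure lborel ?B * emeasure lborel ?B"
        by (rule lborel.emeasure_pair_measure_Times) auto
      also have "ennreal (D * (C * C)) * \<dots> = ennreal (D * (C * C) * (V * (p * R) ^ DIM('a))\<^sup>2)"
        unfolding B using D C_nonneg V p R_pos by (simp add: ennreal_mult power2_eq_square)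
      finally show "(\<integral>\<^sup>+z. ennreal (f\<^sub>2 z * g z) \<partial>lborel) \<le> \<dots>" .
    qed (use D C_nonneg in auto)
    also have "\<dots> = D * (C * C) * (V * R ^ DIM('a))\<^sup>2 * (p ^ DIM('a))\<^sup>2"
      by (simp add: power_mult_distrib mult_ac)
    finally show "expectation (\<lambda>\<omega>. W p i j \<omega> * W p i k \<omega>)
        \<le> D * (C * C) * (V * R ^ DIM('a))\<^sup>2 * (p ^ DIM('a))\<^sup>2" .
  qed
qed

text \<open>Independence of the points passes to functions of disjoint blocks of indices.\<close>

lemma expectation_W_disjoint:
  assumes "i \<ge> 1" "j \<ge> 1" "k \<ge> 1" "l \<ge> 1" "distinct [i, j, k, l]" and p: "p > 0"
  shows "expectation (\<lambda>\<omega>. W p i j \<omega> * W p k l \<omega>) = expectation (W p i j) * expectation (W p k l)"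
proof (rule indep_var_lebesgue_integral)
  have "indep_var (PiM {i, j} (\<lambda>_. borel)) (\<lambda>\<omega>. restrict (\<lambda>i. U i \<omega>) {i, j})
      (PiM {k, l} (\<lambda>_. borel)) (\<lambda>\<omega>. restrict (\<lambda>i. U i \<omega>) {k, l})"
    by (rule indep_var_restrict[OF indep_U]) (use assms in auto)
  from indep_var_compose[OF this, of "\<lambda>f. \<phi> (norm (f i - f j) / p)" borel
      "\<lambda>f. \<phi> (norm (f k - f l) / p)" borel]
  show "indep_var borel (W p i j) borel (W p k l)"
    by (simp add: comp_def W_def[abs_def])
  show "integrable M (W p i j)" "integrable M (W p k l)"
    using W_bounds(3)[OF p] assms by (auto intro!: integrable_const_bound[where B = C])
qed

text \<open>Relative to the square of \<open>n\<^sup>2 * p ^ d\<close>, the mean-square deviation is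
  of order \<open>1 / (n\<^sup>2 * p ^ d) + 1 / n\<close>, apart from the error of the mean. The
  first term comes from coinciding pairs and tends to zero by \<open>many\<close>, the second from
  pairs with one common point. The filter \<open>G\<close> allows the limit to be taken only along
  those \<open>n\<close> for which enough pairs are in range.\<close>

lemma expectation_pair_sum_tendsto:
  assumes p: "filterlim p (at_right 0) G" and G: "G \<le> sequentially"
    and many: "((\<lambda>n. 1 / ((real n)\<^sup>2 * p n ^ DIM('a))) \<longlongrightarrow> 0) G"
  shows "((\<lambda>n. expectation (\<lambda>\<omega>. \<bar>(\<Sum>(i, j)\<in>index_pairs n. W (p n) i j \<omega>) / ((real n)\<^sup>2 * p n ^ DIM('a))
      - f\<^sub>1 0 * mass\<bar>)) \<longlongrightarrow> 0) G"
proof -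
  define \<mu> where "\<mu> = f\<^sub>1 0 * mass"
  have \<mu>: "0 \<le> \<mu>" using f1_nonneg mass_nonneg by (simp add: \<mu>_def)
  define m where "m n = expectation (W (p n) 1 2)" for n
  define N where "N n = (real n)\<^sup>2 * p n ^ DIM('a)" for n
  define S where "S n \<omega> = (\<Sum>(i, j)\<in>index_pairs n. W (p n) i j \<omega>)" for n \<omega>
  have ev_p: "\<forall>\<^sub>F n in G. 0 < p n \<and> p n < \<delta>" if "\<delta> > 0" for \<delta>
    using p that eventually_at_right_less[of "0::real"] unfolding filterlim_at
    by (auto elim: eventually_elim2 dest: order_tendstoD(2))
  have ev_n: "\<forall>\<^sub>F n in G. 1 \<le> n"
    using eventually_ge_at_top[of "1::nat"] G by (simp add: le_filter_def)
  have mean_eq: "expectation (W q i j) = expectation (W q 1 2)"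
    if "i \<ge> 1" "j \<ge> 1" "i \<noteq> j" for q i j
    using that expectation_W[of i j q] expectation_W[of 1 2 q] by simp
  have m_lim: "((\<lambda>n. m n / p n ^ DIM('a)) \<longlongrightarrow> \<mu>) G"
  proof (rule tendstoI)
    fix e :: real assume "e > 0"
    then have "e / 2 > 0" by simp
    from expectation_W_approx[OF this] obtain \<delta> where \<delta>: "\<delta> > 0"
      and approx': "\<And>p i j. 0 < p \<Longrightarrow> p < \<delta> \<Longrightarrow> i \<ge> 1 \<Longrightarrow> j \<ge> 1 \<Longrightarrow> i \<noteq> j \<Longrightarrow>
        \<bar>expectation (W p i j) - p ^ DIM('a) * \<mu>\<bar> \<le> e / 2 * p ^ DIM('a)"
      unfolding \<mu>_def by blast
    have approx: "\<bar>expectation (W p 1 2) - p ^ DIM('a) * \<mu>\<bar> \<le> e / 2 * p ^ DIM('a)"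
      if "0 < p" "p < \<delta>" for p
      using approx'[OF that, of 1 2] by simp
    show "\<forall>\<^sub>F n in G. dist (m n / p n ^ DIM('a)) \<mu> < e"
      using ev_p[OF \<delta>]
    proof eventually_elim
      case (elim n)
      then have pos: "0 < p n ^ DIM('a)" by simp
      have "m n / p n ^ DIM('a) - \<mu> = (m n - p n ^ DIM('a) * \<mu>) / p n ^ DIM('a)"
        using elim by (simp add: diff_divide_distrib)
      then have "\<bar>m n / p n ^ DIM('a) - \<mu>\<bar> = \<bar>m n - p n ^ DIM('a) * \<mu>\<bar> / p n ^ DIM('a)"
        by (simp only: abs_div_pos[OF pos])
      also have "\<dots> \<le> e / 2"
        using approx[of "p n"] elim pos unfolding m_def by (simp add: divide_le_eq)
      finally have "\<bar>m n / p n ^ DIM('a) - \<mu>\<bar> \<le> e / 2" .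
      then show ?case using \<open>e > 0\<close> by (simp add: dist_real_def)
    qed
  qed
  from expectation_W_approx[OF zero_less_one] obtain \<delta>\<^sub>1 where \<delta>\<^sub>1: "\<delta>\<^sub>1 > 0"
    and mean_le': "\<And>p i j. 0 < p \<Longrightarrow> p < \<delta>\<^sub>1 \<Longrightarrow> i \<ge> 1 \<Longrightarrow> j \<ge> 1 \<Longrightarrow> i \<noteq> j \<Longrightarrow>
      \<bar>expectation (W p i j) - p ^ DIM('a) * \<mu>\<bar> \<le> 1 * p ^ DIM('a)"
    unfolding \<mu>_def by blast
  have mean_le: "\<bar>expectation (W p 1 2) - p ^ DIM('a) * \<mu>\<bar> \<le> p ^ DIM('a)"
    if "0 < p" "p < \<delta>\<^sub>1" for p
    using mean_le'[OF that, of 1 2] by simp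
  obtain \<delta>\<^sub>2 B\<^sub>2 where \<delta>\<^sub>2: "\<delta>\<^sub>2 > 0" and B\<^sub>2: "B\<^sub>2 \<ge> 0"
    and shared: "\<And>p i j k. 0 < p \<Longrightarrow> p < \<delta>\<^sub>2 \<Longrightarrow> i \<ge> 1 \<Longrightarrow> j \<ge> 1 \<Longrightarrow> k \<ge> 1 \<Longrightarrow> distinct [i, j, k] \<Longrightarrow>
      expectation (\<lambda>\<omega>. W p i j \<omega> * W p i k \<omega>) \<le> B\<^sub>2 * (p ^ DIM('a))\<^sup>2"
    using expectation_W_shared_le by blast
  define B\<^sub>1 where "B\<^sub>1 = C * (\<mu> + 1)"
  have B\<^sub>1: "B\<^sub>1 \<ge> 0" using C_nonneg \<mu> by (simp add: B\<^sub>1_def)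
  \<comment> \<open>The root bounds the fluctuation of the sum. The other term is the error of its
    mean: there are \<open>n\<^sup>2 - n\<close> pairs instead of \<open>n\<^sup>2\<close>, and
    \<open>m n\<close> is only asymptotic to \<open>\<mu>\<close> times the power of
    \<open>p n\<close>.\<close>
  define bound where "bound n = sqrt (2 * B\<^sub>1 * (1 / N n) + 4 * B\<^sub>2 * inverse (real n))
      + \<bar>(1 - inverse (real n)) * (m n / p n ^ DIM('a)) - \<mu>\<bar>" for n
  have inv_n: "((\<lambda>n. inverse (real n)) \<longlongrightarrow> 0) G"
    using lim_inverse_n by (rule tendsto_mono[OF G])
  have "(bound \<longlongrightarrow> sqrt (2 * B\<^sub>1 * 0 + 4 * B\<^sub>2 * 0) + \<bar>(1 - 0) * \<mu> - \<mu>\<bar>) G"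
    unfolding bound_def N_def by (intro tendsto_intros many inv_n m_lim)
  then have bound_lim: "(bound \<longlongrightarrow> 0) G" by simp
  have S_int: "integrable M (S n)" "integrable M (\<lambda>\<omega>. (S n \<omega> - c)\<^sup>2)" if "0 < p n" for n c
  proof -
    have [measurable]: "S n \<in> borel_measurable M"
      unfolding S_def by (auto simp: index_pairs_def intro!: borel_measurable_sum W_measurable)
    have S_le: "\<bar>S n \<omega>\<bar> \<le> (\<Sum>(i, j)\<in>index_pairs n. C)" for \<omega>
      unfolding S_def using W_bounds(3)[OF that]
      by (intro order.trans[OF sum_abs] sum_mono) auto
    then show "integrable M (S n)"
      by (intro integrable_const_bound[where B = "\<Sum>(i, j)\<in>index_pairs n. C"]) auto
    have "\<bar>S n \<omega> - c\<bar> \<le> (\<Sum>(i, j)\<in>index_pairs n. C) + \<bar>c\<bar>" for \<omega>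
      using S_le[of \<omega>] abs_triangle_ineq4[of "S n \<omega>" c] by linarith
    then have "(S n \<omega> - c)\<^sup>2 \<le> ((\<Sum>(i, j)\<in>index_pairs n. C) + \<bar>c\<bar>)\<^sup>2" for \<omega>
      by (metis abs_ge_zero power2_abs power_mono)
    then show "integrable M (\<lambda>\<omega>. (S n \<omega> - c)\<^sup>2)"
      by (intro integrable_const_bound[where B = "((\<Sum>(i, j)\<in>index_pairs n. C) + \<bar>c\<bar>)\<^sup>2"]) auto
  qed
  have "\<forall>\<^sub>F n in G. norm (expectation (\<lambda>\<omega>. \<bar>S n \<omega> / N n - \<mu>\<bar>)) \<le> bound n"
    using ev_p[OF \<delta>\<^sub>1] ev_p[OF \<delta>\<^sub>2] ev_n
  proof eventually_elim
    case (elim n)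
    then have pn: "0 < p n \<and> p n < \<delta>\<^sub>1 \<and> p n < \<delta>\<^sub>2" and n: "1 \<le> n" by auto
    let ?P = "p n ^ DIM('a)" and ?c = "(real n * real n - real n) * m n"
    have P: "?P > 0" using pn by simp
    have N: "N n > 0" using P n by (simp add: N_def)
    \<comment> \<open>From \<open>W\<^sup>2 \<le> C * W\<close> a second moment has the order of the
      mean, a single factor \<open>?P\<close>.\<close>
    have same: "expectation (\<lambda>\<omega>. W (p n) i j \<omega> * W (p n) i j \<omega>) \<le> B\<^sub>1 * ?P"
      if "i \<ge> 1" "j \<ge> 1" "i \<noteq> j" for i j
    proof -
      have "expectation (\<lambda>\<omega>. W (p n) i j \<omega> * W (p n) i j \<omega>) \<le> expectation (\<lambda>\<omega>. C * W (p n) i j \<omega>)"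
      proof (rule integral_mono)
        note [measurable] = W_measurable[OF that(1,2), of "p n"]
        have W: "0 \<le> W (p n) i j \<omega>" "W (p n) i j \<omega> \<le> C" for \<omega>
          using pn W_bounds[of "p n" i j] by auto
        show *: "W (p n) i j \<omega> * W (p n) i j \<omega> \<le> C * W (p n) i j \<omega>" for \<omega>
          using W by (intro mult_right_mono)
        have "W (p n) i j \<omega> * W (p n) i j \<omega> \<le> C * C" for \<omega>
          using W C_nonneg by (intro mult_mono) auto
        then show "integrable M (\<lambda>\<omega>. W (p n) i j \<omega> * W (p n) i j \<omega>)"
          by (intro integrable_const_bound[where B = "C * C"]) auto
        show "integrable M (\<lambda>\<omega>. C * W (p n) i j \<omega>)"
          using W by (intro integrable_mult_right integrable_const_bound[where B = C]) auto
      qed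
      also have "\<dots> = C * m n" using mean_eq[OF that, of "p n"] by (simp add: m_def)
      also have "\<dots> \<le> C * ((\<mu> + 1) * ?P)"
        using mean_le[of "p n"] pn C_nonneg unfolding m_def
        by (intro mult_left_mono) (auto simp: algebra_simps)
      finally show ?thesis by (simp add: B\<^sub>1_def mult_ac)
    qed
    have "expectation (\<lambda>\<omega>. ((\<Sum>(i, j)\<in>index_pairs n. W (p n) i j \<omega>) - ?c)\<^sup>2)
        \<le> (real n)\<^sup>2 * (2 * (B\<^sub>1 * ?P) + 4 * real n * (B\<^sub>2 * ?P\<^sup>2))"
    proof (rule pair_sum_variance)
      show "expectation (\<lambda>x. W (p n) i j x * W (p n) k l x) = (m n)\<^sup>2"
        if "{i, j, k, l} \<subseteq> {1..n}" "distinct [i, j, k, l]" for i j k l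
      proof -
        have "expectation (\<lambda>x. W (p n) i j x * W (p n) k l x)
            = expectation (W (p n) i j) * expectation (W (p n) k l)"
          by (rule expectation_W_disjoint) (use that pn in auto)
        then show ?thesis using that mean_eq[of i j "p n"] mean_eq[of k l "p n"]
          by (simp add: m_def power2_eq_square)
      qed
      show "expectation (\<lambda>x. W (p n) i j x * W (p n) i k x) \<le> B\<^sub>2 * ?P\<^sup>2"
        if "{i, j, k} \<subseteq> {1..n}" "distinct [i, j, k]" for i j k
        using that pn by (intro shared) auto
      show "\<bar>W (p n) i j x\<bar> \<le> C" for i j x using pn by (intro W_bounds) auto
      show "W (p n) i j x = W (p n) j i x" for i j x by (rule W_commute)
      show "expectation (W (p n) i j) = m n" if "i \<in> {1..n}" "j \<in> {1..n}" "i \<noteq> j" for i j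
        unfolding m_def using that by (intro mean_eq) auto
      show "expectation (\<lambda>x. W (p n) i j x * W (p n) i j x) \<le> B\<^sub>1 * ?P"
        if "i \<in> {1..n}" "j \<in> {1..n}" "i \<noteq> j" for i j
        using that by (intro same) auto
      show "W (p n) i j \<in> borel_measurable M" if "i \<in> {1..n}" "j \<in> {1..n}" for i j
        using that by (intro W_measurable) auto
      show "0 \<le> B\<^sub>1 * ?P" "0 \<le> B\<^sub>2 * ?P\<^sup>2" using P B\<^sub>1 B\<^sub>2 by simp_all
    qed
    then have var: "expectation (\<lambda>\<omega>. (S n \<omega> - ?c)\<^sup>2)
        \<le> (real n)\<^sup>2 * (2 * (B\<^sub>1 * ?P) + 4 * real n * (B\<^sub>2 * ?P\<^sup>2))"
      by (simp add: S_def)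
    have "expectation (\<lambda>\<omega>. \<bar>S n \<omega> / N n - \<mu>\<bar>)
        \<le> expectation (\<lambda>\<omega>. \<bar>S n \<omega> - ?c\<bar> / N n + \<bar>?c / N n - \<mu>\<bar>)"
    proof (rule integral_mono)
      fix \<omega>
      have "S n \<omega> / N n - \<mu> = (S n \<omega> - ?c) / N n + (?c / N n - \<mu>)" by (simp add: diff_divide_distrib)
      then show "\<bar>S n \<omega> / N n - \<mu>\<bar> \<le> \<bar>S n \<omega> - ?c\<bar> / N n + \<bar>?c / N n - \<mu>\<bar>"
        using abs_triangle_ineq[of "(S n \<omega> - ?c) / N n" "?c / N n - \<mu>"] by (simp only: abs_div_pos[OF N])
    qed (use S_int pn in auto)
    also have "\<dots> = expectation (\<lambda>\<omega>. \<bar>S n \<omega> - ?c\<bar>) / N n + \<bar>?c / N n - \<mu>\<bar>"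
      using S_int pn by (simp add: prob_space)
    also have "\<dots> \<le> sqrt ((real n)\<^sup>2 * (2 * (B\<^sub>1 * ?P) + 4 * real n * (B\<^sub>2 * ?P\<^sup>2))) / N n + \<bar>?c / N n - \<mu>\<bar>"
    proof (intro add_right_mono divide_right_mono)
      have "expectation (\<lambda>\<omega>. \<bar>S n \<omega> - ?c\<bar>) \<le> sqrt (expectation (\<lambda>\<omega>. (S n \<omega> - ?c)\<^sup>2))"
        using S_int pn by (intro expectation_abs_le_sqrt) auto
      also have "\<dots> \<le> sqrt ((real n)\<^sup>2 * (2 * (B\<^sub>1 * ?P) + 4 * real n * (B\<^sub>2 * ?P\<^sup>2)))"
        by (rule real_sqrt_le_mono[OF var])
      finally show "expectation (\<lambda>\<omega>. \<bar>S n \<omega> - ?c\<bar>) \<le> \<dots>" .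
    qed (use N in simp)
    also have "\<dots> = bound n"
    proof -
      have alg: "x\<^sup>2 * (2 * (b * q) + 4 * x * (c * q\<^sup>2)) / (x\<^sup>2 * q)\<^sup>2 = 2 * b * (1 / (x\<^sup>2 * q)) + 4 * c * inverse x"
        "(x * x - x) * c / (x\<^sup>2 * q) = (1 - inverse x) * (c / q)"
        if "x > 0" "q > 0" for x q b c :: real
        using that by (simp_all add: field_simps power2_eq_square)
      have "sqrt ((real n)\<^sup>2 * (2 * (B\<^sub>1 * ?P) + 4 * real n * (B\<^sub>2 * ?P\<^sup>2))) / N n
          = sqrt ((real n)\<^sup>2 * (2 * (B\<^sub>1 * ?P) + 4 * real n * (B\<^sub>2 * ?P\<^sup>2)) / (N n)\<^sup>2)"
        using N by (simp add: real_sqrt_divide)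
      also have "(real n)\<^sup>2 * (2 * (B\<^sub>1 * ?P) + 4 * real n * (B\<^sub>2 * ?P\<^sup>2)) / (N n)\<^sup>2
          = 2 * B\<^sub>1 * (1 / N n) + 4 * B\<^sub>2 * inverse (real n)"
        using P n unfolding N_def by (intro alg) auto
      finally have 1: "sqrt ((real n)\<^sup>2 * (2 * (B\<^sub>1 * ?P) + 4 * real n * (B\<^sub>2 * ?P\<^sup>2))) / N n
          = sqrt (2 * B\<^sub>1 * (1 / N n) + 4 * B\<^sub>2 * inverse (real n))" .
      have "?c / N n = (1 - inverse (real n)) * (m n / ?P)"
        using P n unfolding N_def by (intro alg) auto
      then show ?thesis unfolding bound_def 1 by simp
    qed
    finally show ?case
      by (simp add: abs_of_nonneg)
  qed
  then show ?thesis
    using bound_lim unfolding S_def N_def \<mu>_def by (rule Lim_null_comparison)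
qed

end

text \<open>The limits of numerator \<open>S q\<close> and denominator \<open>S 0\<close> pass to
  their quotient \<open>r\<close> without a lower bound for the random \<open>S 0\<close>:
  \<open>c 0 * (r - c q / c 0)\<close> equals \<open>(S q / N - c q) - r * (S 0 / N - c 0)\<close>,
  and \<open>r\<close> is bounded by \<open>R ^ q\<close>. Convergence in mean of the two sums is
  therefore enough.\<close>

lemma (in iid_design) kernel_average_tendsto:
  assumes K: "compact_kernel K R"
    and h: "\<And>n. h n > 0" and L: "\<forall>\<^sub>F n in G. L n > 0"
    and p: "filterlim (\<lambda>n. h n / L n) (at_right 0) G" and G: "G \<le> sequentially"
    and many: "((\<lambda>n. 1 / ((real n)\<^sup>2 * (h n / L n) ^ DIM('a))) \<longlongrightarrow> 0) G"
  shows "((\<lambda>n. expectation (\<lambda>\<omega>. \<bar>kernel_average K (h n) n (\<lambda>i. L n *\<^sub>R U i \<omega>)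
      (\<lambda>i j. norm (L n *\<^sub>R U i \<omega> - L n *\<^sub>R U j \<omega>) ^ q) / h n ^ q - moment_ratio K R DIM('a) q\<bar>)) \<longlongrightarrow> 0) G"
proof -
  define d where "d = DIM('a)"
  have R: "R > 0" and [measurable]: "K \<in> borel_measurable borel"
    using K by (auto simp: compact_kernel_def)
  obtain C where C: "\<And>t. 0 \<le> t \<Longrightarrow> \<bar>K t\<bar> \<le> C"
    using K unfolding compact_kernel_def bounded_iff by auto
  have C0: "C \<ge> 0" using C[of 0] by linarith
  define \<phi> where "\<phi> q t = K t * t ^ q" for q t
  have pk: "pair_kernel M U f\<^sub>1 f\<^sub>2 (\<phi> q) R (C * R ^ q)" for q
  proof
    show "\<phi> q \<in> borel_measurable borel" unfolding \<phi>_def by measurable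
    show 1: "\<phi> q t = 0" if "t > R" for t using K that by (simp add: \<phi>_def compact_kernel_def)
    show "0 \<le> \<phi> q t" if "0 \<le> t" for t
      using that compact_kernel_nonneg[OF K that] by (simp add: \<phi>_def)
    show "\<phi> q t \<le> C * R ^ q" if "0 \<le> t" for t
    proof (cases "t \<le> R")
      case True
      then show ?thesis
        using C[OF that] C0 that unfolding \<phi>_def by (intro mult_mono power_mono) auto
    next
      case False
      then show ?thesis using 1[of t] C0 R by simp
    qed
  qed (use R in auto)
  define S where "S q n \<omega> = (\<Sum>(i, j)\<in>index_pairs n. \<phi> q (norm (U i \<omega> - U j \<omega>) / (h n / L n)))" for q n \<omega>
  \<comment> \<open>The limit of \<open>S q n / N n\<close>. In \<open>c q / c 0\<close> the value
    \<open>f\<^sub>1 0\<close> and the area of the unit sphere cancel, which leaves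
    \<open>moment_ratio\<close>.\<close>
  define c where "c q = f\<^sub>1 0 * (real d * unit_ball_vol (real d) * kernel_moment K R (d + q))" for q
  define N where "N n = (real n)\<^sup>2 * (h n / L n) ^ d" for n
  have d: "d > 0" by (simp add: d_def)
  have c0: "c 0 > 0" using f1_pos d kernel_moment_pos[OF K d] by (simp add: c_def)
  have V: "unit_ball_vol (real d) \<noteq> 0" using unit_ball_vol_pos[of "real d"] by linarith
  have c_ratio: "c q / c 0 = moment_ratio K R DIM('a) q"
    using f1_pos V by (simp add: c_def moment_ratio_def d_def)
  have moment: "(LINT r:{0..R}|lborel. r ^ (d - 1) * \<phi> q r) = kernel_moment K R (d + q)" for q
    unfolding kernel_moment_def \<phi>_def
  proof (rule arg_cong[where f = "\<lambda>g. set_lebesgue_integral lborel {0..R} g"], rule ext)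
    show "r ^ (d - 1) * (K r * r ^ q) = r ^ (d + q - 1) * K r" for r
    proof -
      have "d + q - 1 = (d - 1) + q" using d by simp
      then show ?thesis by (simp add: power_add)
    qed
  qed
  have lim: "((\<lambda>n. expectation (\<lambda>\<omega>. \<bar>S q n \<omega> / N n - c q\<bar>)) \<longlongrightarrow> 0) G" for q
    using pair_kernel.expectation_pair_sum_tendsto[OF pk p G many, of q]
    unfolding pair_kernel.W_def[OF pk] pair_kernel.mass_def[OF pk] S_def N_def c_def
    by (simp only: d_def[symmetric] moment)
  have S_meas: "S q n \<in> borel_measurable M" for q n
  proof -
    have "(\<lambda>\<omega>. \<phi> q (norm (U i \<omega> - U j \<omega>) / (h n / L n))) \<in> borel_measurable M"
      if "(i, j) \<in> index_pairs n" for i j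
      using pair_kernel.W_measurable[OF pk, of i j q "h n / L n"] that
      by (auto simp: pair_kernel.W_def[OF pk, abs_def] index_pairs_def)
    then show ?thesis unfolding S_def by (intro borel_measurable_sum) auto
  qed
  define r where "r n \<omega> = kernel_average K (h n) n (\<lambda>i. L n *\<^sub>R U i \<omega>)
      (\<lambda>i j. norm (L n *\<^sub>R U i \<omega> - L n *\<^sub>R U j \<omega>) ^ q) / h n ^ q" for n \<omega>
  have r_bounds: "0 \<le> r n \<omega>" "r n \<omega> \<le> R ^ q" for n \<omega>
    using kernel_average_norm_power[OF K h, of n n "\<lambda>i. L n *\<^sub>R U i \<omega>" q] h[of n]
    by (simp_all add: r_def divide_le_eq power_mult_distrib mult.commute)
  have r_meas: "r n \<in> borel_measurable M" for n
    unfolding r_def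
  proof (intro borel_measurable_divide kernel_average_measurable)
    fix i j assume "i \<in> {1..n}" "j \<in> {1..n}"
    then have "i \<ge> 1" "j \<ge> 1" by auto
    note [measurable] = U_measurable[OF this(1)] U_measurable[OF this(2)]
    show "(\<lambda>\<omega>. norm (L n *\<^sub>R U i \<omega> - L n *\<^sub>R U j \<omega>) ^ q) \<in> borel_measurable M"
      by measurable
  next
    show "(\<lambda>\<omega>. L n *\<^sub>R U i \<omega>) \<in> borel_measurable M" if "i \<in> {1..n}" for i
      using U_measurable[of i] that by auto
  qed auto
  \<comment> \<open>The product form also covers \<open>S 0 n \<omega> = 0\<close>: the weights are
    nonnegative, so each of them is zero, and so is \<open>S q n \<omega>\<close>.\<close>
  have r_S: "r n \<omega> * S 0 n \<omega> = S q n \<omega>" if Ln: "L n > 0" for n \<omega>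
  proof -
    have pos: "h n / L n > 0" using Ln h by simp
    have dist: "norm (L n *\<^sub>R U i \<omega> - L n *\<^sub>R U j \<omega>) = L n * norm (U i \<omega> - U j \<omega>)" for i j
      using Ln by (simp flip: scaleR_diff_right)
    have "kernel_average K (h n) n (\<lambda>i. L n *\<^sub>R U i \<omega>)
        (\<lambda>i j. norm (L n *\<^sub>R U i \<omega> - L n *\<^sub>R U j \<omega>) ^ q)
        = kernel_average K (h n) n (\<lambda>i. L n *\<^sub>R U i \<omega>)
        (\<lambda>i j. h n ^ q * (norm (U i \<omega> - U j \<omega>) / (h n / L n)) ^ q)"
      using h[of n] Ln by (simp add: dist power_mult_distrib power_divide mult.commute)
    then have "r n \<omega> = kernel_average K (h n) n (\<lambda>i. L n *\<^sub>R U i \<omega>)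
        (\<lambda>i j. (norm (U i \<omega> - U j \<omega>) / (h n / L n)) ^ q)"
      using h[of n] by (simp only: r_def kernel_average_cmult) simp
    also have "\<dots> = S q n \<omega> / S 0 n \<omega>"
      using Ln unfolding kernel_average_def index_pairs_def[symmetric] S_def \<phi>_def dist
      by (simp add: mult.commute)
    finally have r: "r n \<omega> = S q n \<omega> / S 0 n \<omega>" .
    show ?thesis
    proof (cases "S 0 n \<omega> = 0")
      case True
      have "0 \<le> \<phi> 0 (norm (U i \<omega> - U j \<omega>) / (h n / L n))" for i j
        using pair_kernel.phi_nonneg[OF pk] pos by (metis divide_nonneg_pos norm_ge_zero)
      then have "\<phi> 0 (norm (U i \<omega> - U j \<omega>) / (h n / L n)) = 0" if "(i, j) \<in> index_pairs n" for i j
        using True that unfolding S_def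
        by (subst (asm) sum_nonneg_eq_0_iff) (auto simp: case_prod_unfold)
      then have "S q n \<omega> = 0"
        unfolding S_def by (intro sum.neutral) (auto simp: \<phi>_def)
      then show ?thesis using True by simp
    qed (simp add: r)
  qed
  have ev_n: "\<forall>\<^sub>F n in G. 1 \<le> n"
    using eventually_ge_at_top[of "1::nat"] G by (simp add: le_filter_def)
  have ev_le: "\<forall>\<^sub>F n in G. norm (expectation (\<lambda>\<omega>. \<bar>r n \<omega> - c q / c 0\<bar>))
      \<le> (R ^ q * expectation (\<lambda>\<omega>. \<bar>S 0 n \<omega> / N n - c 0\<bar>) + expectation (\<lambda>\<omega>. \<bar>S q n \<omega> / N n - c q\<bar>)) / c 0"
    using L ev_n
  proof eventually_elim
    case (elim n)
    have pos: "h n / L n > 0" using elim h by simp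
    have N: "N n > 0" using pos elim by (simp add: N_def)
    have le: "\<bar>r n \<omega> - c q / c 0\<bar> \<le> (R ^ q * \<bar>S 0 n \<omega> / N n - c 0\<bar> + \<bar>S q n \<omega> / N n - c q\<bar>) / c 0" for \<omega>
    proof -
      have "c 0 * (r n \<omega> - c q / c 0) = (S q n \<omega> / N n - c q) - r n \<omega> * (S 0 n \<omega> / N n - c 0)"
        using c0 r_S[of n \<omega>] elim by (simp add: right_diff_distrib)
      then have "c 0 * \<bar>r n \<omega> - c q / c 0\<bar> = \<bar>(S q n \<omega> / N n - c q) - r n \<omega> * (S 0 n \<omega> / N n - c 0)\<bar>"
        using c0 by (metis abs_mult abs_of_pos)
      also have "\<dots> \<le> \<bar>S q n \<omega> / N n - c q\<bar> + r n \<omega> * \<bar>S 0 n \<omega> / N n - c 0\<bar>"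
        using abs_triangle_ineq4[of "S q n \<omega> / N n - c q" "r n \<omega> * (S 0 n \<omega> / N n - c 0)"]
          r_bounds(1)[of n \<omega>] by (simp add: abs_mult)
      also have "\<dots> \<le> \<bar>S q n \<omega> / N n - c q\<bar> + R ^ q * \<bar>S 0 n \<omega> / N n - c 0\<bar>"
        using r_bounds(2)[of n \<omega>] by (intro add_left_mono mult_right_mono) auto
      finally show ?thesis using c0 by (simp add: le_divide_eq mult.commute add.commute)
    qed
    have int_S: "integrable M (\<lambda>\<omega>. \<bar>S q n \<omega> / N n - c q\<bar>)" for q
    proof -
      have "\<bar>S q n \<omega>\<bar> \<le> (\<Sum>(i, j)\<in>index_pairs n. C * R ^ q)" for \<omega>
        using pair_kernel.W_bounds(3)[OF pk pos] unfolding S_def pair_kernel.W_def[OF pk]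
        by (intro order.trans[OF sum_abs] sum_mono) auto
      then have "integrable M (S q n)"
        using S_meas
        by (intro integrable_const_bound[where B = "\<Sum>(i, j)\<in>index_pairs n. C * R ^ q"]) auto
      then show ?thesis by simp
    qed
    have "integrable M (r n)"
      using r_meas r_bounds[of n] by (intro integrable_const_bound[where B = "R ^ q"]) auto
    then have int_r: "integrable M (\<lambda>\<omega>. \<bar>r n \<omega> - c q / c 0\<bar>)" by simp
    have "expectation (\<lambda>\<omega>. \<bar>r n \<omega> - c q / c 0\<bar>)
        \<le> expectation (\<lambda>\<omega>. (R ^ q * \<bar>S 0 n \<omega> / N n - c 0\<bar> + \<bar>S q n \<omega> / N n - c q\<bar>) / c 0)"
      using int_S int_r le by (intro integral_mono) auto
    also have "\<dots> = (R ^ q * expectation (\<lambda>\<omega>. \<bar>S 0 n \<omega> / N n - c 0\<bar>)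
        + expectation (\<lambda>\<omega>. \<bar>S q n \<omega> / N n - c q\<bar>)) / c 0"
      using int_S[of 0] int_S[of q] by simp
    finally show ?case by (simp add: abs_of_nonneg)
  qed
  have "((\<lambda>n. (R ^ q * expectation (\<lambda>\<omega>. \<bar>S 0 n \<omega> / N n - c 0\<bar>)
      + expectation (\<lambda>\<omega>. \<bar>S q n \<omega> / N n - c q\<bar>)) / c 0) \<longlongrightarrow> (R ^ q * 0 + 0) / c 0) G"
    using c0 by (intro tendsto_intros lim) auto
  then have "((\<lambda>n. (R ^ q * expectation (\<lambda>\<omega>. \<bar>S 0 n \<omega> / N n - c 0\<bar>)
      + expectation (\<lambda>\<omega>. \<bar>S q n \<omega> / N n - c q\<bar>)) / c 0) \<longlongrightarrow> 0) G"
    by (simp only: mult_zero_right add_0 div_0)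
  from Lim_null_comparison[OF ev_le this]
  have "((\<lambda>n. expectation (\<lambda>\<omega>. \<bar>r n \<omega> - c q / c 0\<bar>)) \<longlongrightarrow> 0) G" .
  then show ?thesis unfolding r_def c_ratio .
qed

section \<open>Expectation over the field values\<close>

lemma kernel_average_integral:
  assumes "\<And>i j. integrable N (\<lambda>w. A w i j)"
  shows "integrable N (\<lambda>w. kernel_average K h n s (A w))"
    and "(\<integral>w. kernel_average K h n s (A w) \<partial>N) = kernel_average K h n s (\<lambda>i j. \<integral>w. A w i j \<partial>N)"
  using assms
  by (auto simp: kernel_average_def case_prod_unfold Bochner_Integration.integral_sum
      intro!: Bochner_Integration.integrable_sum)

text \<open>Smoothness concerns \<open>F\<close> near zero only, whereas integrating
  \<open>F (a \<omega>)\<close> calls for Borel measurability on the whole line. It follows from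
  joint measurability of the field, since \<open>F r\<close> is an integral over the field values
  with parameter \<open>r\<close>.\<close>

lemma semivariogram_measurable:
  fixes Y :: "'a::euclidean_space \<Rightarrow> 'x \<Rightarrow> real"
  assumes "prob_space Q" and Y [measurable]: "case_prod Y \<in> borel_measurable (borel \<Otimes>\<^sub>M Q)"
    and F: "\<And>x y. (\<integral>w. (Y x w - Y y w)\<^sup>2 \<partial>Q) = 2 * F (norm (x - y))" and even: "\<And>r. F (- r) = F r"
  shows "F \<in> borel_measurable borel"
proof -
  interpret Q: prob_space Q by fact
  obtain e :: 'a where e: "norm e = 1" using nonempty_Basis norm_Basis by blast
  have "F r = (\<integral>w. (Y (r *\<^sub>R e) w - Y 0 w)\<^sup>2 \<partial>Q) / 2" for r
    using F[of "r *\<^sub>R e" 0] e even[of r] by (simp add: abs_if)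
  moreover have "(\<lambda>r. (\<integral>w. (Y (r *\<^sub>R e) w - Y 0 w)\<^sup>2 \<partial>Q) / 2) \<in> borel_measurable borel"
  proof (intro borel_measurable_divide Q.borel_measurable_lebesgue_integral)
    have [measurable]: "(\<lambda>x. Y (fst x *\<^sub>R e) (snd x)) \<in> borel_measurable (borel \<Otimes>\<^sub>M Q)"
      "(\<lambda>x. Y 0 (snd x)) \<in> borel_measurable (borel \<Otimes>\<^sub>M Q)"
      by (rule measurable_compose[OF _ Y, of "\<lambda>x. (fst x *\<^sub>R e, snd x)", simplified]; measurable)
        (rule measurable_compose[OF _ Y, of "\<lambda>x. (0, snd x)", simplified]; measurable)
    show "(\<lambda>(r, w). (Y (r *\<^sub>R e) w - Y 0 w)\<^sup>2) \<in> borel_measurable (borel \<Otimes>\<^sub>M Q)"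
      unfolding case_prod_unfold by measurable
  qed auto
  ultimately show ?thesis by presburger
qed

text \<open>For the target, which depends on the positions only: the field contributes total mass
  one.\<close>

lemma integral_snd_prob:
  fixes g :: "'w \<Rightarrow> real"
  assumes Q: "prob_space Q" and M: "prob_space M" and g: "integrable M g"
  shows "integrable (Q \<Otimes>\<^sub>M M) (\<lambda>(w, \<omega>). g \<omega>)"
    and "(\<integral>(w, \<omega>). g \<omega> \<partial>(Q \<Otimes>\<^sub>M M)) = (\<integral>\<omega>. g \<omega> \<partial>M)"
proof -
  interpret Q: prob_space Q by fact
  interpret M: prob_space M by fact
  interpret pair_prob_space Q M ..
  have distr: "distr (Q \<Otimes>\<^sub>M M) M snd = M"
  proof (rule measure_eqI)
    fix A assume "A \<in> sets (distr (Q \<Otimes>\<^sub>M M) M snd)"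
    then have A: "A \<in> sets M" by simp
    then have "snd -` A \<inter> space (Q \<Otimes>\<^sub>M M) = space Q \<times> A"
      using sets.sets_into_space by (auto simp: space_pair_measure)
    then show "emeasure (distr (Q \<Otimes>\<^sub>M M) M snd) A = emeasure M A"
      using A by (simp add: emeasure_distr M.emeasure_pair_measure_Times Q.emeasure_space_1)
  qed simp
  have "integrable (distr (Q \<Otimes>\<^sub>M M) M snd) g" unfolding distr by (rule g)
  then show "integrable (Q \<Otimes>\<^sub>M M) (\<lambda>(w, \<omega>). g \<omega>)"
    by (subst (asm) integrable_distr_eq) (use g in \<open>auto simp: case_prod_unfold\<close>)
  have "(\<integral>\<omega>. g \<omega> \<partial>M) = (\<integral>\<omega>. g \<omega> \<partial>distr (Q \<Otimes>\<^sub>M M) M snd)" unfolding distr ..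
  also have "\<dots> = (\<integral>x. g (snd x) \<partial>(Q \<Otimes>\<^sub>M M))"
    by (rule integral_distr) (use g in auto)
  finally show "(\<integral>(w, \<omega>). g \<omega> \<partial>(Q \<Otimes>\<^sub>M M)) = (\<integral>\<omega>. g \<omega> \<partial>M)"
    by (simp add: case_prod_unfold)
qed

text \<open>The weights depend on the positions only, so at fixed positions the expectation over the
  field replaces each squared increment by \<open>2 * F\<close>. Nonnegativity of the estimator
  permits Tonelli, and the bound on \<open>F\<close> over the kernel range makes the outer integral
  finite.\<close>

lemma kernel_average_expectation_field:
  fixes Y :: "'a::euclidean_space \<Rightarrow> 'x \<Rightarrow> real" and s :: "nat \<Rightarrow> 'w \<Rightarrow> 'a"
  assumes Q: "prob_space Q" and M: "prob_space M"
    and Y: "case_prod Y \<in> borel_measurable (borel \<Otimes>\<^sub>M Q)"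
    and s: "\<And>i. i \<in> {1..n} \<Longrightarrow> s i \<in> borel_measurable M"
    and int: "\<And>x y. integrable Q (\<lambda>w. (Y x w - Y y w)\<^sup>2)"
    and F: "\<And>x y. (\<integral>w. (Y x w - Y y w)\<^sup>2 \<partial>Q) = 2 * F (norm (x - y))"
    and K: "compact_kernel K R" and h: "h > 0"
    and bound: "B \<ge> 0" "\<And>r. 0 \<le> r \<Longrightarrow> r \<le> h * R \<Longrightarrow> F r \<le> B"
  defines "E \<equiv> (\<lambda>(w, \<omega>). kernel_average K h n (\<lambda>i. s i \<omega>) (\<lambda>i j. (Y (s i \<omega>) w - Y (s j \<omega>) w)\<^sup>2))"
    and "E' \<equiv> (\<lambda>\<omega>. 2 * kernel_average K h n (\<lambda>i. s i \<omega>) (\<lambda>i j. F (norm (s i \<omega> - s j \<omega>))))"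
  shows "integrable (Q \<Otimes>\<^sub>M M) E" and "integrable M E'"
    and "(\<integral>x. E x \<partial>(Q \<Otimes>\<^sub>M M)) = (\<integral>\<omega>. E' \<omega> \<partial>M)"
proof -
  interpret Q: prob_space Q by fact
  interpret M: prob_space M by fact
  interpret pair_prob_space Q M ..
  have [measurable]: "K \<in> borel_measurable borel" using K by (simp add: compact_kernel_def)
  have Ys: "(\<lambda>x. Y (s i (snd x)) (fst x)) \<in> borel_measurable (Q \<Otimes>\<^sub>M M)" if "i \<in> {1..n}" for i
  proof -
    note [measurable] = s[OF that]
    have "(\<lambda>x. (s i (snd x), fst x)) \<in> Q \<Otimes>\<^sub>M M \<rightarrow>\<^sub>M borel \<Otimes>\<^sub>M Q" by measurable
    from measurable_compose[OF this Y] show ?thesis by simp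
  qed
  have s': "(\<lambda>x. s i (snd x)) \<in> borel_measurable (Q \<Otimes>\<^sub>M M)" if "i \<in> {1..n}" for i
    using measurable_compose[OF measurable_snd s[OF that]] .
  have E_meas: "E \<in> borel_measurable (Q \<Otimes>\<^sub>M M)"
    unfolding E_def case_prod_unfold
    by (intro kernel_average_measurable borel_measurable_power borel_measurable_diff s' Ys) auto
  have E_nonneg: "0 \<le> E x" for x
    unfolding E_def case_prod_unfold by (intro kernel_average_nonneg[OF K h]) simp
  have inner_int: "integrable Q (\<lambda>w. E (w, \<omega>))" for \<omega>
    unfolding E_def split_conv by (intro kernel_average_integral int)
  have inner: "(\<integral>w. E (w, \<omega>) \<partial>Q) = E' \<omega>" for \<omega>
    unfolding E_def E'_def split_conv
    by (subst kernel_average_integral) (simp_all only: int F kernel_average_cmult)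
  have E'_nonneg: "0 \<le> E' \<omega>" for \<omega>
    unfolding inner[symmetric] using E_nonneg by simp
  have E'_le: "E' \<omega> \<le> 2 * B" for \<omega>
    unfolding E'_def using bound by (intro mult_left_mono kernel_average_const_le[OF K h]) auto
  have E'_meas: "E' \<in> borel_measurable M"
    unfolding inner[symmetric]
    by (rule Q.borel_measurable_lebesgue_integral)
      (use measurable_compose[OF measurable_pair_swap' E_meas] in \<open>simp add: case_prod_unfold\<close>)
  show int_E': "integrable M E'"
    using E'_nonneg E'_le E'_meas by (intro M.integrable_const_bound[where B = "2 * B"]) auto
  have nn: "(\<integral>\<^sup>+x. ennreal (E x) \<partial>(Q \<Otimes>\<^sub>M M)) = (\<integral>\<^sup>+\<omega>. ennreal (E' \<omega>) \<partial>M)"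
  proof -
    have "(\<integral>\<^sup>+x. ennreal (E x) \<partial>(Q \<Otimes>\<^sub>M M)) = (\<integral>\<^sup>+\<omega>. (\<integral>\<^sup>+w. ennreal (E (w, \<omega>)) \<partial>Q) \<partial>M)"
      by (rule nn_integral_snd[symmetric]) (use E_meas in simp)
    also have "\<dots> = (\<integral>\<^sup>+\<omega>. ennreal (E' \<omega>) \<partial>M)"
      using nn_integral_eq_integral[OF inner_int] E_nonneg by (simp add: inner)
    finally show ?thesis .
  qed
  also have "\<dots> < \<infinity>"
    using int_E' E'_nonneg by (simp add: nn_integral_eq_integral)
  finally show int_E: "integrable (Q \<Otimes>\<^sub>M M) E"
    using E_meas E_nonneg by (intro integrableI_nonneg) auto
  show "(\<integral>x. E x \<partial>(Q \<Otimes>\<^sub>M M)) = (\<integral>\<omega>. E' \<omega> \<partial>M)"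
    using nn E_meas E'_meas E_nonneg E'_nonneg by (simp add: integral_eq_nn_integral)
qed

text \<open>Estimator and target become the same factor \<open>2 * d\<close> times expectations over
  the positions: on one side the \<open>2\<close> stems from squared increments, on the other from
  \<open>gradient_constraint\<close>. Integrability has to be shown along the way, because the bias
  is the integral of a difference.\<close>

lemma gradient_constraint_expectations:
  fixes Y :: "'a::euclidean_space \<Rightarrow> 'x \<Rightarrow> real" and s :: "nat \<Rightarrow> 'w \<Rightarrow> 'a" and a :: "'w \<Rightarrow> real"
  assumes Q: "prob_space Q" and M: "prob_space M"
    and Y: "case_prod Y \<in> borel_measurable (borel \<Otimes>\<^sub>M Q)"
    and s: "\<And>i. i \<in> {1..n} \<Longrightarrow> s i \<in> borel_measurable M"
    and int: "\<And>x y. integrable Q (\<lambda>w. (Y x w - Y y w)\<^sup>2)"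
    and F: "\<And>x y. (\<integral>w. (Y x w - Y y w)\<^sup>2 \<partial>Q) = 2 * F (norm (x - y))"
    and F_borel: "F \<in> borel_measurable borel"
    and K: "compact_kernel K R" and h: "h > 0"
    and bound: "\<And>r. 0 \<le> r \<Longrightarrow> r \<le> h * R \<Longrightarrow> 0 \<le> F r \<and> F r \<le> B"
    and a: "\<And>\<omega>. a \<omega> \<ge> 0"
      "\<And>\<omega>. (a \<omega>)\<^sup>2 = kernel_average K h n (\<lambda>i. s i \<omega>) (\<lambda>i j. (norm (s i \<omega> - s j \<omega>))\<^sup>2)"
  defines "E \<equiv> (\<lambda>x. sample_gradient_constraint K h n (\<lambda>i. s i (snd x)) (\<lambda>i. Y (s i (snd x)) (fst x)))"
    and "E' \<equiv> (\<lambda>\<omega>. kernel_average K h n (\<lambda>i. s i \<omega>) (\<lambda>i j. F (norm (s i \<omega> - s j \<omega>))))"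
    and "T \<equiv> (\<lambda>\<omega>. gradient_constraint DIM('a) F (a \<omega>))"
  shows "integrable M E'" and "integrable M (\<lambda>\<omega>. F (a \<omega>))" and "integrable M (\<lambda>\<omega>. (a \<omega>)\<^sup>2)"
    and "(\<integral>x. E x \<partial>(Q \<Otimes>\<^sub>M M)) = 2 * real DIM('a) * (\<integral>\<omega>. E' \<omega> \<partial>M)"
    and "(\<integral>x. T (snd x) \<partial>(Q \<Otimes>\<^sub>M M)) = 2 * real DIM('a) * (\<integral>\<omega>. F (a \<omega>) \<partial>M)"
    and "(\<integral>x. E x - T (snd x) \<partial>(Q \<Otimes>\<^sub>M M)) = 2 * real DIM('a) * ((\<integral>\<omega>. E' \<omega> \<partial>M) - (\<integral>\<omega>. F (a \<omega>) \<partial>M))"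
proof -
  interpret M: prob_space M by fact
  have R: "R > 0" and K_borel: "K \<in> borel_measurable borel" using K by (auto simp: compact_kernel_def)
  have B: "B \<ge> 0" using bound[of 0] h R by auto
  note field = kernel_average_expectation_field[OF Q M Y s int F K h B bound[THEN conjunct2]]
  have E_eq: "E = (\<lambda>x. real DIM('a) * (case x of (w, \<omega>) \<Rightarrow>
      kernel_average K h n (\<lambda>i. s i \<omega>) (\<lambda>i j. (Y (s i \<omega>) w - Y (s j \<omega>) w)\<^sup>2)))"
    by (simp add: E_def sample_gradient_constraint_def case_prod_unfold)
  have "integrable M (\<lambda>\<omega>. 2 * E' \<omega>)" unfolding E'_def by (rule field(2))
  then show int_E': "integrable M E'" by simp
  have int_E: "integrable (Q \<Otimes>\<^sub>M M) E" unfolding E_eq by (intro integrable_mult_right field(1))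
  show int_eq: "(\<integral>x. E x \<partial>(Q \<Otimes>\<^sub>M M)) = 2 * real DIM('a) * (\<integral>\<omega>. E' \<omega> \<partial>M)"
    using field(3) by (simp add: E_eq E'_def)
  have a_le: "(a \<omega>)\<^sup>2 \<le> (h * R)\<^sup>2" for \<omega>
    unfolding a(2) by (rule kernel_average_norm_power(2)[OF K h])
  then have a_le': "a \<omega> \<le> h * R" for \<omega>
    using h R by (auto intro: power2_le_imp_le)
  have a2_meas: "(\<lambda>\<omega>. (a \<omega>)\<^sup>2) \<in> borel_measurable M"
    unfolding a(2)
  proof (intro kernel_average_measurable K_borel s)
    fix i j assume "i \<in> {1..n}" "j \<in> {1..n}"
    note [measurable] = s[OF this(1)] s[OF this(2)]
    show "(\<lambda>\<omega>. (norm (s i \<omega> - s j \<omega>))\<^sup>2) \<in> borel_measurable M" by measurable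
  qed
  then show "integrable M (\<lambda>\<omega>. (a \<omega>)\<^sup>2)"
    using a_le by (intro M.integrable_const_bound[where B = "(h * R)\<^sup>2"]) auto
  \<comment> \<open>\<open>a\<close> is given only through its sign and its square, so its
    measurability is that of the root of a kernel average.\<close>
  have "a = (\<lambda>\<omega>. sqrt ((a \<omega>)\<^sup>2))" using a(1) by simp
  then have a_meas: "a \<in> borel_measurable M"
    using measurable_compose[OF a2_meas borel_measurable_sqrt] by simp
  have Fa_le: "0 \<le> F (a \<omega>) \<and> F (a \<omega>) \<le> B" for \<omega>
    using bound[OF a(1) a_le'] .
  then show int_Fa: "integrable M (\<lambda>\<omega>. F (a \<omega>))"
    using measurable_compose[OF a_meas F_borel]
    by (intro M.integrable_const_bound[where B = B]) auto
  have T: "integrable M T" "(\<integral>\<omega>. T \<omega> \<partial>M) = 2 * real DIM('a) * (\<integral>\<omega>. F (a \<omega>) \<partial>M)"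
    using int_Fa by (simp_all add: T_def gradient_constraint_def)
  note T' = integral_snd_prob[OF Q M T(1), unfolded case_prod_unfold]
  show T_eq: "(\<integral>x. T (snd x) \<partial>(Q \<Otimes>\<^sub>M M)) = 2 * real DIM('a) * (\<integral>\<omega>. F (a \<omega>) \<partial>M)"
    unfolding T'(2) by (rule T(2))
  show "(\<integral>x. E x - T (snd x) \<partial>(Q \<Otimes>\<^sub>M M)) = 2 * real DIM('a) * ((\<integral>\<omega>. E' \<omega> \<partial>M) - (\<integral>\<omega>. F (a \<omega>) \<partial>M))"
    using int_E T'(1) by (simp add: int_eq T_eq right_diff_distrib)
qed

theorem theorem1:
  fixes P :: "'v measure" and X :: "'a::euclidean_space \<Rightarrow> 'v \<Rightarrow> real"
    and Q :: "'x measure" and Xs :: "'a \<Rightarrow> 'x \<Rightarrow> real"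
    and M :: "'w measure" and U :: "nat \<Rightarrow> 'w \<Rightarrow> 'a"
    and F K :: "real \<Rightarrow> real" and R :: real
    and \<Omega> :: "nat \<Rightarrow> 'a set" and L h :: "nat \<Rightarrow> real" and a :: "nat \<Rightarrow> 'w \<Rightarrow> real"
    and f\<^sub>1 :: "'a \<Rightarrow> real" and f\<^sub>2 :: "'a \<times> 'a \<Rightarrow> real" and f\<^sub>3 :: "'a \<times> 'a \<times> 'a \<Rightarrow> real"
    and f\<^sub>c :: "'a \<Rightarrow> 'a \<Rightarrow> real"
    and \<psi> :: "real \<Rightarrow> real \<Rightarrow> real \<Rightarrow> real \<Rightarrow> real" and \<xi> c\<^sub>1 :: real
    and g\<^sub>1 :: "real \<Rightarrow> real" and g\<^sub>2 :: "real \<Rightarrow> real \<Rightarrow> real \<Rightarrow> real"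
    and g\<^sub>3 :: "real \<Rightarrow> real \<Rightarrow> real \<Rightarrow> 'a \<Rightarrow> 'a \<Rightarrow> 'a \<Rightarrow> real"
  assumes model: "stationary_isotropic_field P X" "is_semivariogram P X F"
    and data: "prob_space Q" "case_prod Xs \<in> borel_measurable (borel \<Otimes>\<^sub>M Q)"
    and kernel: "compact_kernel K R"
    and design: "prob_space M"
      "\<And>i. i \<ge> 1 \<Longrightarrow> U i \<in> measurable M borel"
      "\<And>i \<omega>. i \<ge> 1 \<Longrightarrow> \<omega> \<in> space M \<Longrightarrow> U i \<omega> \<in> cbox 0 One"
      "\<And>n i \<omega>. i \<in> {1..n} \<Longrightarrow> \<omega> \<in> space M \<Longrightarrow> L n *\<^sub>R U i \<omega> \<in> \<Omega> n"
    and scale: "\<exists>c>0. \<forall>n. L n = c * measure lebesgue (convex hull \<Omega> n) powr (1 / real DIM('a))"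
    and volume: "filterlim (\<lambda>n. measure lebesgue (convex hull \<Omega> n)) at_top sequentially"
    and bandwidth_pos: "\<And>n. h n > 0"
    and consistency: "\<And>n \<omega>. a n \<omega> \<ge> 0"
      "\<And>n \<omega>. (a n \<omega>)\<^sup>2 = kernel_average K (h n) n (\<lambda>i. L n *\<^sub>R U i \<omega>)
                  (\<lambda>i j. (norm (L n *\<^sub>R U i \<omega> - L n *\<^sub>R U j \<omega>))\<^sup>2)"
    and c1: "prob_space.indep_vars M (\<lambda>_. borel) U {1..}"
      "\<And>i j. i \<ge> 1 \<Longrightarrow> j \<ge> 1 \<Longrightarrow> distr M borel (U i) = distr M borel (U j)"
    and c2: "\<And>i j. i \<ge> 1 \<Longrightarrow> j \<ge> 1 \<Longrightarrow> i \<noteq> j \<Longrightarrow> is_pdf M (\<lambda>\<omega>. U i \<omega> - U j \<omega>) f\<^sub>1"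
      "C1_near_zero f\<^sub>1"
    and c3: "\<And>i j k. i \<ge> 1 \<Longrightarrow> j \<ge> 1 \<Longrightarrow> k \<ge> 1 \<Longrightarrow> distinct [i, j, k] \<Longrightarrow>
        is_pdf M (\<lambda>\<omega>. (U i \<omega> - U j \<omega>, U i \<omega> - U k \<omega>)) f\<^sub>2"
      "C1_near_zero f\<^sub>2"
      "\<And>i j k l. i \<ge> 1 \<Longrightarrow> j \<ge> 1 \<Longrightarrow> k \<ge> 1 \<Longrightarrow> l \<ge> 1 \<Longrightarrow> distinct [i, j, k, l] \<Longrightarrow>
        is_pdf M (\<lambda>\<omega>. (U i \<omega> - U j \<omega>, U i \<omega> - U k \<omega>, U i \<omega> - U l \<omega>)) f\<^sub>3"
      "C1_near_zero f\<^sub>3"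
    and c4: "\<And>i j. i \<ge> 1 \<Longrightarrow> j \<ge> 1 \<Longrightarrow> i \<noteq> j \<Longrightarrow>
        is_conditional_pdf M (\<lambda>\<omega>. U i \<omega> - U j \<omega>) (U j) f\<^sub>c"
      "\<exists>C. \<forall>u x. f\<^sub>c u x \<le> C"
    and c5: "same_joint_moments P X Q Xs"
    and c6: "\<exists>\<delta>>0. continuous_on {-\<delta><..<\<delta>} F"
    and c7: "continuous_on ({0..} \<times> {0..} \<times> {0..} \<times> {0..}) (\<lambda>(r, s, t, u). \<psi> r s t u)"
      "\<exists>C. \<forall>r\<ge>0. \<forall>s\<ge>0. \<forall>t\<ge>0. \<forall>u\<ge>0. \<bar>\<psi> r s t u\<bar> \<le> C"
      "squared_increment_covariance Q Xs \<psi>"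
    and c8: "\<xi> > 0" "c\<^sub>1 \<ge> 1" "short_distance_expansion \<psi> \<xi> c\<^sub>1 g\<^sub>1 g\<^sub>2 g\<^sub>3"
    and c9: "radial_integral_bounded R g\<^sub>3"
    and c10: "h \<longlonglongrightarrow> 0"
    and c11: "(\<lambda>n. measure lebesgue (convex hull \<Omega> n) / real n) \<longlonglongrightarrow> 0"
    and smooth: "four_times_differentiable_near_zero F"
  shows "asymptotically_unbiased (Q \<Otimes>\<^sub>M M)
      (\<lambda>n (w, \<omega>). sample_gradient_constraint K (h n) n
         (\<lambda>i. L n *\<^sub>R U i \<omega>) (\<lambda>i. Xs (L n *\<^sub>R U i \<omega>) w))
      (\<lambda>n (w, \<omega>). gradient_constraint DIM('a) F (a n \<omega>))
    \<and> (\<exists>\<rho>\<^sub>1 \<rho>\<^sub>2 :: nat \<Rightarrow> real.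
        \<rho>\<^sub>1 \<in> O(\<lambda>n. (h n)\<^sup>2 * (h n / L n)) \<and> \<rho>\<^sub>2 \<in> o(\<lambda>n. h n ^ 4) \<and>
        (\<forall>n. (\<integral>(w, \<omega>). sample_gradient_constraint K (h n) n
                  (\<lambda>i. L n *\<^sub>R U i \<omega>) (\<lambda>i. Xs (L n *\<^sub>R U i \<omega>) w)
                - gradient_constraint DIM('a) F (a n \<omega>) \<partial>(Q \<Otimes>\<^sub>M M))
          = 2 * real DIM('a) * ((deriv ^^ 4) F 0 / fact 4) * h n ^ 4
              * (moment_ratio K R DIM('a) 4 - (moment_ratio K R DIM('a) 2)\<^sup>2)
            + \<rho>\<^sub>1 n + \<rho>\<^sub>2 n))"
proof -

  \<comment> \<open>The semivariogram near zero\<close>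
  interpret iid_design M U f\<^sub>1 f\<^sub>2
    by (intro iid_design.intro iid_design_axioms.intro design c1 c2 c3 C1_near_zero_isCont)
  have R: "R > 0" and K_borel: "K \<in> borel_measurable borel" using kernel by (auto simp: compact_kernel_def)
  note inc = same_joint_moments_increments[OF model c5]
  note F_nonneg = semivariogram_nonneg[OF model(2)]
  note F_even = semivariogram_even[OF model(2)]
  note F_0 = semivariogram_0[OF model(2)]
  note F_borel = semivariogram_measurable[OF data inc(2) F_even]
  define d where "d = real DIM('a)"
  have d: "d > 0" by (simp add: d_def)
  define \<tau>2 where "\<tau>2 = (deriv ^^ 2) F 0 / 2"
  define \<tau>4 where "\<tau>4 = (deriv ^^ 4) F 0 / fact 4"
  have expansion: "\<exists>\<delta>>0. \<forall>r. 0 \<le> r \<and> r < \<delta> \<longrightarrow> \<bar>F r - \<tau>2 * r\<^sup>2 - \<tau>4 * r ^ 4\<bar> \<le> \<epsilon> * r ^ 4"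
    if "\<epsilon> > 0" for \<epsilon>
    unfolding \<tau>2_def \<tau>4_def by (rule even_quartic_expansion[OF smooth F_even F_0 that])
  \<comment> \<open>The choice \<open>\<epsilon> = 1\<close> fixes a radius on which
    \<open>F\<close> differs from \<open>\<tau>2 * r\<^sup>2\<close> by at most
    \<open>C * r ^ 4\<close> and is bounded.\<close>
  obtain \<delta>\<^sub>1 where \<delta>\<^sub>1: "\<delta>\<^sub>1 > 0"
    and exp1: "\<And>r. 0 \<le> r \<Longrightarrow> r < \<delta>\<^sub>1 \<Longrightarrow> \<bar>F r - \<tau>2 * r\<^sup>2 - \<tau>4 * r ^ 4\<bar> \<le> 1 * r ^ 4"
    using expansion[OF zero_less_one] by blast
  define C where "C = \<bar>\<tau>4\<bar> + 1"
  have C: "C > 0" by (simp add: C_def)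
  have quad: "\<bar>F r - \<tau>2 * r\<^sup>2\<bar> \<le> C * r ^ 4" if "0 \<le> r" "r < \<delta>\<^sub>1" for r
  proof -
    have "\<bar>F r - \<tau>2 * r\<^sup>2\<bar> \<le> \<bar>\<tau>4 * r ^ 4\<bar> + 1 * r ^ 4" using exp1[OF that] by linarith
    then show ?thesis using that by (simp add: C_def abs_mult distrib_right)
  qed
  have F_le: "F r \<le> \<bar>\<tau>2\<bar> * \<delta>\<^sub>1\<^sup>2 + C * \<delta>\<^sub>1 ^ 4" if "0 \<le> r" "r < \<delta>\<^sub>1" for r
  proof -
    have "F r \<le> \<tau>2 * r\<^sup>2 + C * r ^ 4" using quad[OF that] by linarith
    also have "\<tau>2 * r\<^sup>2 \<le> \<bar>\<tau>2\<bar> * \<delta>\<^sub>1\<^sup>2"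
      using that by (intro mult_mono power_mono) auto
    also have "C * r ^ 4 \<le> C * \<delta>\<^sub>1 ^ 4"
      using that C by (intro mult_left_mono power_mono) auto
    finally show ?thesis by simp
  qed

  \<comment> \<open>Bias and constraints as expectations over the positions\<close>
  define E where "E n = (\<lambda>x. sample_gradient_constraint K (h n) n (\<lambda>i. L n *\<^sub>R U i (snd x))
      (\<lambda>i. Xs (L n *\<^sub>R U i (snd x)) (fst x)))" for n
  define T where "T n \<omega> = gradient_constraint DIM('a) F (a n \<omega>)" for n \<omega>
  define avg where "avg n A = (\<lambda>\<omega>. kernel_average K (h n) n (\<lambda>i. L n *\<^sub>R U i \<omega>)
      (\<lambda>i j. A (norm (L n *\<^sub>R U i \<omega> - L n *\<^sub>R U j \<omega>))))" for n and A :: "real \<Rightarrow> real"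
  define bias where "bias n = (\<integral>x. E n x - T n (snd x) \<partial>(Q \<Otimes>\<^sub>M M))" for n

  have small: "\<forall>\<^sub>F n in sequentially. h n * R < \<delta>" if "\<delta> > 0" for \<delta>
  proof -
    have "(\<lambda>n. h n * R) \<longlonglongrightarrow> 0 * R" by (intro tendsto_intros c10)
    then show ?thesis using that by (auto dest: order_tendstoD(2))
  qed
  have s_meas: "(\<lambda>\<omega>. L n *\<^sub>R U i \<omega>) \<in> borel_measurable M" if "i \<in> {1..n}" for i n
    using U_measurable[of i] that by auto
  have avg_borel: "avg n A \<in> borel_measurable M" if [measurable]: "A \<in> borel_measurable borel" for n A
    unfolding avg_def
  proof (intro kernel_average_measurable K_borel s_meas)
    fix i j assume "i \<in> {1..n}" "j \<in> {1..n}"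
    note [measurable] = s_meas[OF this(1)] s_meas[OF this(2)]
    show "(\<lambda>\<omega>. A (norm (L n *\<^sub>R U i \<omega> - L n *\<^sub>R U j \<omega>))) \<in> borel_measurable M" by measurable
  qed

  have expect: "integrable M (avg n F) \<and> integrable M (\<lambda>\<omega>. F (a n \<omega>)) \<and> integrable M (\<lambda>\<omega>. (a n \<omega>)\<^sup>2)
      \<and> (\<integral>x. E n x \<partial>(Q \<Otimes>\<^sub>M M)) = 2 * d * expectation (avg n F)
      \<and> (\<integral>x. T n (snd x) \<partial>(Q \<Otimes>\<^sub>M M)) = 2 * d * expectation (\<lambda>\<omega>. F (a n \<omega>))
      \<and> bias n = 2 * d * (expectation (avg n F) - expectation (\<lambda>\<omega>. F (a n \<omega>)))"
    if "h n * R < \<delta>\<^sub>1" for n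
  proof -
    have bound: "0 \<le> F r \<and> F r \<le> \<bar>\<tau>2\<bar> * \<delta>\<^sub>1\<^sup>2 + C * \<delta>\<^sub>1 ^ 4" if "0 \<le> r" "r \<le> h n * R" for r
      using F_nonneg F_le that \<open>h n * R < \<delta>\<^sub>1\<close> by auto
    show ?thesis
      using gradient_constraint_expectations[where s = "\<lambda>i \<omega>. L n *\<^sub>R U i \<omega>" and h = "h n" and n = n
          and a = "a n", OF data(1) design(1) data(2) s_meas inc F_borel kernel bandwidth_pos bound consistency]
      unfolding E_def T_def avg_def bias_def d_def by blast
  qed

  \<comment> \<open>Bias relative to each of the two constraints\<close>
  have unbiased_small: "\<forall>\<^sub>F n in sequentially. \<bar>bias n\<bar> \<le> c * \<bar>\<integral>x. E n x \<partial>(Q \<Otimes>\<^sub>M M)\<bar>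
      \<and> \<bar>bias n\<bar> \<le> c * \<bar>\<integral>x. T n (snd x) \<partial>(Q \<Otimes>\<^sub>M M)\<bar>" if c: "c > 0" for c
  proof (cases "\<tau>2 > 0")
    \<comment> \<open>If \<open>\<tau>2 \<le> 0\<close>, the expansion bounds \<open>F\<close> by
      \<open>C * r ^ 4\<close>, which forces \<open>F\<close> to vanish. The bias is then zero as
      soon as the kernel range is small enough.\<close>
    case False
    have "F r = 0" for r
    proof (rule semivariogram_eq_0[OF model \<delta>\<^sub>1])
      fix r assume r: "0 \<le> r" "r < \<delta>\<^sub>1"
      have "\<tau>2 * r\<^sup>2 \<le> 0" using False by (simp add: mult_nonpos_nonneg)
      then show "F r \<le> C * r ^ 4" using quad[OF r] by linarith
    qed
    then have "avg n F \<omega> = 0" "F (a n \<omega>) = 0" for n \<omega>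
      by (simp_all add: avg_def kernel_average_def)
    then have "avg n F = (\<lambda>\<omega>. 0)" "(\<lambda>\<omega>. F (a n \<omega>)) = (\<lambda>\<omega>. 0)" for n by auto
    then have "expectation (avg n F) = 0" "expectation (\<lambda>\<omega>. F (a n \<omega>)) = 0" for n by simp_all
    then have "bias n = 0" if "h n * R < \<delta>\<^sub>1" for n using expect[OF that] by simp
    then show ?thesis
      using small[OF \<delta>\<^sub>1] c by (auto elim: eventually_mono)
  next
    case True
    \<comment> \<open>With \<open>A\<close> the mean of \<open>a\<^sup>2\<close>, the bound
      \<open>\<epsilon> \<le> \<tau>2 / 2\<close> keeps both expectations above
      \<open>\<tau>2 * A / 2\<close>, and \<open>4 * \<epsilon> \<le> c * \<tau>2\<close> makes
      their difference, at most \<open>2 * \<epsilon> * A\<close>, no larger than \<open>c\<close>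
      times that. The radius \<open>sqrt (\<epsilon> / C)\<close> turns \<open>C * r ^ 4\<close>
      into \<open>\<epsilon> * r\<^sup>2\<close>.\<close>
    define \<epsilon> where "\<epsilon> = min (\<tau>2 / 2) (c * \<tau>2 / 4)"
    have \<epsilon>: "\<epsilon> > 0" "\<epsilon> \<le> \<tau>2 / 2" "4 * \<epsilon> \<le> c * \<tau>2" using True c by (auto simp: \<epsilon>_def min_def)
    define \<delta> where "\<delta> = min \<delta>\<^sub>1 (sqrt (\<epsilon> / C))"
    have \<delta>: "\<delta> > 0" using \<delta>\<^sub>1 \<epsilon> C by (simp add: \<delta>_def)
    have F_quad: "\<bar>F r - \<tau>2 * r\<^sup>2\<bar> \<le> \<epsilon> * r\<^sup>2" if "0 \<le> r" "r < \<delta>" for r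
    proof -
      have "r < sqrt (\<epsilon> / C)" using that by (simp add: \<delta>_def)
      then have "r\<^sup>2 < (sqrt (\<epsilon> / C))\<^sup>2" using that by (intro power_strict_mono) auto
      then have "C * r\<^sup>2 \<le> \<epsilon>" using C \<epsilon> by (simp add: field_simps)
      then have "C * r\<^sup>2 * r\<^sup>2 \<le> \<epsilon> * r\<^sup>2" by (intro mult_right_mono) auto
      then show ?thesis using quad[of r] that by (simp add: \<delta>_def power_eq_if mult_ac)
    qed
    show ?thesis using small[OF \<delta>] small[OF \<delta>\<^sub>1]
    proof eventually_elim
      case (elim n)
      note ex = expect[OF elim(2)]
      define I where "I = expectation (avg n F)"
      define J where "J = expectation (\<lambda>\<omega>. F (a n \<omega>))"
      define A where "A = expectation (\<lambda>\<omega>. (a n \<omega>)\<^sup>2)"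
      have A: "A \<ge> 0" by (simp add: A_def)
      have bounds: "\<bar>avg n F \<omega> - \<tau>2 * (a n \<omega>)\<^sup>2\<bar> \<le> \<epsilon> * (a n \<omega>)\<^sup>2"
        "\<bar>F (a n \<omega>) - \<tau>2 * (a n \<omega>)\<^sup>2\<bar> \<le> \<epsilon> * (a n \<omega>)\<^sup>2" for \<omega>
        unfolding avg_def using F_quad elim
        by (intro kernel_average_quadratic_bounds[OF kernel bandwidth_pos consistency]; auto)+
      have mean: "\<bar>expectation g - \<tau>2 * A\<bar> \<le> \<epsilon> * A"
        if g: "integrable M g" "\<And>\<omega>. \<bar>g \<omega> - \<tau>2 * (a n \<omega>)\<^sup>2\<bar> \<le> \<epsilon> * (a n \<omega>)\<^sup>2" for g
      proof -
        have "\<bar>expectation g - \<tau>2 * A\<bar> = \<bar>expectation (\<lambda>\<omega>. g \<omega> - \<tau>2 * (a n \<omega>)\<^sup>2)\<bar>"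
          using g(1) ex by (simp add: A_def)
        also have "\<dots> \<le> expectation (\<lambda>\<omega>. \<bar>g \<omega> - \<tau>2 * (a n \<omega>)\<^sup>2\<bar>)" by (rule integral_abs_bound)
        also have "\<dots> \<le> expectation (\<lambda>\<omega>. \<epsilon> * (a n \<omega>)\<^sup>2)"
          using g ex by (intro integral_mono) auto
        finally show ?thesis by (simp add: A_def)
      qed
      have I: "\<bar>I - \<tau>2 * A\<bar> \<le> \<epsilon> * A" and J: "\<bar>J - \<tau>2 * A\<bar> \<le> \<epsilon> * A"
        unfolding I_def J_def using ex bounds by (auto intro!: mean)
      have "\<epsilon> * A \<le> \<tau>2 / 2 * A" "4 * \<epsilon> * A \<le> c * \<tau>2 * A"
        using \<epsilon> A by (intro mult_right_mono; simp)+
      then have eA: "\<epsilon> * A \<le> \<tau>2 * A / 2" "2 * (\<epsilon> * A) \<le> c * (\<tau>2 * A / 2)" by (simp_all add: algebra_simps)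
      have "\<tau>2 * A / 2 \<le> I" "\<tau>2 * A / 2 \<le> J" using I J eA(1) by linarith+
      then have "c * (\<tau>2 * A / 2) \<le> c * \<bar>I\<bar>" "c * (\<tau>2 * A / 2) \<le> c * \<bar>J\<bar>"
        using c by (auto intro!: mult_left_mono)
      moreover have "\<bar>I - J\<bar> \<le> 2 * (\<epsilon> * A)" using I J by linarith
      ultimately have "\<bar>I - J\<bar> \<le> c * \<bar>I\<bar>" "\<bar>I - J\<bar> \<le> c * \<bar>J\<bar>" using eA(2) by linarith+
      then have "2 * d * \<bar>I - J\<bar> \<le> 2 * d * (c * \<bar>I\<bar>)" "2 * d * \<bar>I - J\<bar> \<le> 2 * d * (c * \<bar>J\<bar>)"
        using d by (auto intro!: mult_left_mono)
      then show ?case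
        using ex d by (simp add: I_def[symmetric] J_def[symmetric] abs_mult mult.left_commute)
    qed
  qed

  \<comment> \<open>The bias through rescaled kernel averages\<close>
  define B where "B = moment_ratio K R DIM('a) 4 - (moment_ratio K R DIM('a) 2)\<^sup>2"
  define r where "r q n \<omega> = avg n (\<lambda>r. r ^ q) \<omega> / h n ^ q" for q n \<omega>
  \<comment> \<open>Unless all weights vanish, the integrand is the variance of
    \<open>(s / h)\<^sup>2\<close> under the kernel weights, where \<open>s\<close> is the distance
    of a pair. \<open>B\<close> is the value to which its mean tends when many pairs are in
    range.\<close>
  define V where "V n = expectation (\<lambda>\<omega>. r 4 n \<omega> - (r 2 n \<omega>)\<^sup>2)" for n
  define e where "e n = bias n - 2 * d * \<tau>4 * h n ^ 4 * B" for n
  have r_bounds: "0 \<le> r q n \<omega>" "r q n \<omega> \<le> R ^ q" for q n \<omega>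
    using kernel_average_norm_power[OF kernel bandwidth_pos, of n n "\<lambda>i. L n *\<^sub>R U i \<omega>" q] bandwidth_pos[of n]
    by (simp_all add: r_def avg_def divide_le_eq power_mult_distrib mult.commute)
  have r_meas: "r q n \<in> borel_measurable M" for q n
    unfolding r_def by (intro borel_measurable_divide avg_borel) auto
  have r_int: "integrable M (r q n)" for q n
    using r_meas r_bounds[of q n] by (intro integrable_const_bound[where B = "R ^ q"]) auto
  have r2_le: "(r 2 n \<omega>)\<^sup>2 \<le> R ^ 4" for n \<omega>
    using power_mono[OF r_bounds(2,1), of 2 n \<omega> 2] by simp
  have r2_int: "integrable M (\<lambda>\<omega>. (r 2 n \<omega>)\<^sup>2)" for n
    using r_meas[of 2 n] r2_le by (intro integrable_const_bound[where B = "R ^ 4"]) auto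
  have V_le: "\<bar>V n\<bar> \<le> R ^ 4" for n
  proof -
    have "\<bar>V n\<bar> \<le> expectation (\<lambda>\<omega>. \<bar>r 4 n \<omega> - (r 2 n \<omega>)\<^sup>2\<bar>)"
      unfolding V_def by (rule integral_abs_bound)
    also have "\<dots> \<le> expectation (\<lambda>\<omega>. R ^ 4)"
    proof (intro integral_mono)
      fix \<omega>
      show "\<bar>r 4 n \<omega> - (r 2 n \<omega>)\<^sup>2\<bar> \<le> R ^ 4"
        using r_bounds[of 4 n \<omega>] r2_le[of n \<omega>] zero_le_power2[of "r 2 n \<omega>"] by linarith
    qed (use r_int r2_int in auto)
    finally show ?thesis by (simp add: prob_space)
  qed

  \<comment> \<open>Valid in both regimes, since the cancellation takes place at each configuration.
    The constant is \<open>2 * d\<close> times the defect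
    \<open>2 * \<epsilon> * (h * R) ^ 4\<close>.\<close>
  have bias_V: "\<forall>\<^sub>F n in sequentially. \<bar>bias n - 2 * d * \<tau>4 * h n ^ 4 * V n\<bar> \<le> 4 * d * \<epsilon> * R ^ 4 * h n ^ 4"
    if \<epsilon>: "\<epsilon> > 0" for \<epsilon>
  proof -
    obtain \<delta> where \<delta>: "\<delta> > 0"
      and exp: "\<And>r. 0 \<le> r \<Longrightarrow> r < \<delta> \<Longrightarrow> \<bar>F r - \<tau>2 * r\<^sup>2 - \<tau>4 * r ^ 4\<bar> \<le> \<epsilon> * r ^ 4"
      using expansion[OF \<epsilon>] by blast
    show ?thesis using small[OF \<delta>] small[OF \<delta>\<^sub>1]
    proof eventually_elim
      case (elim n)
      note ex = expect[OF elim(2)]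
      have h: "h n > 0" by (rule bandwidth_pos)
      define g where "g \<omega> = avg n F \<omega> - F (a n \<omega>) - \<tau>4 * h n ^ 4 * (r 4 n \<omega> - (r 2 n \<omega>)\<^sup>2)" for \<omega>
      have g_eq: "g \<omega> = avg n F \<omega> - F (a n \<omega>) - \<tau>4 * (avg n (\<lambda>r. r ^ 4) \<omega> - (avg n (\<lambda>r. r\<^sup>2) \<omega>)\<^sup>2)" for \<omega>
      proof -
        have "(h n)\<^sup>2 ^ 2 = h n ^ 4" by (simp flip: power_mult)
        then have "h n ^ 4 * (r 4 n \<omega> - (r 2 n \<omega>)\<^sup>2) = avg n (\<lambda>r. r ^ 4) \<omega> - (avg n (\<lambda>r. r\<^sup>2) \<omega>)\<^sup>2"
          using h by (simp add: r_def power_divide right_diff_distrib)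
        then show ?thesis by (simp add: g_def mult.assoc)
      qed
      have g_le: "\<bar>g \<omega>\<bar> \<le> 2 * \<epsilon> * (h n * R) ^ 4" for \<omega>
        unfolding g_eq avg_def using exp elim \<epsilon>
        by (intro kernel_average_quartic_defect[where ?\<tau>2.0 = \<tau>2, OF kernel h consistency(1) _ consistency(2)])
          auto
      have g_int: "integrable M g"
        unfolding g_def using ex r_int r2_int by auto
      have "\<bar>expectation g\<bar> \<le> expectation (\<lambda>\<omega>. \<bar>g \<omega>\<bar>)" by (rule integral_abs_bound)
      also have "\<dots> \<le> expectation (\<lambda>\<omega>. 2 * \<epsilon> * (h n * R) ^ 4)"
        using g_le g_int by (intro integral_mono) auto
      finally have "\<bar>expectation g\<bar> \<le> 2 * \<epsilon> * (h n * R) ^ 4" by (simp add: prob_space)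
      then have "2 * d * \<bar>expectation g\<bar> \<le> 2 * d * (2 * \<epsilon> * (h n * R) ^ 4)"
        using d by (intro mult_left_mono) auto
      moreover have "expectation g = expectation (avg n F) - expectation (\<lambda>\<omega>. F (a n \<omega>)) - \<tau>4 * h n ^ 4 * V n"
        unfolding g_def V_def using ex r_int r2_int by simp
      then have "2 * d * expectation g
          = 2 * d * (expectation (avg n F) - expectation (\<lambda>\<omega>. F (a n \<omega>))) - 2 * d * \<tau>4 * h n ^ 4 * V n"
        by (simp add: right_diff_distrib mult.assoc)
      then have "2 * d * expectation g = bias n - 2 * d * \<tau>4 * h n ^ 4 * V n"
        using ex by simp
      then have "\<bar>bias n - 2 * d * \<tau>4 * h n ^ 4 * V n\<bar> = 2 * d * \<bar>expectation g\<bar>"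
        using d by (metis abs_mult abs_of_pos mult_pos_pos zero_less_numeral)
      ultimately show ?case by (simp add: power_mult_distrib mult_ac)
    qed
  qed

  define C' where "C' = 2 * d * (2 * R ^ 4 + \<bar>\<tau>4\<bar> * (R ^ 4 + \<bar>B\<bar>))"
  have C': "C' \<ge> 0" using d R by (simp add: C'_def)
  \<comment> \<open>Separates the remainder of the expansion, arbitrarily small in both regimes,
    from \<open>V n - B\<close>, which is always bounded but is shown to be small only along
    \<open>G\<close>.\<close>
  have e_le: "\<forall>\<^sub>F n in sequentially. \<bar>e n\<bar> \<le> 2 * d * (2 * \<epsilon> * R ^ 4 + \<bar>\<tau>4\<bar> * \<bar>V n - B\<bar>) * h n ^ 4"
    if "\<epsilon> > 0" for \<epsilon>
    using bias_V[OF that]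
  proof eventually_elim
    case (elim n)
    have "e n = (bias n - 2 * d * \<tau>4 * h n ^ 4 * V n) + 2 * d * \<tau>4 * h n ^ 4 * (V n - B)"
      by (simp add: e_def algebra_simps)
    then have "\<bar>e n\<bar> \<le> 4 * d * \<epsilon> * R ^ 4 * h n ^ 4 + \<bar>2 * d * \<tau>4 * h n ^ 4 * (V n - B)\<bar>"
      using elim by linarith
    also have "\<bar>2 * d * \<tau>4 * h n ^ 4 * (V n - B)\<bar> = 2 * d * (\<bar>\<tau>4\<bar> * \<bar>V n - B\<bar>) * h n ^ 4"
      using d bandwidth_pos[of n] by (simp add: abs_mult)
    finally show ?case by (simp add: algebra_simps)
  qed
  have e_le_C': "\<forall>\<^sub>F n in sequentially. \<bar>e n\<bar> \<le> C' * h n ^ 4"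
    using e_le[OF zero_less_one]
  proof eventually_elim
    case (elim n)
    have "\<bar>V n - B\<bar> \<le> R ^ 4 + \<bar>B\<bar>" using V_le[of n] by linarith
    then have "2 * d * (2 * 1 * R ^ 4 + \<bar>\<tau>4\<bar> * \<bar>V n - B\<bar>) * h n ^ 4 \<le> C' * h n ^ 4"
      unfolding C'_def using d bandwidth_pos[of n]
      by (intro mult_right_mono mult_left_mono add_mono) auto
    with elim show ?case by linarith
  qed

  \<comment> \<open>The regime with many pairs in range\<close>
  obtain c where c: "c > 0" and L_eq: "\<And>n. L n = c * measure lebesgue (convex hull \<Omega> n) powr (1 / d)"
    using scale unfolding d_def by blast
  define vol where "vol n = measure lebesgue (convex hull \<Omega> n)" for n
  have vol_pos: "\<forall>\<^sub>F n in sequentially. vol n > 0"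
    using volume unfolding vol_def filterlim_at_top_dense by blast
  have L_pow: "L n ^ DIM('a) = c ^ DIM('a) * vol n" if "vol n > 0" for n
  proof -
    have "(vol n powr (1 / d)) ^ DIM('a) = vol n powr (1 / d * d)"
      using that by (subst powr_realpow[symmetric]) (simp_all add: powr_powr d_def)
    also have "\<dots> = vol n" using that d by simp
    finally show ?thesis by (simp add: L_eq vol_def[symmetric] power_mult_distrib)
  qed
  have L_pos: "\<forall>\<^sub>F n in sequentially. L n > 0"
    using vol_pos by eventually_elim (use c in \<open>simp add: L_eq vol_def[symmetric]\<close>)
  have L_top: "filterlim L at_top sequentially"
  proof -
    have "filterlim (\<lambda>x::real. exp (1 / d * ln x)) at_top at_top"
      using d by (intro filterlim_compose[OF exp_at_top]
          filterlim_tendsto_pos_mult_at_top[OF tendsto_const _ ln_at_top]) simp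
    moreover have "\<forall>\<^sub>F x::real in at_top. exp (1 / d * ln x) = x powr (1 / d)"
      using eventually_gt_at_top[of 0] by eventually_elim (simp add: powr_def)
    ultimately have "filterlim (\<lambda>x::real. x powr (1 / d)) at_top at_top"
      by (rule filterlim_cong[OF refl refl, THEN iffD1, rotated])
    then have "filterlim (\<lambda>n. vol n powr (1 / d)) at_top sequentially"
      using volume unfolding vol_def[symmetric] by (rule filterlim_compose)
    then show ?thesis
      unfolding L_eq vol_def[symmetric] using c
      by (intro filterlim_tendsto_pos_mult_at_top[OF tendsto_const])
  qed
  \<comment> \<open>Limits along \<open>G\<close> concern only the \<open>n\<close> with
    \<open>h n * L n \<ge> 1\<close>. If these are finitely many, \<open>G\<close> is the trivial
    filter and the limits hold vacuously.\<close>
  define G where "G = inf sequentially (principal {n. h n * L n \<ge> 1})"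
  have G: "G \<le> sequentially" by (simp add: G_def)
  have evG: "eventually P G" if "eventually P sequentially" for P
    using that G by (simp add: le_filter_def)
  have p_lim: "filterlim (\<lambda>n. h n / L n) (at_right 0) G"
  proof -
    have "(\<lambda>n. h n / L n) \<longlonglongrightarrow> 0"
      using c10 filterlim_at_top_imp_at_infinity[OF L_top] by (rule tendsto_divide_0)
    moreover have "\<forall>\<^sub>F n in sequentially. h n / L n > 0"
      using L_pos by eventually_elim (use bandwidth_pos in simp)
    ultimately have "filterlim (\<lambda>n. h n / L n) (at_right 0) sequentially"
      by (auto simp: filterlim_at elim: eventually_mono)
    then show ?thesis using G by (rule filterlim_mono[OF _ order.refl])
  qed
  \<comment> \<open>\<open>l\<close> is proportional to the volume, so the bound is a multiple of
    \<open>(vol n / n)\<^sup>2\<close>, which tends to zero by \<open>c11\<close>.\<close>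
  have many: "((\<lambda>n. 1 / ((real n)\<^sup>2 * (h n / L n) ^ DIM('a))) \<longlongrightarrow> 0) G"
  proof (rule Lim_null_comparison)
    have "(\<lambda>n. (c ^ DIM('a) * (vol n / real n))\<^sup>2) \<longlonglongrightarrow> (c ^ DIM('a) * 0)\<^sup>2"
      unfolding vol_def by (intro tendsto_intros c11)
    then show "((\<lambda>n. (c ^ DIM('a) * (vol n / real n))\<^sup>2) \<longlongrightarrow> 0) G"
      using G by (auto intro: tendsto_mono)
    have "\<forall>\<^sub>F n in G. h n * L n \<ge> 1" unfolding G_def by (simp add: eventually_inf_principal)
    then show "\<forall>\<^sub>F n in G. norm (1 / ((real n)\<^sup>2 * (h n / L n) ^ DIM('a))) \<le> (c ^ DIM('a) * (vol n / real n))\<^sup>2"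
      using evG[OF L_pos] evG[OF vol_pos] evG[OF eventually_gt_at_top[of 0]]
    proof eventually_elim
      case (elim n)
      define l where "l = L n ^ DIM('a)"
      have l: "l > 0" using elim by (simp add: l_def)
      have "1 \<le> (h n * L n) ^ DIM('a)" using elim(1) by (rule one_le_power)
      then have "1 \<le> h n ^ DIM('a) * l" by (simp add: power_mult_distrib l_def)
      then have "1 / l \<le> h n ^ DIM('a)" using l by (simp add: divide_le_eq)
      then have "1 / l / l \<le> h n ^ DIM('a) / l" using l by (intro divide_right_mono) auto
      then have "(real n)\<^sup>2 * (1 / l / l) \<le> (real n)\<^sup>2 * (h n / L n) ^ DIM('a)"
        by (intro mult_left_mono) (auto simp: power_divide l_def)
      then have "1 / ((real n)\<^sup>2 * (h n / L n) ^ DIM('a)) \<le> 1 / ((real n)\<^sup>2 * (1 / l / l))"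
        using l elim bandwidth_pos[of n] by (intro divide_left_mono mult_pos_pos) auto
      also have "\<dots> = (l / real n)\<^sup>2"
        using l elim by (simp add: power_divide power2_eq_square)
      also have "l / real n = c ^ DIM('a) * (vol n / real n)"
        using L_pow[of n] elim by (simp add: l_def)
      finally show ?case using elim bandwidth_pos[of n] by simp
    qed
  qed
  have r_lim: "((\<lambda>n. expectation (\<lambda>\<omega>. \<bar>r q n \<omega> - moment_ratio K R DIM('a) q\<bar>)) \<longlongrightarrow> 0) G" for q
    using kernel_average_tendsto[OF kernel bandwidth_pos evG[OF L_pos] p_lim G many, of q]
    unfolding r_def avg_def .
  \<comment> \<open>For the squared quotient, the difference of squares is at most
    \<open>R\<^sup>2 + \<bar>?m2\<bar>\<close> times
    \<open>\<bar>r 2 n \<omega> - ?m2\<bar>\<close>, so convergence in mean of \<open>r 2 n\<close>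
    suffices.\<close>
  have V_lim: "((\<lambda>n. V n - B) \<longlongrightarrow> 0) G"
  proof (rule Lim_null_comparison)
    let ?m2 = "moment_ratio K R DIM('a) 2" and ?m4 = "moment_ratio K R DIM('a) 4"
    let ?g = "\<lambda>n. expectation (\<lambda>\<omega>. \<bar>r 4 n \<omega> - ?m4\<bar>) + (R\<^sup>2 + \<bar>?m2\<bar>) * expectation (\<lambda>\<omega>. \<bar>r 2 n \<omega> - ?m2\<bar>)"
    have "(?g \<longlongrightarrow> 0 + (R\<^sup>2 + \<bar>?m2\<bar>) * 0) G"
      by (intro tendsto_intros r_lim)
    then show "(?g \<longlongrightarrow> 0) G" by simp
    have "norm (V n - B) \<le> ?g n" for n
    proof -
      have "V n - B = expectation (\<lambda>\<omega>. r 4 n \<omega> - (r 2 n \<omega>)\<^sup>2 - B)"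
        unfolding V_def using r_int r2_int by (simp add: prob_space)
      then have "norm (V n - B) \<le> expectation (\<lambda>\<omega>. \<bar>r 4 n \<omega> - (r 2 n \<omega>)\<^sup>2 - B\<bar>)"
        by (simp add: integral_abs_bound)
      also have "\<dots> \<le> expectation (\<lambda>\<omega>. \<bar>r 4 n \<omega> - ?m4\<bar> + (R\<^sup>2 + \<bar>?m2\<bar>) * \<bar>r 2 n \<omega> - ?m2\<bar>)"
      proof (rule integral_mono)
        fix \<omega>
        have "(r 2 n \<omega>)\<^sup>2 - ?m2\<^sup>2 = (r 2 n \<omega> + ?m2) * (r 2 n \<omega> - ?m2)"
          by (simp add: power2_eq_square algebra_simps)
        then have "\<bar>(r 2 n \<omega>)\<^sup>2 - ?m2\<^sup>2\<bar> = \<bar>r 2 n \<omega> + ?m2\<bar> * \<bar>r 2 n \<omega> - ?m2\<bar>"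
          by (simp only: abs_mult)
        also have "\<dots> \<le> (R\<^sup>2 + \<bar>?m2\<bar>) * \<bar>r 2 n \<omega> - ?m2\<bar>"
          using r_bounds[of 2 n \<omega>] by (intro mult_right_mono) auto
        finally show "\<bar>r 4 n \<omega> - (r 2 n \<omega>)\<^sup>2 - B\<bar> \<le> \<bar>r 4 n \<omega> - ?m4\<bar> + (R\<^sup>2 + \<bar>?m2\<bar>) * \<bar>r 2 n \<omega> - ?m2\<bar>"
          unfolding B_def by linarith
      qed (use r_int r2_int in auto)
      finally show ?thesis using r_int by simp
    qed
    then show "\<forall>\<^sub>F n in G. norm (V n - B) \<le> ?g n" by simp
  qed

  \<comment> \<open>The two remainders of the expansion\<close>
  define \<rho>\<^sub>1 where "\<rho>\<^sub>1 n = (if h n * L n < 1 then e n else 0)" for n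
  \<comment> \<open>In each regime one remainder carries the whole error and the other is zero.
    Since \<open>e\<close> is defined as a difference, the expansion is exact for every
    \<open>n\<close>, not only for large ones.\<close>
  define \<rho>\<^sub>2 where "\<rho>\<^sub>2 n = (if h n * L n < 1 then 0 else e n)" for n
  have "\<rho>\<^sub>1 \<in> O(\<lambda>n. (h n)\<^sup>2 * (h n / L n))"
  proof (rule bigoI)
    show "\<forall>\<^sub>F n in sequentially. norm (\<rho>\<^sub>1 n) \<le> C' * norm ((h n)\<^sup>2 * (h n / L n))"
      using e_le_C' L_pos
    proof eventually_elim
      case (elim n)
      show ?case
      proof (cases "h n * L n < 1")
        case True
        have h: "h n > 0" by (rule bandwidth_pos)
        have "h n ^ 4 = (h n)\<^sup>2 * (h n / L n) * (h n * L n)"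
          using elim by (simp add: power_eq_if)
        also have "\<dots> \<le> (h n)\<^sup>2 * (h n / L n)"
          using True h elim by (intro mult_left_le) auto
        finally have "C' * h n ^ 4 \<le> C' * ((h n)\<^sup>2 * (h n / L n))"
          using C' by (rule mult_left_mono)
        then show ?thesis using True elim h by (simp add: \<rho>\<^sub>1_def)
      qed (use C' in \<open>simp add: \<rho>\<^sub>1_def\<close>)
    qed
  qed
  moreover have "\<rho>\<^sub>2 \<in> o(\<lambda>n. h n ^ 4)"
  proof (rule landau_o.smallI)
    fix \<eta> :: real assume \<eta>: "\<eta> > 0"
    \<comment> \<open>Makes the contribution \<open>4 * d * \<epsilon> * R ^ 4\<close> of the
      expansion remainder equal to \<open>\<eta> / 2\<close>.\<close>
    define \<epsilon> where "\<epsilon> = \<eta> / (8 * d * R ^ 4)"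
    have \<epsilon>: "\<epsilon> > 0" using \<eta> d R by (simp add: \<epsilon>_def)
    have "((\<lambda>n. 2 * d * (2 * \<epsilon> * R ^ 4 + \<bar>\<tau>4\<bar> * \<bar>V n - B\<bar>)) \<longlongrightarrow> 2 * d * (2 * \<epsilon> * R ^ 4 + \<bar>\<tau>4\<bar> * \<bar>0\<bar>)) G"
      by (intro tendsto_intros V_lim)
    moreover have "2 * d * (2 * \<epsilon> * R ^ 4 + \<bar>\<tau>4\<bar> * \<bar>0\<bar>) < \<eta>"
      using d R \<eta> by (simp add: \<epsilon>_def)
    ultimately have "\<forall>\<^sub>F n in G. 2 * d * (2 * \<epsilon> * R ^ 4 + \<bar>\<tau>4\<bar> * \<bar>V n - B\<bar>) < \<eta>"
      by (rule order_tendstoD)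
    then have "\<forall>\<^sub>F n in G. \<bar>e n\<bar> \<le> \<eta> * h n ^ 4"
      using evG[OF e_le[OF \<epsilon>]]
    proof eventually_elim
      case (elim n)
      have "2 * d * (2 * \<epsilon> * R ^ 4 + \<bar>\<tau>4\<bar> * \<bar>V n - B\<bar>) * h n ^ 4 \<le> \<eta> * h n ^ 4"
        using elim(1) bandwidth_pos[of n] by (intro mult_right_mono) auto
      with elim(2) show ?case by linarith
    qed
    then have "\<forall>\<^sub>F n in sequentially. h n * L n \<ge> 1 \<longrightarrow> \<bar>e n\<bar> \<le> \<eta> * h n ^ 4"
      by (simp add: G_def eventually_inf_principal)
    then show "\<forall>\<^sub>F n in sequentially. norm (\<rho>\<^sub>2 n) \<le> \<eta> * norm (h n ^ 4)"
      by eventually_elim (use \<eta> bandwidth_pos in \<open>auto simp: \<rho>\<^sub>2_def not_less less_imp_le\<close>)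
  qed
  moreover have "bias n = 2 * d * \<tau>4 * h n ^ 4 * B + \<rho>\<^sub>1 n + \<rho>\<^sub>2 n" for n
    by (simp add: \<rho>\<^sub>1_def \<rho>\<^sub>2_def e_def)
  ultimately have rate: "\<exists>\<rho>\<^sub>1 \<rho>\<^sub>2 :: nat \<Rightarrow> real. \<rho>\<^sub>1 \<in> O(\<lambda>n. (h n)\<^sup>2 * (h n / L n)) \<and> \<rho>\<^sub>2 \<in> o(\<lambda>n. h n ^ 4) \<and>
      (\<forall>n. bias n = 2 * d * \<tau>4 * h n ^ 4 * B + \<rho>\<^sub>1 n + \<rho>\<^sub>2 n)"
    by blast

  \<comment> \<open>Vanishing of the bias and conclusion\<close>
  have "bias \<longlonglongrightarrow> 0"
  proof (rule Lim_null_comparison)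
    have "(\<lambda>n. C' * h n ^ 4 + \<bar>2 * d * \<tau>4 * h n ^ 4 * B\<bar>) \<longlonglongrightarrow> C' * 0 ^ 4 + \<bar>2 * d * \<tau>4 * 0 ^ 4 * B\<bar>"
      by (intro tendsto_intros c10)
    then show "(\<lambda>n. C' * h n ^ 4 + \<bar>2 * d * \<tau>4 * h n ^ 4 * B\<bar>) \<longlonglongrightarrow> 0" by simp
    show "\<forall>\<^sub>F n in sequentially. norm (bias n) \<le> C' * h n ^ 4 + \<bar>2 * d * \<tau>4 * h n ^ 4 * B\<bar>"
      using e_le_C' by eventually_elim (simp add: e_def)
  qed
  moreover have "bias \<in> o(\<lambda>n. \<integral>x. E n x \<partial>(Q \<Otimes>\<^sub>M M))" "bias \<in> o(\<lambda>n. \<integral>x. T n (snd x) \<partial>(Q \<Otimes>\<^sub>M M))"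
    by (rule landau_o.smallI, drule unbiased_small, erule eventually_mono, simp)+
  ultimately show ?thesis
    using rate
    unfolding asymptotically_unbiased_def case_prod_unfold bias_def E_def T_def d_def \<tau>4_def B_def
    by blast
qed

end
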